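(* Let $n\ge1$. The label distribution of a uniform random well labelled tree with $n$ edges has the same law as the profile of a uniform random rooted planar quadrangulation with $n$ faces: \[ (\lambda^{(n)}_k)_{k\geq1}\;\overset{\text{law}}{=}\;(H^{(n)}_k)_{k\geq1}. \] In particular $r_n\overset{\text{law}}{=}\mu_n$, where $r_n$ is the radius of the random quadrangulation and $\mu_n$ is the maximal label of the random well labelled tree.
   Context: A planar map is a proper embedding (without edge crossings) of a connected graph in the plane; loops and multiple edges are allowed. It is rooted if an edge on the border of the infinite face is distinguished and oriented counterclockwise; the origin of this edge is the root vertex. Rooted planar maps are considered up to (orientation-preserving) homeomorphisms of the plane respecting the root. A quadrangulation is a planar map all of whose faces have degree $4$. Let $L_n$ be uniform on the set of rooted quadrangulations with $n$ faces; $H^{(n)}_k$ is the number of vertices of $L_n$ at graph distance $k$ from the root vertex, and $r_n$ is the maximal distance of a vertex to the root vertex. A well labelled tree is a plane tree (rooted, children linearly ordered) with positive integer vertex labels such that adjacent labels differ by at most $1$ and the root vertex has label $1$. Let $W_n$ be uniform on the set of well labelled trees with $n$ edges; $\lambda^{(n)}_k$ is the number of vertices of $W_n$ with label $k$ and $\mu_n$ its maximal label. *)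

theory Defs
  imports
    "Graph_Theory.Bidirected_Digraph"
    "Graph_Theory.Digraph_Component"
    "HOL-Combinatorics.Orbits"
    "HOL-Probability.Probability_Mass_Function"
begin

section \<open>Rooted planar maps\<close>

text \<open>
  A map is a finite connected multigraph together with its rotation system. The edges are
  the pairs \<open>{a, map_rev m a}\<close> of opposite arcs (loops and parallel edges allowed), and
  \<open>map_rot m\<close> sends an arc to the next arc, in counterclockwise order, with the same tail.
  A walker who traverses \<open>a\<close> and then \<open>map_rot m (map_rev m a)\<close>, and so on, keeps one and
  the same face on the right, so a face is represented by the set of the arcs that have it on
  their right; an edge with the same face on both sides contributes both of its arcs to that
  face. This presentation determines an embedding up to orientation-preserving homeomorphism,
  the embedding being into the sphere exactly if Euler's formula holds. Naming the infinite
  face turns the sphere into the plane.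

  The border of the infinite face is oriented counterclockwise by having the infinite face on
  the right, so the root is an arc belonging to the infinite face. The map with one vertex and
  no edge is not covered; it has no root edge.
\<close>

record ('v, 'e) rooted_map =
  map_graph :: "('v, 'e) pre_digraph"
  map_rev :: "'e \<Rightarrow> 'e"
  map_rot :: "'e \<Rightarrow> 'e"
  infinite_face :: "'e set"
  root_arc :: "'e"

definition map_verts :: "('v, 'e) rooted_map \<Rightarrow> 'v set" where
  "map_verts m = verts (map_graph m)"

definition map_arcs :: "('v, 'e) rooted_map \<Rightarrow> 'e set" where
  "map_arcs m = arcs (map_graph m)"

definition map_faces :: "('v, 'e) rooted_map \<Rightarrow> 'e set set" where
  "map_faces m = orbit (map_rot m \<circ> map_rev m) ` map_arcs m"

definition face_degree :: "'e set \<Rightarrow> nat" where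
  "face_degree F = card F"

definition root_vertex :: "('v, 'e) rooted_map \<Rightarrow> 'v" where
  "root_vertex m = tail (map_graph m) (root_arc m)"

locale rooted_planar_map =
  fixes m :: "('v, 'e) rooted_map"
  assumes fin: "fin_digraph (map_graph m)"
    and bidirected: "bidirected_digraph (map_graph m) (map_rev m)"
    and connected: "Digraph_Component.connected (map_graph m)"
    and rot_permutes: "map_rot m permutes map_arcs m"
    and rot_cyclic: "\<And>v. v \<in> map_verts m \<Longrightarrow> out_arcs (map_graph m) v \<noteq> {} \<Longrightarrow>
                       cyclic_on (map_rot m) (out_arcs (map_graph m) v)"
    and euler: "int (card (map_verts m)) - int (card (map_arcs m) div 2)
                  + int (card (map_faces m)) = 2"
    and infinite_face: "infinite_face m \<in> map_faces m"
    and root_on_border: "root_arc m \<in> infinite_face m"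

text \<open>
  Isomorphisms stand for the orientation-preserving homeomorphisms of the plane that respect
  the root.
\<close>

definition rooted_map_iso ::
    "('v, 'e) rooted_map \<Rightarrow> ('w, 'f) rooted_map \<Rightarrow> ('v \<Rightarrow> 'w) \<Rightarrow> ('e \<Rightarrow> 'f) \<Rightarrow> bool" where
  "rooted_map_iso m m' f g \<longleftrightarrow>
     bij_betw f (map_verts m) (map_verts m') \<and>
     bij_betw g (map_arcs m) (map_arcs m') \<and>
     (\<forall>a\<in>map_arcs m. tail (map_graph m') (g a) = f (tail (map_graph m) a) \<and>
                     head (map_graph m') (g a) = f (head (map_graph m) a) \<and>
                     map_rev m' (g a) = g (map_rev m a) \<and>
                     map_rot m' (g a) = g (map_rot m a)) \<and>
     g ` infinite_face m = infinite_face m' \<and>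
     g (root_arc m) = root_arc m'"

definition graph_dist :: "('v, 'e) pre_digraph \<Rightarrow> 'v \<Rightarrow> 'v \<Rightarrow> nat" where
  "graph_dist G u v = (LEAST k. \<exists>p. pre_digraph.awalk G u p v \<and> length p = k)"

definition map_quadrangulation :: "('v, 'e) rooted_map \<Rightarrow> bool" where
  "map_quadrangulation m \<longleftrightarrow> (\<forall>F\<in>map_faces m. face_degree F = 4)"

definition map_profile :: "('v, 'e) rooted_map \<Rightarrow> nat \<Rightarrow> nat" where
  "map_profile m k = card {v \<in> map_verts m. graph_dist (map_graph m) (root_vertex m) v = k}"

definition map_radius :: "('v, 'e) rooted_map \<Rightarrow> nat" where
  "map_radius m = Max (graph_dist (map_graph m) (root_vertex m) ` map_verts m)"


subsection \<open>Invariance under isomorphism\<close>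

lemma rooted_planar_map_arcsD:
  assumes "rooted_planar_map m" "a \<in> map_arcs m"
  shows "map_rev m a \<in> map_arcs m" "map_rot m a \<in> map_arcs m"
    "tail (map_graph m) a \<in> map_verts m" "head (map_graph m) a \<in> map_verts m"
proof -
  interpret rooted_planar_map m by (rule assms(1))
  interpret bidirected_digraph "map_graph m" "map_rev m" by (rule bidirected)
  show "map_rev m a \<in> map_arcs m" "tail (map_graph m) a \<in> map_verts m"
    "head (map_graph m) a \<in> map_verts m"
    using assms(2) by (auto simp: map_arcs_def map_verts_def)
  show "map_rot m a \<in> map_arcs m"
    using assms(2) rot_permutes by (simp add: permutes_in_image)
qed

lemma orbit_arcs_subset:
  assumes "rooted_planar_map m" "a \<in> map_arcs m"
  shows "orbit (map_rot m \<circ> map_rev m) a \<subseteq> map_arcs m"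
proof
  fix b assume "b \<in> orbit (map_rot m \<circ> map_rev m) a"
  then show "b \<in> map_arcs m"
    by induction (use assms rooted_planar_map_arcsD[OF assms(1)] in auto)
qed

lemma faces_subset:
  assumes "rooted_planar_map m" "F \<in> map_faces m"
  shows "F \<subseteq> map_arcs m"
proof -
  obtain a where "a \<in> map_arcs m" "F = orbit (map_rot m \<circ> map_rev m) a"
    using assms(2) by (auto simp: map_faces_def)
  then show ?thesis using orbit_arcs_subset[OF assms(1)] by simp
qed

lemma root_arc_in_arcs:
  assumes "rooted_planar_map m" shows "root_arc m \<in> map_arcs m"
  using assms faces_subset rooted_planar_map.infinite_face rooted_planar_map.root_on_border
  by blast

lemma root_vertex_in_verts:
  assumes "rooted_planar_map m" shows "root_vertex m \<in> map_verts m"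
  unfolding root_vertex_def
  using rooted_planar_map_arcsD(3)[OF assms root_arc_in_arcs[OF assms]] .

lemma rooted_map_iso_refl: "rooted_map_iso m m id id"
  by (simp add: rooted_map_iso_def)

lemma rooted_map_iso_sym:
  assumes "rooted_planar_map m" "rooted_map_iso m m' f g"
  shows "rooted_map_iso m' m (the_inv_into (map_verts m) f) (the_inv_into (map_arcs m) g)"
proof -
  note arcsD = rooted_planar_map_arcsD[OF assms(1)]
  have f: "bij_betw f (map_verts m) (map_verts m')" and g: "bij_betw g (map_arcs m) (map_arcs m')"
    using assms(2) by (auto simp: rooted_map_iso_def)
  have f_inv: "the_inv_into (map_verts m) f (f v) = v" if "v \<in> map_verts m" for v
    using f that by (auto simp: bij_betw_def the_inv_into_f_f)
  have g_inv: "the_inv_into (map_arcs m) g (g a) = a" if "a \<in> map_arcs m" for a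
    using g that by (auto simp: bij_betw_def the_inv_into_f_f)
  have img: "map_arcs m' = g ` map_arcs m" using g by (simp add: bij_betw_def)
  have infF: "infinite_face m \<subseteq> map_arcs m"
    using assms(1) faces_subset rooted_planar_map.infinite_face by blast
  have inf': "infinite_face m' = g ` infinite_face m" "root_arc m' = g (root_arc m)"
    using assms(2) by (auto simp: rooted_map_iso_def)
  have "the_inv_into (map_arcs m) g ` infinite_face m' = infinite_face m"
    unfolding inf' image_image using g_inv infF by (auto simp: image_def subset_iff)
  moreover have "the_inv_into (map_arcs m) g (root_arc m') = root_arc m"
    using root_arc_in_arcs[OF assms(1)] g_inv inf' by simp
  ultimately show ?thesis
    using assms(2) unfolding rooted_map_iso_def img
    by (auto simp: f_inv g_inv arcsD bij_betw_the_inv_into[OF f]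
        bij_betw_the_inv_into[OF g, unfolded img])
qed

lemma rooted_map_iso_trans:
  assumes "rooted_map_iso m m' f g" "rooted_map_iso m' m'' f' g'"
  shows "rooted_map_iso m m'' (f' \<circ> f) (g' \<circ> g)"
proof -
  have "\<And>a. a \<in> map_arcs m \<Longrightarrow> g a \<in> map_arcs m'"
    using assms(1) by (auto simp: rooted_map_iso_def bij_betw_def)
  moreover have "(\<lambda>a. g' (g a)) ` infinite_face m = infinite_face m''"
    using assms by (simp add: rooted_map_iso_def image_image [symmetric])
  moreover have "bij_betw (f' \<circ> f) (map_verts m) (map_verts m'')"
    "bij_betw (g' \<circ> g) (map_arcs m) (map_arcs m'')"
    using assms unfolding rooted_map_iso_def by (blast intro: bij_betw_trans)+
  ultimately show ?thesis
    using assms unfolding rooted_map_iso_def by simp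
qed

lemma orbit_iso:
  assumes "rooted_planar_map m" "rooted_map_iso m m' f g" "a \<in> map_arcs m"
  shows "orbit (map_rot m' \<circ> map_rev m') (g a) = g ` orbit (map_rot m \<circ> map_rev m) a"
proof -
  let ?h = "map_rot m \<circ> map_rev m" and ?h' = "map_rot m' \<circ> map_rev m'"
  have step: "?h' (g b) = g (?h b)" if "b \<in> map_arcs m" for b
    using assms that rooted_planar_map_arcsD[OF assms(1)] by (auto simp: rooted_map_iso_def)
  show ?thesis
  proof (intro equalityI subsetI)
    fix y assume "y \<in> orbit ?h' (g a)"
    then show "y \<in> g ` orbit ?h a"
    proof induction
      case base then show ?case unfolding step[OF assms(3)] by (blast intro: orbit.base)
    next
      case (step y)
      then obtain b where b: "b \<in> orbit ?h a" "y = g b" by blast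
      then have "b \<in> map_arcs m" using orbit_arcs_subset[OF assms(1,3)] by blast
      then have "?h' y = g (?h b)" using b \<open>\<And>b. b \<in> map_arcs m \<Longrightarrow> ?h' (g b) = g (?h b)\<close> by blast
      then show ?case using b(1) by (metis imageI orbit.step)
    qed
  next
    fix y assume "y \<in> g ` orbit ?h a"
    then obtain b where b: "b \<in> orbit ?h a" "y = g b" by blast
    from b(1) have "g b \<in> orbit ?h' (g a)"
    proof induction
      case base then show ?case unfolding step[OF assms(3), symmetric] by (rule orbit.base)
    next
      case (step b)
      then have "b \<in> map_arcs m" using orbit_arcs_subset[OF assms(1,3)] by blast
      then have "g (?h b) = ?h' (g b)" using \<open>\<And>b. b \<in> map_arcs m \<Longrightarrow> ?h' (g b) = g (?h b)\<close> by simp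
      then show ?case using step by (metis orbit.step)
    qed
    then show "y \<in> orbit ?h' (g a)" using b by simp
  qed
qed

lemma faces_iso:
  assumes "rooted_planar_map m" "rooted_map_iso m m' f g"
  shows "map_faces m' = (`) g ` map_faces m"
proof -
  have "map_arcs m' = g ` map_arcs m"
    using assms(2) by (auto simp: rooted_map_iso_def bij_betw_def)
  then show ?thesis
    unfolding map_faces_def by (simp add: image_image orbit_iso[OF assms])
qed

lemma inj_on_arcs_iso:
  "rooted_map_iso m m' f g \<Longrightarrow> inj_on g (map_arcs m)"
  by (simp add: rooted_map_iso_def bij_betw_def)

lemma card_faces_iso:
  assumes "rooted_planar_map m" "rooted_map_iso m m' f g"
  shows "card (map_faces m') = card (map_faces m)"
  unfolding faces_iso[OF assms]
proof (rule card_image, rule inj_onI)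
  fix F F' assume "F \<in> map_faces m" "F' \<in> map_faces m" "g ` F = g ` F'"
  then show "F = F'"
    using inj_on_image_eq_iff[OF inj_on_arcs_iso[OF assms(2)]] faces_subset[OF assms(1)] by blast
qed

lemma quadrangulation_iso:
  assumes "rooted_planar_map m" "rooted_map_iso m m' f g"
  shows "map_quadrangulation m' \<longleftrightarrow> map_quadrangulation m"
proof -
  have "card (g ` F) = card F" if "F \<in> map_faces m" for F
    using that faces_subset[OF assms(1)] inj_on_arcs_iso[OF assms(2)]
    by (meson card_image inj_on_subset)
  then show ?thesis
    unfolding map_quadrangulation_def faces_iso[OF assms] face_degree_def by auto
qed

lemma awalk_iso:
  assumes "rooted_map_iso m m' f g"
    and "pre_digraph.awalk (map_graph m) u p v"
  shows "pre_digraph.awalk (map_graph m') (f u) (map g p) (f v)"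
proof -
  have "pre_digraph.cas (map_graph m') (f u) (map g p) (f v)"
    if "set p \<subseteq> map_arcs m" "pre_digraph.cas (map_graph m) u p v"
    using that assms(1)
    by (induction p arbitrary: u) (auto simp: pre_digraph.cas.simps rooted_map_iso_def)
  moreover have "f u \<in> map_verts m'" if "u \<in> map_verts m"
    using that assms(1) by (auto simp: rooted_map_iso_def bij_betw_def)
  moreover have "g ` map_arcs m = map_arcs m'"
    using assms(1) by (auto simp: rooted_map_iso_def bij_betw_def)
  ultimately show ?thesis
    using assms(2) unfolding pre_digraph.awalk_def map_arcs_def map_verts_def by auto
qed

lemma graph_dist_iso:
  assumes "rooted_planar_map m" "rooted_map_iso m m' f g" "u \<in> map_verts m" "v \<in> map_verts m"
  shows "graph_dist (map_graph m') (f u) (f v) = graph_dist (map_graph m) u v"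
proof -
  let ?f = "the_inv_into (map_verts m) f" and ?g = "the_inv_into (map_arcs m) g"
  have inv: "?f (f w) = w" if "w \<in> map_verts m" for w
    using assms(2) that by (auto simp: rooted_map_iso_def bij_betw_def the_inv_into_f_f)
  have "(\<exists>p. pre_digraph.awalk (map_graph m') (f u) p (f v) \<and> length p = k) \<longleftrightarrow>
        (\<exists>p. pre_digraph.awalk (map_graph m) u p v \<and> length p = k)" for k
    using awalk_iso[OF assms(2), of u _ v]
      awalk_iso[OF rooted_map_iso_sym[OF assms(1,2)], of "f u" _ "f v"] inv assms(3,4)
    by (metis length_map)
  then show ?thesis unfolding graph_dist_def by simp
qed

lemma root_dist_iso:
  assumes "rooted_planar_map m" "rooted_map_iso m m' f g" "v \<in> map_verts m"
  shows "graph_dist (map_graph m') (root_vertex m') (f v)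
           = graph_dist (map_graph m) (root_vertex m) v"
proof -
  have "root_vertex m' = f (root_vertex m)"
    using assms(2) root_arc_in_arcs[OF assms(1)]
    unfolding rooted_map_iso_def root_vertex_def by metis
  then show ?thesis
    using graph_dist_iso[OF assms(1,2) root_vertex_in_verts[OF assms(1)] assms(3)] by simp
qed

lemma profile_iso:
  assumes "rooted_planar_map m" "rooted_map_iso m m' f g"
  shows "map_profile m' = map_profile m"
proof
  fix k
  let ?A = "{v \<in> map_verts m. graph_dist (map_graph m) (root_vertex m) v = k}"
  have f: "inj_on f (map_verts m)" "map_verts m' = f ` map_verts m"
    using assms(2) by (auto simp: rooted_map_iso_def bij_betw_def)
  have "{v \<in> map_verts m'. graph_dist (map_graph m') (root_vertex m') v = k} = f ` ?A"
    using root_dist_iso[OF assms] unfolding f(2) by auto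
  moreover have "card (f ` ?A) = card ?A"
    using f(1) by (intro card_image) (auto intro: inj_on_subset)
  ultimately show "map_profile m' k = map_profile m k"
    by (simp add: map_profile_def)
qed

lemma radius_iso:
  assumes "rooted_planar_map m" "rooted_map_iso m m' f g"
  shows "map_radius m' = map_radius m"
proof -
  have "map_verts m' = f ` map_verts m"
    using assms(2) by (auto simp: rooted_map_iso_def bij_betw_def)
  then have "graph_dist (map_graph m') (root_vertex m') ` map_verts m'
      = graph_dist (map_graph m) (root_vertex m) ` map_verts m"
    using root_dist_iso[OF assms] by (auto simp: image_image)
  then show ?thesis by (simp add: map_radius_def)
qed


subsection \<open>Rooted planar maps up to homeomorphism\<close>

text \<open>Since maps are finite, taking vertices and arcs in \<^typ>\<open>nat\<close> loses no isomorphism class.\<close>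

definition planar_map_equiv :: "(nat, nat) rooted_map \<Rightarrow> (nat, nat) rooted_map \<Rightarrow> bool" where
  "planar_map_equiv m m' \<longleftrightarrow>
     rooted_planar_map m \<and> rooted_planar_map m' \<and> (\<exists>f g. rooted_map_iso m m' f g)"

lemma ex_rooted_planar_map: "\<exists>m :: (nat, nat) rooted_map. rooted_planar_map m"
proof -
  define G :: "(nat, nat) pre_digraph"
    where "G = \<lparr>verts = {0, 1}, arcs = {0, 1}, tail = id, head = (\<lambda>a. 1 - a)\<rparr>"
  define r :: "nat \<Rightarrow> nat" where "r = (\<lambda>a. if a = 0 then 1 else if a = 1 then 0 else a)"
  define m :: "(nat, nat) rooted_map"
    where "m = \<lparr>map_graph = G, map_rev = r, map_rot = id, infinite_face = {0, 1}, root_arc = 0\<rparr>"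
  have r: "r 0 = 1" "r (Suc 0) = 0" by (auto simp: r_def)
  have wf: "wf_digraph G" by unfold_locales (auto simp: G_def)
  have orb: "orbit r a = {0, 1}" if "a \<in> {0, 1}" for a
  proof
    show "orbit r a \<subseteq> {0, 1}"
    proof
      fix b assume "b \<in> orbit r a" then show "b \<in> {0, 1}"
        by induction (use that r in auto)
    qed
    have "r a \<in> orbit r a" "r (r a) \<in> orbit r a" by (auto intro: orbit.intros)
    then show "{0, 1} \<subseteq> orbit r a" using that r by auto
  qed
  have faces: "map_faces m = {{0, 1}}"
    using orb by (auto simp: map_faces_def map_arcs_def m_def G_def)
  have sym: "(0, 1) \<in> arcs_ends (with_proj (mk_symmetric G))"
    "(1, 0) \<in> arcs_ends (with_proj (mk_symmetric G))"
    by (auto simp: mk_symmetric_def G_def arcs_ends_conv)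
  have V: "verts (with_proj (mk_symmetric G)) = {0, 1}"
    by (simp add: mk_symmetric_def G_def)
  have conn: "Digraph_Component.connected G"
    unfolding Digraph_Component.connected_def strongly_connected_def reachable_def V
    using sym by (auto intro!: rtrancl_on_refl intro: rtrancl_on_into_rtrancl_on[OF rtrancl_on_refl])
  have "rooted_planar_map m"
  proof (rule rooted_planar_map.intro)
    show "fin_digraph (map_graph m)"
      using wf by (auto simp: m_def G_def fin_digraph_def fin_digraph_axioms_def)
    show "bidirected_digraph (map_graph m) (map_rev m)"
      using wf by (auto simp: m_def G_def r_def bidirected_digraph_def bidirected_digraph_axioms_def)
    show "Digraph_Component.connected (map_graph m)" using conn by (simp add: m_def)
    show "map_rot m permutes map_arcs m" by (simp add: m_def permutes_id)
    show "cyclic_on (map_rot m) (out_arcs (map_graph m) v)"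
      if "v \<in> map_verts m" for v
    proof -
      have "orbit id v = {v}" by (auto simp: orbit_altdef)
      moreover have "out_arcs G v = {v}"
        using that by (auto simp: out_arcs_def G_def map_verts_def m_def)
      ultimately show ?thesis by (simp add: cyclic_on_def m_def)
    qed
    show "int (card (map_verts m)) - int (card (map_arcs m) div 2) + int (card (map_faces m)) = 2"
      unfolding faces by (simp add: map_verts_def map_arcs_def m_def G_def)
    show "infinite_face m \<in> map_faces m" unfolding faces by (simp add: m_def)
    show "root_arc m \<in> infinite_face m" by (simp add: m_def)
  qed
  then show ?thesis ..
qed

quotient_type planar_map = "(nat, nat) rooted_map" / partial: planar_map_equiv
proof (rule part_equivpI)
  show "\<exists>m. planar_map_equiv m m"
    using ex_rooted_planar_map rooted_map_iso_refl unfolding planar_map_equiv_def by blast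
  show "symp planar_map_equiv"
    using rooted_map_iso_sym unfolding planar_map_equiv_def symp_def by blast
  show "transp planar_map_equiv"
    using rooted_map_iso_trans unfolding planar_map_equiv_def transp_def by blast
qed

lift_definition is_quadrangulation :: "planar_map \<Rightarrow> bool" is map_quadrangulation
  using quadrangulation_iso unfolding planar_map_equiv_def by blast

lift_definition num_faces :: "planar_map \<Rightarrow> nat" is "\<lambda>m. card (map_faces m)"
  using card_faces_iso unfolding planar_map_equiv_def by metis

lift_definition profile :: "planar_map \<Rightarrow> nat \<Rightarrow> nat" is map_profile
  using profile_iso unfolding planar_map_equiv_def by metis

lift_definition radius :: "planar_map \<Rightarrow> nat" is map_radius
  using radius_iso unfolding planar_map_equiv_def by metis

definition quadrangulations :: "nat \<Rightarrow> planar_map set" where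
  "quadrangulations n = {q. is_quadrangulation q \<and> num_faces q = n}"

definition random_quadrangulation :: "nat \<Rightarrow> planar_map pmf" where
  "random_quadrangulation n = pmf_of_set (quadrangulations n)"


section \<open>Well labelled trees\<close>

datatype 'a plane_tree = Node (root_label: 'a) (children: "'a plane_tree list")

fun num_edges :: "'a plane_tree \<Rightarrow> nat" where
  "num_edges (Node x ts) = (\<Sum>t\<leftarrow>ts. Suc (num_edges t))"

text \<open>One list entry for every vertex.\<close>

fun labels :: "'a plane_tree \<Rightarrow> 'a list" where
  "labels (Node x ts) = x # concat (map labels ts)"

fun adjacent_labels_close :: "nat plane_tree \<Rightarrow> bool" where
  "adjacent_labels_close (Node x ts) \<longleftrightarrow>
     (\<forall>t\<in>set ts. \<bar>int x - int (root_label t)\<bar> \<le> 1 \<and> adjacent_labels_close t)"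

definition well_labelled :: "nat plane_tree \<Rightarrow> bool" where
  "well_labelled t \<longleftrightarrow>
     (\<forall>x\<in>set (labels t). x > 0) \<and> adjacent_labels_close t \<and> root_label t = 1"

definition well_labelled_trees :: "nat \<Rightarrow> nat plane_tree set" where
  "well_labelled_trees n = {t. well_labelled t \<and> num_edges t = n}"

definition random_well_labelled_tree :: "nat \<Rightarrow> nat plane_tree pmf" where
  "random_well_labelled_tree n = pmf_of_set (well_labelled_trees n)"

definition label_count :: "nat plane_tree \<Rightarrow> nat \<Rightarrow> nat" where
  "label_count t k = count_list (labels t) k"

definition max_label :: "nat plane_tree \<Rightarrow> nat" where
  "max_label t = Max (set (labels t))"

end

theory Submission
  imports Defs
begin

text \<open>
  The law identity comes from a bijection between rooted quadrangulations with \<open>n\<close> faces and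
  well labelled trees with \<open>n\<close> edges (Cori--Vauquelin--Schaeffer) that turns distances into
  labels; it is carried out on rotation systems. Label the vertices of a quadrangulation by their
  distance to the root vertex. Every edge joins consecutive labels: the dual graph has a spanning
  tree, and counting modulo 2 over the remaining edges shows that a planar map with even faces is
  bipartite. Hence each edge carries exactly one down arc, whose tail has the larger label, and each
  face contains exactly two down arcs. Pairing these two gives the edges of the tree; its corners
  are the down arcs, and its rotation is the first return of the rotation to the down arcs. The
  contour of this tree is a single cycle: around an arc of minimal label on a contour cycle one
  turns about a vertex without down arcs, which can only be the root vertex. As the tree has \<open>n\<close>
  edges and \<open>n + 1\<close> vertices, the pairing of the corners along the contour is noncrossing.

  Conversely, the head of the down arc at a corner is found at the next corner of smaller label,
  so that labels and pairing determine the rotation of the quadrangulation explicitly.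
\<close>

section \<open>Label sequences and contours of plane forests\<close>

text \<open>A rotation system has no topology to argue with: planarity is the value 2 in Euler's
  formula, and for a given quadrangulation it is used only through the number of vertices. Faces of
  degree 4 give \<open>n\<close> faces, \<open>2 n\<close> edges and hence \<open>n + 2\<close>
  vertices. Without the root vertex these are exactly one more than the \<open>n\<close> pairs of
  down arcs, so connectedness of the contour leaves no room for crossings. In the other direction
  Euler's formula has to be proved for the constructed map, which requires knowing that no two tree
  vertices fall into one rotation orbit.

  A tree is handled through the corners of its contour, as a pairing \<open>A\<close> and a label
  function \<open>L\<close> on positions. The relation \<open>codes\<close> between maps and trees
  lists equations for the rotation in terms of \<open>A\<close> and \<open>L\<close>. Read one way
  they determine the map from the tree, read the other way they determine each corner from the
  preceding one. Hence no composition of the two constructions has to be computed: existence and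
  uniqueness on both sides of \<open>codes\<close> give the bijection. The root vertex has no
  corner; it is the common end of the down arcs at the corners of label 1.\<close>

text \<open>
  The successor of corner \<open>i\<close> in Schaeffer's construction. When no smaller label follows, the value
  is arbitrary; in that case the label is 1 and the successor is the root vertex of the map.
\<close>
definition next_lower :: "(nat \<Rightarrow> nat) \<Rightarrow> nat \<Rightarrow> nat" where
  "next_lower L i = (LEAST j. i < j \<and> L j < L i)"

definition prev_le :: "(nat \<Rightarrow> nat) \<Rightarrow> nat \<Rightarrow> nat" where
  "prev_le L c = (GREATEST j. j < c \<and> L j \<le> L c)"

definition slow :: "nat \<Rightarrow> (nat \<Rightarrow> nat) \<Rightarrow> bool" where
  "slow N L \<longleftrightarrow> (\<forall>i<N. L (Suc i) \<le> Suc (L i) \<and> L i \<le> Suc (L (Suc i)))"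

section \<open>Successors of corners in slowly varying label sequences\<close>

lemma slow_mono: "slow N L \<Longrightarrow> M \<le> N \<Longrightarrow> slow M L"
  by (auto simp: slow_def)

lemma next_lower_eqI:
  assumes "i < j" "L j < L i" "\<And>k. i < k \<Longrightarrow> k < j \<Longrightarrow> L i \<le> L k"
  shows "next_lower L i = j"
  unfolding next_lower_def using assms
  by (intro Least_equality) (auto simp: not_less [symmetric])

lemma next_lower:
  assumes "i < j" "L j < L i"
  shows "i < next_lower L i" "L (next_lower L i) < L i" "next_lower L i \<le> j"
    and "\<And>k. i \<le> k \<Longrightarrow> k < next_lower L i \<Longrightarrow> L i \<le> L k"
proof -
  have ex: "i < j \<and> L j < L i" using assms by simp
  show "i < next_lower L i" "L (next_lower L i) < L i"
    using LeastI[of "\<lambda>j. i < j \<and> L j < L i", OF ex] by (auto simp: next_lower_def)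
  show "next_lower L i \<le> j"
    using Least_le[of "\<lambda>j. i < j \<and> L j < L i", OF ex] by (auto simp: next_lower_def)
  fix k assume "i \<le> k" "k < next_lower L i"
  then show "L i \<le> L k"
    using not_less_Least[of k "\<lambda>j. i < j \<and> L j < L i"]
    by (cases "i = k") (auto simp: next_lower_def)
qed

text \<open>Labels fall by at most one per step, so the first smaller label is smaller by exactly
  one.\<close>

lemma next_lower_label:
  assumes "slow j L" "i < j" "L j < L i"
  shows "Suc (L (next_lower L i)) = L i"
proof -
  note n = next_lower[OF assms(2,3)]
  obtain k where k: "next_lower L i = Suc k" using n(1) by (cases "next_lower L i") auto
  have "L i \<le> L k" using n(1) n(4)[of k] k by simp
  moreover have "L k \<le> Suc (L (Suc k))" using assms(1) n(3) k by (auto simp: slow_def)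
  ultimately show ?thesis using n(2) k by simp
qed

lemma next_lower_down: "L (Suc i) < L i \<Longrightarrow> next_lower L i = Suc i"
  by (rule next_lower_eqI) auto

lemma next_lower_level:
  assumes "L (Suc i) = L i" "i < j" "L j < L i"
  shows "next_lower L i = next_lower L (Suc i)"
proof -
  have "Suc i < j" using assms by (cases "Suc i = j") auto
  note n = next_lower[OF this, of L]
  show ?thesis
    by (rule next_lower_eqI) (use n assms in \<open>auto simp: Suc_le_eq intro: n(4)\<close>)
qed

text \<open>The descent from corner \<open>Suc i\<close> cannot skip the label \<open>L i\<close>,
  so the search for the successor of \<open>i\<close> can restart where that label is met again.
  With the level case this gives the recursion that \<open>run_next_lower\<close> follows.\<close>

lemma next_lower_up:
  assumes "slow j L" "L (Suc i) = Suc (L i)" "i < j" "L j < L i"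
  shows "next_lower L (Suc i) < j" "L (next_lower L (Suc i)) = L i"
    and "next_lower L i = next_lower L (next_lower L (Suc i))"
proof -
  let ?m = "next_lower L (Suc i)"
  have "Suc i < j" using assms by (cases "Suc i = j") auto
  moreover have "L j < L (Suc i)" using assms by simp
  ultimately have n: "Suc i < ?m" "L ?m < L (Suc i)" "?m \<le> j"
    "\<And>k. Suc i \<le> k \<Longrightarrow> k < ?m \<Longrightarrow> L (Suc i) \<le> L k"
    and l: "Suc (L ?m) = L (Suc i)"
    using next_lower[of "Suc i" j L] next_lower_label[OF assms(1), of "Suc i"] by blast+
  show lm: "L ?m = L i" using l assms by simp
  then show mj: "?m < j" using n(3) assms(4) by (cases "?m = j") auto
  note n' = next_lower[OF mj, of L]
  have l': "L j < L ?m" using lm assms by simp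
  show "next_lower L i = next_lower L ?m"
  proof (rule next_lower_eqI)
    fix k assume k: "i < k" "k < next_lower L ?m"
    show "L i \<le> L k"
    proof (cases "k < ?m")
      case True then show ?thesis using n(4)[of k] k assms(2) by simp
    next
      case False then show ?thesis using n'(4)[OF l', of k] k lm by simp
    qed
  qed (use n n'(1,2)[OF l'] lm in auto)
qed

lemma prev_le:
  assumes "j < c" "L j \<le> L c"
  shows "prev_le L c < c" "L (prev_le L c) \<le> L c" "j \<le> prev_le L c"
    and "\<And>k. prev_le L c < k \<Longrightarrow> k < c \<Longrightarrow> L c < L k"
proof -
  have ex: "j < c \<and> L j \<le> L c" using assms by simp
  note G = GreatestI_nat[of "\<lambda>j. j < c \<and> L j \<le> L c", OF ex, of c]
    Greatest_le_nat[of "\<lambda>j. j < c \<and> L j \<le> L c" _ c]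
  show "prev_le L c < c" "L (prev_le L c) \<le> L c" using G(1) by (auto simp: prev_le_def)
  show "j \<le> prev_le L c" using G(2)[OF ex] by (auto simp: prev_le_def)
  fix k assume "prev_le L c < k" "k < c"
  then show "L c < L k" using G(2)[of k] by (fastforce simp: prev_le_def not_less[symmetric])
qed

text \<open>Labels strictly between \<open>prev_le\<close> and the corner exceed that of the corner,
  and they rise by at most one per step, so the step after \<open>prev_le\<close> must ascend.
  Descending steps are thus matched with earlier ascending ones like brackets;
  \<open>prev_le_next_lower\<close> is the converse, for ascents from which the labels come down
  again.\<close>

lemma prev_le_down:
  assumes "slow (Suc p) L" "L (Suc p) < L p" "j < Suc p" "L j \<le> L (Suc p)"
  defines "i \<equiv> prev_le L (Suc p)"
  shows "i < p" "L i = L (Suc p)" "L (Suc i) = Suc (L i)" "next_lower L (Suc i) = Suc p"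
proof -
  note q = prev_le[OF assms(3,4), folded i_def]
  show ip: "i < p" using q(1,2) assms(2) by (cases "i = p") auto
  have "L (Suc p) < L (Suc i)" using q(4)[of "Suc i"] ip by simp
  moreover have "L (Suc i) \<le> Suc (L i)" using assms(1) ip by (auto simp: slow_def)
  ultimately show li: "L i = L (Suc p)" "L (Suc i) = Suc (L i)" using q(2) by auto
  show "next_lower L (Suc i) = Suc p"
  proof (rule next_lower_eqI)
    fix k assume "Suc i < k" "k < Suc p"
    then show "L (Suc i) \<le> L k" using q(4)[of k] li by simp
  qed (use ip li in auto)
qed

lemma prev_le_next_lower:
  assumes "slow j L" "L (Suc i) = Suc (L i)" "Suc i < j" "L j < L (Suc i)"
  shows "prev_le L (next_lower L (Suc i)) = i"
    "L (next_lower L (Suc i)) < L (next_lower L (Suc i) - 1)" "L (next_lower L (Suc i)) = L i"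
proof -
  let ?c = "next_lower L (Suc i)"
  note n = next_lower[OF assms(3,4)]
  show l: "L ?c = L i" using next_lower_label[OF assms(1,3,4)] assms(2) by simp
  show "prev_le L ?c = i" unfolding prev_le_def
  proof (rule Greatest_equality)
    fix k assume k: "k < ?c \<and> L k \<le> L ?c"
    show "k \<le> i" using n(4)[of k] k n(2) by (meson linorder_not_le not_less_eq_eq order_le_less_trans not_less_eq less_le_not_le)
  qed (use n l in auto)
  have "L (Suc i) \<le> L (?c - 1)" using n(1) by (intro n(4)) auto
  then show "L ?c < L (?c - 1)" using n(2) by simp
qed

lemma next_lower_cong:
  assumes "\<And>k. k \<le> N \<Longrightarrow> L k = L' k" "i < N" "L N < L i"
  shows "next_lower L i = next_lower L' i"
proof -
  have lt: "L' N < L' i" using assms by simp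
  note n = next_lower[OF assms(2) lt]
  show ?thesis by (rule next_lower_eqI) (use n assms in auto)
qed

text \<open>
  \<open>plane_forest A L lo hi ts\<close>: the contour of the trees \<open>ts\<close>, hanging from a common vertex, visits
  the corners \<open>lo, \<dots>, hi\<close>; step \<open>i\<close> leads from corner \<open>i\<close> to corner \<open>i + 1\<close>, the steps \<open>i\<close> and
  \<open>A i\<close> traverse the same edge in opposite directions, and \<open>L i\<close> is the label at corner \<open>i\<close>.
\<close>
inductive plane_forest :: "(nat \<Rightarrow> nat) \<Rightarrow> (nat \<Rightarrow> nat) \<Rightarrow> nat \<Rightarrow> nat \<Rightarrow> nat plane_tree list \<Rightarrow> bool"
  for A L where
  Nil: "plane_forest A L lo lo []"
| Cons: "A lo = a \<Longrightarrow> A a = lo \<Longrightarrow> L (Suc a) = L lo \<Longrightarrow> plane_forest A L (Suc lo) a us \<Longrightarrow>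
         plane_forest A L (Suc a) hi ts \<Longrightarrow> plane_forest A L lo hi (Node (L (Suc lo)) us # ts)"

section \<open>Contours of plane forests: uniqueness, counting, construction\<close>

lemma plane_forest_le: "plane_forest A L lo hi ts \<Longrightarrow> lo \<le> hi"
  by (induction rule: plane_forest.induct) auto

lemma plane_forest_length:
  "plane_forest A L lo hi ts \<Longrightarrow> hi = lo + 2 * (\<Sum>t\<leftarrow>ts. Suc (num_edges t))"
  by (induction rule: plane_forest.induct) auto

lemma plane_forest_end: "plane_forest A L lo hi ts \<Longrightarrow> L hi = L lo"
  by (induction rule: plane_forest.induct) auto

lemma plane_forest_matching:
  "plane_forest A L lo hi ts \<Longrightarrow> lo \<le> i \<Longrightarrow> i < hi \<Longrightarrow>
     lo \<le> A i \<and> A i < hi \<and> A (A i) = i \<and> A i \<noteq> i \<and> L (Suc (A i)) = L i"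
proof (induction arbitrary: i rule: plane_forest.induct)
  case (Cons lo a us hi ts)
  note le = Cons.hyps(4,5)[THEN plane_forest_le]
  consider "i = lo" | "Suc lo \<le> i" "i < a" | "i = a" | "Suc a \<le> i" "i < hi"
    using Cons.prems by linarith
  then show ?case
  proof cases
    case 3
    then show ?thesis using Cons.hyps le plane_forest_end[OF Cons.hyps(4)] by auto
  next
    case 2 then show ?thesis using Cons.IH(1)[of i] le by auto
  next
    case 4 then show ?thesis using Cons.IH(2)[of i] le by auto
  qed (use Cons.hyps le in auto)
qed auto

lemma plane_forest_unique:
  "plane_forest A L lo hi ts \<Longrightarrow> plane_forest A L lo hi ts' \<Longrightarrow> ts = ts'"
proof (induction arbitrary: ts' rule: plane_forest.induct)
  case (Nil lo)
  from Nil.prems show ?case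
  proof cases
    case (Cons a us ts)
    then show ?thesis using plane_forest_le[OF Cons(5)] plane_forest_le[OF Cons(6)] by simp
  qed auto
next
  case (Cons lo a us hi ts)
  note le = Cons.hyps(4,5)[THEN plane_forest_le]
  from Cons.prems show ?case
  proof cases
    case Nil then show ?thesis using le by simp
  next
    case (Cons a' us' ts'')
    then show ?thesis using Cons.IH \<open>A lo = a\<close> by auto
  qed
qed

text \<open>The label at \<open>lo\<close> belongs to the common vertex, which is not part of the
  forest; this is why it is the only one that must be given.\<close>

lemma plane_forest_determines:
  "plane_forest A L lo hi ts \<Longrightarrow> plane_forest A' L' lo hi' ts \<Longrightarrow> L lo = L' lo \<Longrightarrow>
     hi = hi' \<and> (\<forall>i. lo \<le> i \<and> i < hi \<longrightarrow> A i = A' i) \<and> (\<forall>i. lo \<le> i \<and> i \<le> hi \<longrightarrow> L i = L' i)"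
proof (induction arbitrary: hi' rule: plane_forest.induct)
  case (Nil lo)
  from Nil.prems(1) show ?case by cases (use Nil.prems in auto)
next
  case (Cons lo a us hi ts)
  note le = Cons.hyps(4,5)[THEN plane_forest_le] and l0 = Cons.prems(2)
  from Cons.prems(1) show ?case
  proof cases
    case (Cons a')
    note 1 = Cons.IH(1)[OF Cons(5)] and c = Cons
    have aa: "a = a'" and 1: "\<And>i. Suc lo \<le> i \<Longrightarrow> i < a \<Longrightarrow> A i = A' i"
        "\<And>i. Suc lo \<le> i \<Longrightarrow> i \<le> a \<Longrightarrow> L i = L' i"
      using 1 c by auto
    have e: "L (Suc a) = L' (Suc a)" using c Cons.hyps Cons.prems aa by simp
    have 2: "hi = hi'" "\<And>i. Suc a \<le> i \<Longrightarrow> i < hi \<Longrightarrow> A i = A' i"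
        "\<And>i. Suc a \<le> i \<Longrightarrow> i \<le> hi \<Longrightarrow> L i = L' i"
      using Cons.IH(2)[OF c(6)[folded aa] e] by auto
    show ?thesis
    proof (intro conjI allI impI)
      fix i assume i: "lo \<le> i \<and> i < hi"
      then consider "i = lo" | "Suc lo \<le> i" "i < a" | "i = a" | "Suc a \<le> i" by linarith
      then show "A i = A' i"
        by cases (use i 1 2 c aa Cons.hyps in auto)
    next
      fix i assume i: "lo \<le> i \<and> i \<le> hi"
      then consider "i = lo" | "Suc lo \<le> i" "i \<le> a" | "Suc a \<le> i" by linarith
      then show "L i = L' i"
        by cases (use i 1 2 c aa l0 in auto)
    qed (use 2 in auto)
  qed
qed

lemma plane_forest_ups_Cons:
  assumes "A lo = a" "A a = lo" "plane_forest A L (Suc lo) a us" "plane_forest A L (Suc a) hi ts"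
  shows "{i\<in>{lo..<hi}. i < A i \<and> P i} = (if P lo then {lo} else {}) \<union>
     {i\<in>{Suc lo..<a}. i < A i \<and> P i} \<union> {i\<in>{Suc a..<hi}. i < A i \<and> P i}" (is "?X = ?Y")
proof -
  note le = assms(3,4)[THEN plane_forest_le]
  have "i \<in> ?X \<longleftrightarrow> i \<in> ?Y" for i
  proof -
    consider "i < lo" | "i = lo" | "Suc lo \<le> i" "i < a" | "i = a" | "Suc a \<le> i" by linarith
    then show ?thesis by cases (use le assms(1,2) in auto)
  qed
  then show ?thesis by blast
qed

text \<open>A step with \<open>i < A i\<close> is the first traversal of its edge and discovers a
  new vertex at corner \<open>Suc i\<close>; each vertex of the forest is discovered once. Such
  steps lead away from the root of the tree, whatever they do to the labels.\<close>

lemma plane_forest_count: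
  "plane_forest A L lo hi ts \<Longrightarrow>
    count_list (concat (map labels ts)) k = card {i\<in>{lo..<hi}. i < A i \<and> L (Suc i) = k}"
proof (induction rule: plane_forest.induct)
  case (Cons lo a us hi ts)
  note le = Cons.hyps(4,5)[THEN plane_forest_le]
  let ?X = "{i\<in>{Suc lo..<a}. i < A i \<and> L (Suc i) = k}"
    and ?Y = "{i\<in>{Suc a..<hi}. i < A i \<and> L (Suc i) = k}"
  have "?X \<inter> ?Y = {}" by auto
  then have "card (?X \<union> ?Y) = card ?X + card ?Y" by (intro card_Un_disjoint) auto
  moreover have "lo \<notin> ?X \<union> ?Y" "finite (?X \<union> ?Y)" using le by auto
  ultimately have "card ((if L (Suc lo) = k then {lo} else {}) \<union> ?X \<union> ?Y) =
      (if L (Suc lo) = k then 1 else 0) + (card ?X + card ?Y)"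
    by (simp only: Un_assoc) auto
  then show ?case
    unfolding plane_forest_ups_Cons[OF Cons.hyps(1,2,4,5)] using Cons.IH by simp
qed auto

lemma plane_forest_card_ups:
  "plane_forest A L lo hi ts \<Longrightarrow> card {i\<in>{lo..<hi}. i < A i} = (hi - lo) div 2"
proof (induction rule: plane_forest.induct)
  case (Cons lo a us hi ts)
  note le = Cons.hyps(4,5)[THEN plane_forest_le]
  note len = Cons.hyps(4,5)[THEN plane_forest_length]
  let ?X = "{i\<in>{Suc lo..<a}. i < A i}" and ?Y = "{i\<in>{Suc a..<hi}. i < A i}"
  have "{i\<in>{lo..<hi}. i < A i} = insert lo (?X \<union> ?Y)"
    using plane_forest_ups_Cons[OF Cons.hyps(1,2,4,5), of "\<lambda>_. True"] by simp
  moreover have "?X \<inter> ?Y = {}" by auto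
  then have "card (?X \<union> ?Y) = card ?X + card ?Y" by (intro card_Un_disjoint) auto
  moreover have "lo \<notin> ?X \<union> ?Y" "finite (?X \<union> ?Y)" using le by auto
  ultimately have "card {i\<in>{lo..<hi}. i < A i} = Suc ((a - Suc lo) div 2 + (hi - Suc a) div 2)"
    using Cons.IH by simp
  then show ?case using len by auto
qed auto

text \<open>Any function that is constant on the corners of each vertex takes its values at the
  initial corner and at the corners of discovery. It is applied to vertices of maps and to labels
  alike.\<close>

lemma plane_forest_corner:
  "plane_forest A L lo hi ts \<Longrightarrow> (\<And>i. lo \<le> i \<Longrightarrow> i < hi \<Longrightarrow> v (Suc i) = v (A i)) \<Longrightarrow>
     lo \<le> c \<Longrightarrow> c \<le> hi \<Longrightarrow>
     v c = v lo \<or> (\<exists>i\<in>{lo..<hi}. i < A i \<and> v c = v (Suc i))"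
proof (induction arbitrary: c rule: plane_forest.induct)
  case (Cons lo a us hi ts)
  note le = Cons.hyps(4,5)[THEN plane_forest_le]
  consider "c = lo" | "Suc lo \<le> c" "c \<le> a" | "Suc a \<le> c" using Cons.prems by linarith
  then show ?case
  proof cases
    case 2
    then have "v c = v (Suc lo) \<or> (\<exists>i\<in>{Suc lo..<a}. i < A i \<and> v c = v (Suc i))"
      using Cons.prems le by (intro Cons.IH(1)) auto
    then show ?thesis
    proof
      assume "v c = v (Suc lo)"
      then show ?thesis using Cons.hyps(1) le by (intro disjI2 bexI[of _ lo]) auto
    qed (use le in force)
  next
    case 3
    then have "v c = v (Suc a) \<or> (\<exists>i\<in>{Suc a..<hi}. i < A i \<and> v c = v (Suc i))"
      using Cons.prems le by (intro Cons.IH(2)) auto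
    moreover have "v (Suc a) = v lo" using Cons.prems(1)[of a] Cons.hyps le by auto
    ultimately show ?thesis using le by force
  qed auto
qed auto

lemma plane_forest_vertices:
  "plane_forest A L lo hi ts \<Longrightarrow> \<exists>v::nat \<Rightarrow> nat. (\<forall>i. lo \<le> i \<and> i < hi \<longrightarrow> v (Suc i) = v (A i)) \<and>
     v lo = lo \<and> v hi = lo \<and> (\<forall>i. lo \<le> i \<and> i < hi \<and> i < A i \<longrightarrow> v (Suc i) = Suc i)"
proof (induction rule: plane_forest.induct)
  case (Nil lo) then show ?case by (intro exI[of _ "\<lambda>_. lo"]) auto
next
  case (Cons lo a us hi ts)
  note le = Cons.hyps(4,5)[THEN plane_forest_le]
  from Cons.IH obtain v w where
    v: "\<And>i. Suc lo \<le> i \<Longrightarrow> i < a \<Longrightarrow> v (Suc i) = v (A i)" "v (Suc lo) = Suc lo" "v a = Suc lo"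
      "\<And>i. Suc lo \<le> i \<Longrightarrow> i < a \<Longrightarrow> i < A i \<Longrightarrow> v (Suc i) = Suc i" and
    w: "\<And>i. Suc a \<le> i \<Longrightarrow> i < hi \<Longrightarrow> w (Suc i) = w (A i)" "w (Suc a) = Suc a" "w hi = Suc a"
      "\<And>i. Suc a \<le> i \<Longrightarrow> i < hi \<Longrightarrow> i < A i \<Longrightarrow> w (Suc i) = Suc i"
    by blast
  \<comment> \<open>The remaining trees hang from the same vertex as the first one, but
    \<open>w\<close> calls it \<open>Suc a\<close>; it has to be renamed to
    \<open>lo\<close>.\<close>
  define u where "u i = (if i \<le> lo then lo else if i \<le> a then v i
      else if w i = Suc a then lo else w i)" for i
  have m1: "Suc lo \<le> A i \<and> A i < a" if "Suc lo \<le> i" "i < a" for i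
    using plane_forest_matching[OF Cons.hyps(4) that] by auto
  have m2: "Suc a \<le> A i \<and> A i < hi" if "Suc a \<le> i" "i < hi" for i
    using plane_forest_matching[OF Cons.hyps(5) that] by auto
  have "u (Suc i) = u (A i)" if i: "lo \<le> i" "i < hi" for i
  proof -
    consider "i = lo" | "Suc lo \<le> i" "i < a" | "i = a" | "Suc a \<le> i" using i by linarith
    then show ?thesis
    proof cases
      case 2 then show ?thesis using m1[of i] v by (auto simp: u_def)
    next
      case 4 then show ?thesis using m2[of i] w i le by (auto simp: u_def)
    qed (use le Cons.hyps v w in \<open>auto simp: u_def\<close>)
  qed
  moreover have "u lo = lo" "u hi = lo" using le w by (auto simp: u_def)
  moreover have "u (Suc i) = Suc i" if i: "lo \<le> i" "i < hi" "i < A i" for i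
  proof -
    consider "i = lo" | "Suc lo \<le> i" "i < a" | "i = a" | "Suc a \<le> i" using i by linarith
    then show ?thesis
      by cases (use i le Cons.hyps v w in \<open>auto simp: u_def\<close>)
  qed
  ultimately show ?case by blast
qed

lemma plane_forest_close:
  "plane_forest A L lo hi ts \<Longrightarrow>
     (\<forall>i. lo \<le> i \<and> i < hi \<longrightarrow> \<bar>int (L i) - int (L (Suc i))\<bar> \<le> 1) \<longleftrightarrow>
     (\<forall>t\<in>set ts. \<bar>int (L lo) - int (root_label t)\<bar> \<le> 1 \<and> adjacent_labels_close t)"
proof (induction rule: plane_forest.induct)
  case (Cons lo a us hi ts)
  note le = Cons.hyps(4,5)[THEN plane_forest_le]
  let ?P = "\<lambda>i. \<bar>int (L i) - int (L (Suc i))\<bar> \<le> 1"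
  have "L a = L (Suc lo)" using plane_forest_end[OF Cons.hyps(4)] .
  \<comment> \<open>Step \<open>a\<close> traverses the edge of step \<open>lo\<close>
    backwards.\<close>
  then have pa: "?P a \<longleftrightarrow> ?P lo" using Cons.hyps(3) by auto
  have "(\<forall>i. lo \<le> i \<and> i < hi \<longrightarrow> ?P i) \<longleftrightarrow> ?P lo \<and> (\<forall>i. Suc lo \<le> i \<and> i < a \<longrightarrow> ?P i) \<and>
      (\<forall>i. Suc a \<le> i \<and> i < hi \<longrightarrow> ?P i)" (is "?X \<longleftrightarrow> ?Y")
  proof
    assume ?X then show ?Y using le by simp
  next
    assume Y: ?Y
    show ?X
    proof (intro allI impI)
      fix i assume "lo \<le> i \<and> i < hi"
      then consider "i = lo" | "Suc lo \<le> i" "i < a" | "i = a" | "Suc a \<le> i" "i < hi" by linarith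
      then show "?P i" by cases (use Y pa in blast)+
    qed
  qed
  then show ?case using Cons.IH Cons.hyps(3) by auto
qed auto

lemma plane_forest_cong:
  assumes "plane_forest A L lo hi ts" "\<And>i. lo \<le> i \<Longrightarrow> i < hi \<Longrightarrow> A i = A' i"
    "\<And>i. lo \<le> i \<Longrightarrow> i \<le> hi \<Longrightarrow> L i = L' i"
  shows "plane_forest A' L' lo hi ts"
  using assms
proof (induction rule: plane_forest.induct)
  case (Cons lo a us hi ts)
  note le = Cons.hyps(4,5)[THEN plane_forest_le]
  have "plane_forest A' L' (Suc lo) a us" using Cons le by auto
  moreover have "plane_forest A' L' (Suc a) hi ts" using Cons le by auto
  ultimately have "plane_forest A' L' lo hi (Node (L' (Suc lo)) us # ts)"
    using Cons.hyps(1-3) Cons.prems(1)[of lo] Cons.prems(1)[of a] le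
      Cons.prems(2)[of lo] Cons.prems(2)[of "Suc a"]
    by (intro plane_forest.Cons[of _ _ a]) auto
  then show ?case using Cons.prems(2)[of "Suc lo"] le by simp
qed (auto intro: plane_forest.Nil)

lemma plane_forest_exists: "\<exists>A L hi. plane_forest A L lo hi ts \<and> L lo = x"
proof (induction "\<Sum>t\<leftarrow>ts. Suc (num_edges t)" arbitrary: ts lo x rule: less_induct)
  case less
  show ?case
  proof (cases ts)
    case Nil then show ?thesis using plane_forest.Nil by (intro exI[of _ "\<lambda>_. x"]) blast
  next
    case (Cons t ts')
    obtain y us where t: "t = Node y us" by (cases t) auto
    obtain A1 L1 a where 1: "plane_forest A1 L1 (Suc lo) a us" "L1 (Suc lo) = y"
      using less[of us] Cons t by fastforce
    obtain A2 L2 hi where 2: "plane_forest A2 L2 (Suc a) hi ts'" "L2 (Suc a) = x"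
      using less[of ts'] Cons by fastforce
    note le = 1(1)[THEN plane_forest_le] 2(1)[THEN plane_forest_le]
    define A where "A i = (if i = lo then a else if i = a then lo else if i < a then A1 i else A2 i)" for i
    define L where "L i = (if i = lo then x else if i \<le> a then L1 i else L2 i)" for i
    have "plane_forest A L (Suc lo) a us"
      by (rule plane_forest_cong[OF 1(1)]) (auto simp: A_def L_def)
    moreover have "plane_forest A L (Suc a) hi ts'"
      using le by (intro plane_forest_cong[OF 2(1)]) (auto simp: A_def L_def)
    ultimately have "plane_forest A L lo hi (Node (L (Suc lo)) us # ts')"
      using le 2 by (intro plane_forest.Cons[of _ _ a]) (auto simp: A_def L_def)
    moreover have "L (Suc lo) = y" using 1 le by (simp add: L_def)
    ultimately show ?thesis using t Cons by (intro exI[of _ A] exI[of _ L] exI[of _ hi]) (auto simp: L_def)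
  qed
qed

text \<open>No chord crosses the one from \<open>lo\<close> to \<open>A lo\<close>, so the corners
  below it and those behind it are each closed under \<open>A\<close> and carry forests of their
  own.\<close>

lemma plane_forest_of_noncrossing:
  assumes "lo \<le> hi"
    and "\<And>i. lo \<le> i \<Longrightarrow> i < hi \<Longrightarrow>
      lo \<le> A i \<and> A i < hi \<and> A (A i) = i \<and> A i \<noteq> i \<and> L (Suc (A i)) = L i"
    and "\<And>i j. lo \<le> i \<Longrightarrow> i < j \<Longrightarrow> j < A i \<Longrightarrow> A i < A j \<Longrightarrow> A j < hi \<Longrightarrow> False"
  shows "\<exists>ts. plane_forest A L lo hi ts"
  using assms
proof (induction "hi - lo" arbitrary: lo hi rule: less_induct)
  case less
  note m = less.prems(2) and nc = less.prems(3)
  show ?case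
  proof (cases "lo = hi")
    case True then show ?thesis using plane_forest.Nil by blast
  next
    case False
    define a where "a = A lo"
    have lo: "lo < hi" using False less.prems(1) by simp
    have a: "lo < a" "a < hi" "A a = lo" "L (Suc a) = L lo"
      using m[of lo] lo by (auto simp: a_def)
    have 1: "Suc lo \<le> A i \<and> A i < a" if "Suc lo \<le> i" "i < a" for i
    proof -
      have mi: "lo \<le> A i" "A i < hi" "A (A i) = i" using m[of i] that a by auto
      then have "A i \<noteq> lo" "A i \<noteq> a" using that a by (auto simp: a_def)
      moreover have "\<not> a < A i"
        using nc[of lo i] that mi by (auto simp: a_def)
      ultimately show ?thesis using mi by auto
    qed
    have 2: "Suc a \<le> A i \<and> A i < hi" if "Suc a \<le> i" "i < hi" for i
    proof -
      have mi: "lo \<le> A i" "A i < hi" "A (A i) = i" using m[of i] that a by auto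
      have "A i \<noteq> lo" "A i \<noteq> a" using that a mi by (auto simp: a_def)
      moreover have "\<not> (lo < A i \<and> A i < a)" using 1[of "A i"] that mi by auto
      ultimately show ?thesis using mi by auto
    qed
    have "\<exists>us. plane_forest A L (Suc lo) a us"
    proof (rule less.hyps)
      show "A j < a \<Longrightarrow> False" if "Suc lo \<le> i" "i < j" "j < A i" "A i < A j" for i j
        using nc[of i j] that a by auto
    qed (use a lo m 1 in auto)
    moreover have "\<exists>ts. plane_forest A L (Suc a) hi ts"
    proof (rule less.hyps)
      show "A j < hi \<Longrightarrow> False" if "Suc a \<le> i" "i < j" "j < A i" "A i < A j" for i j
        using nc[of i j] that a by auto
    qed (use a lo m 2 in auto)
    ultimately obtain us ts where "plane_forest A L (Suc lo) a us" "plane_forest A L (Suc a) hi ts" by blast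
    then show ?thesis using plane_forest.Cons[OF a_def[symmetric] a(3,4)] by blast
  qed
qed

section \<open>Edge counts and noncrossing pairings\<close>

lemma connected_graph_card:
  assumes fin: "finite E" "finite V" and r: "r \<in> V"
    and ends: "\<And>i. i \<in> E \<Longrightarrow> f i \<in> V \<and> g i \<in> V"
    and cross: "\<And>X. r \<in> X \<Longrightarrow> X \<subset> V \<Longrightarrow> \<exists>i\<in>E. (f i \<in> X) \<noteq> (g i \<in> X)"
  shows "card V \<le> Suc (card E)"
proof -
  \<comment> \<open>Grow a vertex set from \<open>r\<close>: every edge leaving it adds one vertex
    and at least one inner edge. Connectivity is assumed in terms of cuts because this is how
    \<open>matching_noncrossing\<close> can verify it.\<close>
  have "\<exists>X\<subseteq>V. r \<in> X \<and> card X = Suc k \<and> k \<le> card {i \<in> E. f i \<in> X \<and> g i \<in> X}" if "k < card V" for k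
    using that
  proof (induction k)
    case 0 then show ?case using r by (intro exI[of _ "{r}"]) simp
  next
    case (Suc k)
    then obtain X where X: "X \<subseteq> V" "r \<in> X" "card X = Suc k"
      "k \<le> card {i \<in> E. f i \<in> X \<and> g i \<in> X}" by auto
    then have "X \<noteq> V" using Suc.prems by auto
    then obtain i where i: "i \<in> E" "(f i \<in> X) \<noteq> (g i \<in> X)" using cross[of X] X by auto
    define w where "w = (if f i \<in> X then g i else f i)"
    have w: "w \<in> V" "w \<notin> X" using ends[OF i(1)] i(2) by (auto simp: w_def)
    let ?I = "\<lambda>X. {i \<in> E. f i \<in> X \<and> g i \<in> X}"
    have "insert i (?I X) \<subseteq> ?I (insert w X)" using i by (auto simp: w_def)
    then have "card (insert i (?I X)) \<le> card (?I (insert w X))" using fin(1) by (intro card_mono) auto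
    moreover have "i \<notin> ?I X" using i by auto
    ultimately have "Suc k \<le> card (?I (insert w X))" using X(4) fin(1) by simp
    moreover have "card (insert w X) = Suc (Suc k)"
      using w X finite_subset[OF X(1) fin(2)] by simp
    ultimately show ?case using X w by (intro exI[of _ "insert w X"]) auto
  qed
  moreover have "0 < card V" using r fin(2) by (auto simp: card_gt_0_iff)
  ultimately obtain X where "card V - 1 \<le> card {i \<in> E. f i \<in> X \<and> g i \<in> X}"
    by (metis diff_less zero_less_one)
  also have "\<dots> \<le> card E" using fin(1) by (intro card_mono) auto
  finally show ?thesis by simp
qed

lemma card_involution:
  fixes h :: "'a::linorder \<Rightarrow> 'a"
  assumes "finite T" and h: "\<And>a. a \<in> T \<Longrightarrow> h a \<in> T \<and> h (h a) = a \<and> h a \<noteq> a"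
  shows "card T = 2 * card {a \<in> T. a < h a}"
proof -
  let ?P = "{a \<in> T. a < h a}"
  have "T = ?P \<union> h ` ?P"
  proof
    show "T \<subseteq> ?P \<union> h ` ?P"
    proof
      fix a assume a: "a \<in> T"
      show "a \<in> ?P \<union> h ` ?P"
      proof (cases "a < h a")
        case False
        then have "h a \<in> ?P" using h[OF a] by auto
        then show ?thesis using h[OF a] by (intro UnI2 image_eqI[of _ _ "h a"]) simp_all
      qed (use a in simp)
    qed
  qed (use h in auto)
  moreover have "?P \<inter> h ` ?P = {}" using h by auto
  moreover have "card (h ` ?P) = card ?P"
    by (intro card_image inj_on_inverseI[where g = h]) (use h in auto)
  ultimately show ?thesis using assms(1) card_Un_disjoint[of ?P "h ` ?P"] by simp
qed

text \<open>
  If the chords \<open>{i, A i}\<close> and \<open>{j, A j}\<close> crossed, the graph would stay connected after removing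
  the edge \<open>{i, A i}\<close>, so it would have too few edges for its number of vertices.
\<close>
lemma matching_noncrossing:
  assumes A: "\<And>i. i < N \<Longrightarrow> A i < N \<and> A (A i) = i \<and> A i \<noteq> i"
    and v: "\<And>i. i < N \<Longrightarrow> v (Suc i) = v (A i)" "v N = v 0"
    and card: "N div 2 < card (v ` {..<N})"
    and cr: "i < j" "j < A i" "A i < A j" "A j < N"
  shows False
proof -
  define E where "E = {k \<in> {..<N}. k < A k}"
  have N: "N = 2 * card E" using card_involution[of "{..<N}" A] A by (simp add: E_def)
  have iN: "i < N" and jN: "j < N" using cr by simp_all
  have iE: "i \<in> E" using cr iN by (simp add: E_def)
  have v': "v (Suc (A k)) = v k" if "k < N" for k
    using v(1)[of "A k"] A[OF that] by simp
  have vN: "v (Suc k) \<in> v ` {..<N}" if "k < N" for k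
    using v(1)[OF that] A[OF that] by auto
  have "card (v ` {..<N}) \<le> Suc (card (E - {i}))"
  proof (rule connected_graph_card[where f = v and g = "\<lambda>k. v (Suc k)" and r = "v 0"])
    show "v 0 \<in> v ` {..<N}" using iN by auto
    show "v k \<in> v ` {..<N} \<and> v (Suc k) \<in> v ` {..<N}" if "k \<in> E - {i}" for k
      using that vN by (auto simp: E_def)
    fix X assume X: "v 0 \<in> X" "X \<subset> v ` {..<N}"
    show "\<exists>k\<in>E - {i}. (v k \<in> X) \<noteq> (v (Suc k) \<in> X)"
    proof (rule ccontr)
      assume "\<not> ?thesis"
      then have noE: "v k \<in> X \<longleftrightarrow> v (Suc k) \<in> X" if "k \<in> E" "k \<noteq> i" for k using that by blast
      have no: "v k \<in> X \<longleftrightarrow> v (Suc k) \<in> X" if k: "k < N" "k \<noteq> i" "k \<noteq> A i" for k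
      proof (cases "k < A k")
        case True then show ?thesis using noE k by (simp add: E_def)
      next
        case False
        then have "A k \<in> E" "A k \<noteq> i" using A[OF k(1)] k by (auto simp: E_def)
        then show ?thesis using noE[of "A k"] v'[OF k(1)] v(1)[OF k(1)] by simp
      qed
      have up: "v k \<in> X \<longleftrightarrow> v b \<in> X" if "b \<le> k" "k \<le> c" "\<And>l. b \<le> l \<Longrightarrow> l < c \<Longrightarrow> l < N \<and> l \<noteq> i \<and> l \<noteq> A i" for b c k
        using that(1,2)
      proof (induction k rule: dec_induct)
        case (step k) then show ?case using no[of k] that(3)[of k] by simp
      qed simp
      have lo: "v k \<in> X" if "k \<le> i" for k
        using up[of 0 k i] that X(1) iN cr by auto
      have hi: "v k \<in> X" if "Suc (A i) \<le> k" "k \<le> N" for k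
        using up[of "Suc (A i)" k N] up[of "Suc (A i)" N N] that X(1) v(2) cr by auto
      have mid: "v k \<in> X \<longleftrightarrow> v (Suc i) \<in> X" if "Suc i \<le> k" "k \<le> A i" for k
        using up[of "Suc i" k "A i"] that A[OF iN] by auto
      \<comment> \<open>The chord of \<open>j\<close> connects the stretches: step \<open>j\<close>
        runs inside the inner one and ends at the vertex of corner \<open>A j\<close>, which lies in
        the outer one.\<close>
      have "v (A j) \<in> X" using hi[of "A j"] cr by simp
      then have "v (Suc j) \<in> X" using v(1)[OF jN] by simp
      moreover have "v j \<in> X \<longleftrightarrow> v (Suc j) \<in> X" using no[OF jN] cr by simp
      ultimately have vi: "v (Suc i) \<in> X" using mid[of j] cr by simp
      have "v k \<in> X" if k: "k < N" for k
      proof -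
        consider "k \<le> i" | "Suc i \<le> k" "k \<le> A i" | "Suc (A i) \<le> k" by linarith
        then show ?thesis
        proof cases
          case 1 then show ?thesis by (rule lo)
        next
          case 2 then show ?thesis using mid[of k] vi by simp
        next
          case 3 then show ?thesis using hi[of k] k by simp
        qed
      qed
      then show False using X(2) by blast
    qed
  qed (auto simp: E_def)
  moreover have "card E = Suc (card (E - {i}))"
    by (rule card.remove[OF _ iE]) (simp add: E_def)
  ultimately show False using card N by simp
qed


section \<open>Labelled quadrangulated surfaces\<close>

lemma card_orbits:
  assumes "f permutes S" "finite S" "\<And>a. a \<in> S \<Longrightarrow> card (orbit f a) = k"
  shows "k * card (orbit f ` S) = card S"
proof -
  have cyc: "cyclic_on f (orbit f a)" for a by (rule cyclic_on_orbit[OF assms(1,2)])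
  have "permutation f" using assms(1,2) by (auto simp: permutation_permutes)
  then have self: "a \<in> orbit f a" for a by (rule permutation_self_in_orbit)
  have U: "\<Union> (orbit f ` S) = S"
  proof
    show "\<Union> (orbit f ` S) \<subseteq> S" using permutes_orbit_subset[OF assms(1)] by (simp add: UN_subset_iff)
    show "S \<subseteq> \<Union> (orbit f ` S)" using self by (auto intro: UN_I)
  qed
  have "k * card (orbit f ` S) = card (\<Union> (orbit f ` S))"
  proof (rule card_partition)
    show "finite (\<Union> (orbit f ` S))" unfolding U by (rule assms(2))
    show "X \<inter> Y = {}" if X: "X \<in> orbit f ` S" "Y \<in> orbit f ` S" "X \<noteq> Y" for X Y
    proof (rule ccontr)
      assume "X \<inter> Y \<noteq> {}"
      then obtain c where "c \<in> X" "c \<in> Y" by blast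
      moreover have "cyclic_on f X" "cyclic_on f Y" using X(1,2) cyc by auto
      ultimately show False using orbit_cyclic_eq3[of f X c] orbit_cyclic_eq3[of f Y c] X(3) by simp
    qed
  qed (use assms in auto)
  then show ?thesis unfolding U .
qed

lemma card_orbit_four:
  assumes "f (f (f (f a))) = a" "f (f a) \<noteq> a"
  shows "card (orbit f a) = 4"
proof -
  have "(f ^^ 4) a = a" using assms(1) by (simp add: eval_nat_numeral)
  then have "orbit f a = {(f ^^ k) a | k. k < 4}" by (rule orbit_altdef_bounded) simp
  also have "\<dots> = (\<lambda>k. (f ^^ k) a) ` {0..<4}" by auto
  also have "{0..<4} = {0, 1, 2, 3::nat}" by auto
  finally have "orbit f a = {a, f a, f (f a), f (f (f a))}" by (simp add: eval_nat_numeral)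
  moreover have "f a \<noteq> a" "f (f a) \<noteq> f a" "f (f (f a)) \<noteq> a" "f (f (f a)) \<noteq> f a" "f (f (f a)) \<noteq> f (f a)"
    using assms by metis+
  ultimately show ?thesis using assms(2) by simp
qed


text \<open>\<open>c\<close> is the last element satisfying \<open>P\<close> that is met when following \<open>s\<close> up to and including \<open>x\<close>.\<close>
inductive run :: "('e \<Rightarrow> 'e) \<Rightarrow> ('e \<Rightarrow> bool) \<Rightarrow> 'e \<Rightarrow> 'e \<Rightarrow> bool" for s P where
  base: "P c \<Longrightarrow> run s P c c"
| step: "run s P c x \<Longrightarrow> \<not> P (s x) \<Longrightarrow> run s P c (s x)"

lemma run_start: "run s P c x \<Longrightarrow> P c"
  by (induction rule: run.induct)

lemma run_self: "run s P c x \<Longrightarrow> P x \<Longrightarrow> c = x"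
  by (induction rule: run.induct) auto

lemma run_back:
  assumes "inj s" "run s P c (s x)" "\<not> P (s x)"
  shows "run s P c x"
  using assms(2)
proof cases
  case base then show ?thesis using assms by simp
next
  case (step y) then show ?thesis using assms(1) by (auto dest: injD)
qed

lemma run_unique:
  assumes "inj s" "run s P c x" "run s P c' x"
  shows "c = c'"
  using assms(2,3)
proof (induction rule: run.induct)
  case (base c) then show ?case using run_self[of s P c' c] by simp
next
  case (step c x) then show ?case using run_back[OF assms(1)] by blast
qed

lemma run_funpow:
  "run s P c x \<Longrightarrow> \<exists>n. x = (s ^^ n) c \<and> (\<forall>k. 0 < k \<and> k \<le> n \<longrightarrow> \<not> P ((s ^^ k) c))"
proof (induction rule: run.induct)
  case (base c) then show ?case by (intro exI[of _ 0]) auto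
next
  case (step c x)
  then obtain n where "x = (s ^^ n) c" "\<And>k. 0 < k \<Longrightarrow> k \<le> n \<Longrightarrow> \<not> P ((s ^^ k) c)" by blast
  then show ?case using step by (intro exI[of _ "Suc n"]) (auto simp: le_Suc_eq)
qed

lemma run_next_unique:
  assumes "run s P c x" "P (s x)" "run s P c y" "P (s y)"
  shows "x = y"
proof -
  obtain m where m: "x = (s ^^ m) c" "\<And>k. 0 < k \<Longrightarrow> k \<le> m \<Longrightarrow> \<not> P ((s ^^ k) c)"
    using run_funpow[OF assms(1)] by blast
  obtain n where n: "y = (s ^^ n) c" "\<And>k. 0 < k \<Longrightarrow> k \<le> n \<Longrightarrow> \<not> P ((s ^^ k) c)"
    using run_funpow[OF assms(3)] by blast
  have "\<not> m < n" using n(2)[of "Suc m"] m(1) assms(2) by auto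
  moreover have "\<not> n < m" using m(2)[of "Suc n"] n(1) assms(4) by auto
  ultimately have "m = n" by simp
  then show ?thesis using m(1) n(1) by simp
qed

lemma run_orbit: "run s P c x \<Longrightarrow> x = c \<or> x \<in> orbit s c"
  by (induction rule: run.induct) (auto intro: orbit.intros)

text \<open>Four unit steps that return to their start contain two descents. The first step is one,
  and \<open>d1\<close>, \<open>d2\<close>, \<open>d3\<close> tell which of the others
  descend.\<close>

lemma four_steps:
  fixes p q s t :: nat
  assumes "p = Suc q" "d1 \<and> q = Suc s \<or> \<not> d1 \<and> s = Suc q"
    "d2 \<and> s = Suc t \<or> \<not> d2 \<and> t = Suc s" "d3 \<and> t = Suc p \<or> \<not> d3 \<and> p = Suc t"
  shows "d1 \<and> \<not> d2 \<and> \<not> d3 \<or> \<not> d1 \<and> d2 \<and> \<not> d3 \<or> \<not> d1 \<and> \<not> d2 \<and> d3"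
  using assms by (cases d1; cases d2; cases d3; simp)

text \<open>
  \<open>e 0, \<dots>, e N = e 0\<close> lists the down arcs (the arcs satisfying \<open>P\<close>) in contour order and \<open>A\<close> pairs
  the two down arcs of a face. The three clauses are the three possible patterns of a face: the
  contour step from corner \<open>i\<close> to corner \<open>i + 1\<close> lowers, keeps or raises the label.
\<close>
definition encodes ::
  "('e \<Rightarrow> 'e) \<Rightarrow> ('e \<Rightarrow> 'e) \<Rightarrow> ('e \<Rightarrow> bool) \<Rightarrow> ('e \<Rightarrow> nat) \<Rightarrow> nat \<Rightarrow> (nat \<Rightarrow> 'e) \<Rightarrow> (nat \<Rightarrow> nat) \<Rightarrow> bool"
where
  "encodes rot rv P lab N e A \<longleftrightarrow> bij_betw e {..<N} {a. P a} \<and> e N = e 0 \<and>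
    (let L = \<lambda>i. lab (e i) in slow N L \<and> (\<forall>i<N. A i < N \<and>
      (L (Suc i) < L i \<longrightarrow> rot (rv (e i)) = e (A i) \<and> run rot P (e (Suc i)) (rv (e i))) \<and>
      (L (Suc i) = L i \<longrightarrow> rot (rv (e i)) = rv (e (Suc i)) \<and> rot (e (Suc i)) = e (A i)) \<and>
      (L i < L (Suc i) \<longrightarrow>
         rot (rv (e i)) = rv (e (next_lower L (Suc i))) \<and>
         rot (e (next_lower L (Suc i))) = rv (e (Suc i)) \<and> rot (e (Suc i)) = e (A i))))"

text \<open>
  \<open>lab a\<close> is the label of the tail of the arc \<open>a\<close>.
\<close>
locale quadrangulated_surface =
  fixes D :: "'e set" and rot rev :: "'e \<Rightarrow> 'e" and lab :: "'e \<Rightarrow> nat" and r :: 'e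
  assumes finite_D: "finite D"
    and rot: "rot permutes D" and rev: "rev permutes D"
    and rev_rev: "rev (rev a) = a"
    and lab_rot: "a \<in> D \<Longrightarrow> lab (rot a) = lab a"
    and lab_rev: "a \<in> D \<Longrightarrow> lab (rev a) = Suc (lab a) \<or> lab a = Suc (lab (rev a))"
    and four: "a \<in> D \<Longrightarrow> rot (rev (rot (rev (rot (rev (rot (rev a))))))) = a"
    and two: "a \<in> D \<Longrightarrow> rot (rev (rot (rev a))) \<noteq> a"
    and down_exists: "a \<in> D \<Longrightarrow> lab a > 0 \<Longrightarrow> \<exists>b\<in>orbit rot a. lab b = Suc (lab (rev b))"
    and r: "r \<in> D" "lab r = 0"
    and label_zero: "a \<in> D \<Longrightarrow> lab a = 0 \<Longrightarrow> r \<in> orbit rot a"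
begin

definition dn :: "'e \<Rightarrow> bool" where "dn a \<longleftrightarrow> a \<in> D \<and> lab a = Suc (lab (rev a))"

definition phi :: "'e \<Rightarrow> 'e" where "phi a = rot (rev a)"

text \<open>By \<open>face_cases\<close>, exactly one of the three other arcs of the face is a down
  arc, so the last alternative needs no test.\<close>

definition opp :: "'e \<Rightarrow> 'e" where
  "opp a = (if dn (phi a) then phi a else if dn (phi (phi a)) then phi (phi a) else phi (phi (phi a)))"

text \<open>Crossing the tree edge at corner \<open>a\<close> leads to the vertex of
  \<open>opp a\<close>; the next corner is the one whose image under the rotation of the tree, the
  first return of \<open>rot\<close> to the down arcs, is \<open>opp a\<close>. The identity
  elsewhere makes \<open>succ\<close> a permutation in the sense of \<open>permutes\<close>.\<close>

definition succ :: "'e \<Rightarrow> 'e" where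
  "succ a = (if dn a then THE c. \<exists>x. run rot dn c x \<and> rot x = opp a else a)"

section \<open>Face patterns and the contour permutation of the down arcs\<close>

lemma rot_D [simp]: "rot a \<in> D \<longleftrightarrow> a \<in> D" and rev_D [simp]: "rev a \<in> D \<longleftrightarrow> a \<in> D"
  using rot rev by (auto simp: permutes_in_image)

lemma phi_D [simp]: "phi a \<in> D \<longleftrightarrow> a \<in> D" by (simp add: phi_def)

lemma inj_rot: "inj rot" using rot by (rule permutes_inj)

lemma permutation_rot: "permutation rot"
  using rot finite_D by (auto simp: permutation_permutes)

lemma lab_phi: "a \<in> D \<Longrightarrow> lab (phi a) = lab (rev a)"
  by (simp add: phi_def lab_rot)

lemma phi4: "a \<in> D \<Longrightarrow> phi (phi (phi (phi a))) = a"
  using four by (simp add: phi_def)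

lemma phi2: "a \<in> D \<Longrightarrow> phi (phi a) \<noteq> a"
  using two by (simp add: phi_def)

lemma dn_D: "dn a \<Longrightarrow> a \<in> D" by (simp add: dn_def)

lemma dn_lab: "a \<in> D \<Longrightarrow> dn a \<longleftrightarrow> lab a = Suc (lab (phi a))"
  "a \<in> D \<Longrightarrow> \<not> dn a \<longleftrightarrow> lab (phi a) = Suc (lab a)"
  unfolding dn_def using lab_rev[of a] lab_phi[of a] by presburger+

lemma dn_rev: "a \<in> D \<Longrightarrow> dn (rev a) \<longleftrightarrow> \<not> dn a"
  unfolding dn_def rev_rev rev_D using lab_rev[of a] by presburger

lemma face_cases:
  assumes "dn a"
  obtains (down) "dn (phi a)" "\<not> dn (phi (phi a))" "\<not> dn (phi (phi (phi a)))"
  | (level) "\<not> dn (phi a)" "dn (phi (phi a))" "\<not> dn (phi (phi (phi a)))"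
  | (up) "\<not> dn (phi a)" "\<not> dn (phi (phi a))" "dn (phi (phi (phi a)))"
proof -
  have D: "a \<in> D" using assms by (simp add: dn_def)
  have l: "dn b \<and> lab b = Suc (lab (phi b)) \<or> \<not> dn b \<and> lab (phi b) = Suc (lab b)" if "b \<in> D" for b
    using dn_lab[OF that] by blast
  have "dn (phi a) \<and> \<not> dn (phi (phi a)) \<and> \<not> dn (phi (phi (phi a))) \<or>
    \<not> dn (phi a) \<and> dn (phi (phi a)) \<and> \<not> dn (phi (phi (phi a))) \<or>
    \<not> dn (phi a) \<and> \<not> dn (phi (phi a)) \<and> dn (phi (phi (phi a)))"
  proof (rule four_steps[where s = "lab (phi (phi a))"])
    show "lab a = Suc (lab (phi a))" using l[OF D] assms by blast
    show "dn (phi (phi (phi a))) \<and> lab (phi (phi (phi a))) = Suc (lab a) \<or>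
        \<not> dn (phi (phi (phi a))) \<and> lab a = Suc (lab (phi (phi (phi a))))"
      using l[of "phi (phi (phi a))"] D by (simp add: phi4)
  qed (use l D in simp_all)
  then show ?thesis using that by blast
qed

lemma dn_opp: "dn a \<Longrightarrow> dn (opp a)"
  by (erule face_cases) (auto simp: opp_def)

lemma opp_opp:
  assumes "dn a"
  shows "opp (opp a) = a"
  using assms
proof (cases rule: face_cases)
  case down then show ?thesis by (simp add: opp_def phi4 dn_D assms)
next
  case level then show ?thesis by (simp add: opp_def phi4 dn_D assms)
next
  case up then show ?thesis by (simp add: opp_def phi4 dn_D assms)
qed

lemma opp_neq:
  assumes "dn a"
  shows "opp a \<noteq> a"
  using assms
proof (cases rule: face_cases)
  case down
  then have "opp a = phi a" by (simp add: opp_def)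
  moreover have "lab a \<noteq> lab (phi a)" using dn_lab(1)[OF dn_D[OF assms]] assms by simp
  ultimately show ?thesis by metis
next
  case level then show ?thesis by (simp add: opp_def phi2 dn_D assms)
next
  case up
  then have "opp a = phi (phi (phi a))" by (simp add: opp_def)
  moreover have "phi a \<noteq> a" using up(1) assms by metis
  ultimately show ?thesis using phi4[OF dn_D[OF assms]] by metis
qed

lemma run_exists:
  assumes "dn d" "rot x = d"
  shows "\<exists>c. run rot dn c x"
proof -
  \<comment> \<open>The orbit of \<open>d\<close> is a cycle, so following \<open>rot\<close> from
    \<open>d\<close> reaches the arc \<open>x\<close> just before \<open>d\<close>; the last down
    arc met on the way is the one sought.\<close>
  have "x \<in> orbit rot d"
    using permutation_self_in_orbit[OF permutation_rot, of x]
      permutation_orbit_step[OF permutation_rot, of x] assms(2) by simp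
  then show ?thesis
  proof induction
    case base
    show ?case
      using run.base[of dn "rot d" rot] run.step[OF run.base[of dn d rot, OF assms(1)]] by blast
  next
    case (step y)
    then obtain c where "run rot dn c y" by blast
    then show ?case using run.base[of dn "rot y" rot] run.step[of rot dn c y] by blast
  qed
qed

lemma succ_eqI:
  assumes "dn a" "run rot dn c x" "rot x = opp a"
  shows "succ a = c"
proof -
  have "(THE c. \<exists>x. run rot dn c x \<and> rot x = opp a) = c"
  proof (rule the_equality)
    fix c' assume "\<exists>x. run rot dn c' x \<and> rot x = opp a"
    then obtain y where y: "run rot dn c' y" "rot y = opp a" by blast
    then have "y = x" using injD[OF inj_rot, of y x] assms(3) by simp
    then show "c' = c" using run_unique[OF inj_rot y(1)] assms(2) by simp
  qed (use assms(2,3) in \<open>intro exI conjI\<close>)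
  then show ?thesis using assms(1) by (simp add: succ_def)
qed

lemma run_succ:
  assumes "dn a"
  obtains x where "run rot dn (succ a) x" "rot x = opp a"
proof -
  obtain x where x: "rot x = opp a"
    using permutes_inverses(1)[OF rot] by blast
  from run_exists[OF dn_opp[OF assms] this] obtain c where c: "run rot dn c x" ..
  then have "succ a = c" using x by (rule succ_eqI[OF assms])
  then show ?thesis using that c x by blast
qed

lemma dn_succ: "dn a \<Longrightarrow> dn (succ a)"
  using run_succ[of a] run_start[of rot dn] by blast

lemma run_refl: "dn c \<Longrightarrow> run rot dn c c"
  by (rule run.base)

lemma run_lab: "run rot dn c x \<Longrightarrow> x \<in> D \<and> lab x = lab c"
  by (induction rule: run.induct) (simp_all add: dn_D lab_rot)

lemma opp_in_orbit_succ:
  assumes "dn a"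
  shows "opp a \<in> orbit rot (succ a)"
proof -
  obtain x where x: "run rot dn (succ a) x" "rot x = opp a" using run_succ[OF assms] .
  have "rot x \<in> orbit rot (succ a)"
    using run_orbit[OF x(1)] orbit.intros[where f = rot] by auto
  then show ?thesis using x(2) by simp
qed

text \<open>Labels around the face: \<open>l, l-1, l-2, l-1\<close>. The arc before
  \<open>opp a\<close> in the rotation is \<open>rev a\<close>, which is not a down arc, so the new
  corner is known only as the start of its run.\<close>

lemma succ_down:
  assumes "dn a" "dn (phi a)"
  shows "opp a = phi a" "Suc (lab (succ a)) = lab a" "run rot dn (succ a) (rev a)"
proof -
  show o: "opp a = phi a" using assms by (simp add: opp_def)
  obtain x where x: "run rot dn (succ a) x" "rot x = opp a" using run_succ[OF assms(1)] .
  then have "x = rev a" using injD[OF inj_rot, of x "rev a"] o by (simp add: phi_def)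
  then show r: "run rot dn (succ a) (rev a)" using x by simp
  then show "Suc (lab (succ a)) = lab a" using run_lab[OF r] assms(1) by (simp add: dn_def)
qed

text \<open>Labels around the face: \<open>l, l-1, l, l-1\<close>. Here the arc before
  \<open>opp a\<close> is \<open>rev (phi a)\<close>, itself a down arc and hence the new
  corner.\<close>

lemma succ_level:
  assumes "dn a" "\<not> dn (phi a)" "dn (phi (phi a))"
  shows "phi a = rev (succ a)" "phi (rev (succ a)) = opp a" "lab (succ a) = lab a"
proof -
  have d: "dn (rev (phi a))" using assms by (simp add: dn_rev dn_D)
  have sa: "succ a = rev (phi a)"
    by (rule succ_eqI[OF assms(1) run_refl[OF d]]) (use assms in \<open>simp add: opp_def flip: phi_def\<close>)
  then show e: "phi a = rev (succ a)" by (simp add: rev_rev)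
  then show "phi (rev (succ a)) = opp a" using assms by (simp add: opp_def flip: e)
  have "lab (succ a) = lab (phi (phi a))"
    using lab_phi[of "phi a"] assms(1) by (simp add: sa dn_D)
  moreover have "lab a = Suc (lab (phi a))" "lab (phi (phi a)) = Suc (lab (phi a))"
    using dn_lab(1)[of a] dn_lab(2)[of "phi a"] assms by (simp_all add: dn_D)
  ultimately show "lab (succ a) = lab a" by linarith
qed

text \<open>Labels around the face: \<open>l, l-1, l, l+1\<close>. The new corner is
  \<open>rev (phi (phi a))\<close>. The last claim says that its down arc arrives right after the
  down arc \<open>rev (phi a)\<close> in the rotation, which locates that second corner.\<close>

lemma succ_up:
  assumes "dn a" "\<not> dn (phi a)" "\<not> dn (phi (phi a))"
  shows "phi (phi a) = rev (succ a)" "phi (rev (succ a)) = opp a" "lab (succ a) = Suc (lab a)"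
    "run rot dn (rev (phi a)) (rev (succ a))"
proof -
  have d: "dn (rev (phi (phi a)))" "dn (rev (phi a))" using assms by (simp_all add: dn_rev dn_D)
  have o: "opp a = phi (phi (phi a))"
    using assms by (simp add: opp_def)
  have sa: "succ a = rev (phi (phi a))"
    by (rule succ_eqI[OF assms(1) run_refl[OF d(1)]]) (simp add: o flip: phi_def)
  then show e: "phi (phi a) = rev (succ a)" by (simp add: rev_rev)
  then show "phi (rev (succ a)) = opp a" using o by (simp flip: e)
  have "lab (succ a) = lab (phi (phi (phi a)))"
    using lab_phi[of "phi (phi a)"] assms(1) by (simp add: sa dn_D)
  moreover have "lab a = Suc (lab (phi a))" "lab (phi (phi a)) = Suc (lab (phi a))"
    "lab (phi (phi (phi a))) = Suc (lab (phi (phi a)))"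
    using dn_lab(1)[of a] dn_lab(2)[of "phi a"] dn_lab(2)[of "phi (phi a)"] assms
    by (simp_all add: dn_D)
  ultimately show "lab (succ a) = Suc (lab a)" by linarith
  have "rev (succ a) = rot (rev (phi a))" using e by (simp add: phi_def)
  moreover have "\<not> dn (rot (rev (phi a)))" using assms(3) by (simp add: phi_def)
  ultimately show "run rot dn (rev (phi a)) (rev (succ a))"
    using run.step[OF run_refl[OF d(2)]] by simp
qed

text \<open>The sign of the label change identifies the face pattern; this allows
  \<open>encodes\<close> to distinguish its cases by labels alone.\<close>

lemma succ_cases:
  assumes "dn a"
  shows "lab (succ a) < lab a \<Longrightarrow> dn (phi a)"
    "lab (succ a) = lab a \<Longrightarrow> \<not> dn (phi a) \<and> dn (phi (phi a))"
    "lab a < lab (succ a) \<Longrightarrow> \<not> dn (phi a) \<and> \<not> dn (phi (phi a))"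
    "lab (succ a) \<le> Suc (lab a)" "lab a \<le> Suc (lab (succ a))"
proof -
  have "dn (phi a) \<and> Suc (lab (succ a)) = lab a \<or>
      \<not> dn (phi a) \<and> dn (phi (phi a)) \<and> lab (succ a) = lab a \<or>
      \<not> dn (phi a) \<and> \<not> dn (phi (phi a)) \<and> lab (succ a) = Suc (lab a)"
    using succ_down(2)[OF assms] succ_level(3)[OF assms] succ_up(3)[OF assms] by blast
  then show "lab (succ a) < lab a \<Longrightarrow> dn (phi a)"
    "lab (succ a) = lab a \<Longrightarrow> \<not> dn (phi a) \<and> dn (phi (phi a))"
    "lab a < lab (succ a) \<Longrightarrow> \<not> dn (phi a) \<and> \<not> dn (phi (phi a))"
    "lab (succ a) \<le> Suc (lab a)" "lab a \<le> Suc (lab (succ a))"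
    by (elim disjE conjE; simp)+
qed

lemma succ_inj:
  assumes "dn a" "dn b" "succ a = succ b"
  shows "a = b"
proof -
  obtain x where x: "run rot dn (succ a) x" "rot x = opp a" using run_succ[OF assms(1)] .
  obtain y where y: "run rot dn (succ b) y" "rot y = opp b" using run_succ[OF assms(2)] .
  have "x = y"
    by (rule run_next_unique[of rot dn "succ a"]) (use x y assms dn_opp in auto)
  then have "opp a = opp b" using x y by simp
  then show ?thesis using opp_opp[OF assms(1)] opp_opp[OF assms(2)] by metis
qed

lemma finite_dn: "finite {a. dn a}"
  by (rule finite_subset[OF _ finite_D]) (auto simp: dn_D)

lemma succ_permutes: "succ permutes {a. dn a}"
proof (rule bij_imp_permutes)
  have i: "inj_on succ {a. dn a}" using succ_inj by (auto intro: inj_onI)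
  moreover have "succ ` {a. dn a} \<subseteq> {a. dn a}" using dn_succ by auto
  ultimately show "bij_betw succ {a. dn a} {a. dn a}"
    using endo_inj_surj[OF finite_dn] by (auto simp: bij_betw_def)
qed (simp add: succ_def)

lemma permutation_succ: "permutation succ"
  using succ_permutes finite_dn by (auto simp: permutation_permutes)

lemma dn_funpow_succ: "dn a \<Longrightarrow> dn ((succ ^^ i) a)"
  by (induction i) (auto simp: dn_succ)

text \<open>This is Schaeffer's successor rule: the down arc of a corner arrives in the sector that
  begins at the next corner of smaller label. The three face patterns correspond to the three
  recursions of \<open>next_lower\<close>. The sequence \<open>e\<close> is arbitrary because the
  rule is applied to an unknown contour cycle before there is known to be only one.\<close>

lemma run_next_lower:
  assumes "\<And>i. dn (e i)" "\<And>i. e (Suc i) = succ (e i)"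
    and "i < j" "lab (e j) < lab (e i)"
  shows "run rot dn (e (next_lower (\<lambda>i. lab (e i)) i)) (rev (e i))"
proof -
  let ?L = "\<lambda>i. lab (e i)"
  have slow: "slow N ?L" for N
    using succ_cases(4,5)[OF assms(1)] by (simp add: slow_def assms(2))
  show ?thesis using assms(3,4)
  proof (induction "j - i" arbitrary: i j rule: less_induct)
    case less
    note d = assms(1)[of i]
    \<comment> \<open>\<open>phi (e i)\<close> follows \<open>rev (e i)\<close> in the rotation; if
      it is not a down arc, both belong to the same run.\<close>
    have up_run: "run rot dn c (rev (e i))" if "run rot dn c (phi (e i))" "\<not> dn (phi (e i))" for c
      using run_back[OF inj_rot] that by (simp add: phi_def)
    consider (down) "?L (Suc i) < ?L i" | (level) "?L (Suc i) = ?L i" | (up) "?L i < ?L (Suc i)"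
      by linarith
    then show ?case
    proof cases
      case down
      then have "dn (phi (e i))" using succ_cases(1)[OF d] by (simp add: assms(2))
      then show ?thesis
        using succ_down(3)[OF d] next_lower_down[of ?L i] down by (simp add: assms(2))
    next
      case level
      then have l: "\<not> dn (phi (e i))" "dn (phi (phi (e i)))"
        using succ_cases(2)[OF d] by (simp_all add: assms(2))
      have "Suc i < j" using less.prems level by (cases "Suc i = j") auto
      then have "run rot dn (e (next_lower ?L (Suc i))) (rev (e (Suc i)))"
        using less.prems level by (intro less.hyps[of j "Suc i"]) auto
      then show ?thesis
        using next_lower_level[of ?L i j, OF level less.prems] up_run l succ_level(1)[OF d l]
        by (simp add: assms(2))
    next
      case up
      then have l: "\<not> dn (phi (e i))" "\<not> dn (phi (phi (e i)))"
        using succ_cases(3)[OF d] by (simp_all add: assms(2))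
      note u = succ_up[OF d l, folded assms(2)]
      let ?m = "next_lower ?L (Suc i)"
      note nu = next_lower_up[of j ?L i, OF slow u(3) less.prems]
      have sj: "Suc i < j" using less.prems up by (cases "Suc i = j") auto
      have lm: "?L j < ?L (Suc i)" using less.prems up by simp
      note n = next_lower[of "Suc i" j ?L, OF sj lm]
      have "run rot dn (e ?m) (rev (e (Suc i)))"
        using lm sj less.prems by (intro less.hyps[of j "Suc i"]) auto
      \<comment> \<open>By the face pattern the run through \<open>rev (e (Suc i))\<close> starts at
        \<open>rev (phi (e i))\<close>, so this arc is the corner where the search restarts.\<close>
      then have c: "e ?m = rev (phi (e i))" using u(4) run_unique[OF inj_rot] by blast
      have "run rot dn (e (next_lower ?L ?m)) (rev (e ?m))"
        using n nu less.prems by (intro less.hyps[of j ?m]) auto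
      then show ?thesis using c nu(3) up_run l by (simp add: rev_rev)
    qed
  qed
qed

lemma dn_root: "dn (rev r)" and lab_rev_root: "lab (rev r) = 1"
proof -
  show "dn (rev r)" using r by (simp add: dn_rev) (simp add: dn_def)
  then show "lab (rev r) = 1" using r by (simp add: dn_def rev_rev)
qed

lemma dn_pos: "dn a \<Longrightarrow> 0 < lab a"
  by (simp add: dn_def)

text \<open>
  On a contour cycle let \<open>M\<close> be the arcs of minimal label. Rotating about their heads never leaves
  \<open>rev ` M\<close>, so these heads have no down arc and equal the root vertex. Hence every contour cycle
  contains \<open>rev r\<close>.
\<close>
lemma root_in_orbit_succ:
  assumes "dn x"
  shows "rev r \<in> orbit succ x"
proof -
  define C where "C = orbit succ x"
  have C: "C \<subseteq> {a. dn a}" "C \<noteq> {}"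
    unfolding C_def using permutes_orbit_subset[OF succ_permutes, of x] assms orbit_nonempty[of succ x] by auto
  then have finC: "finite C" using finite_dn finite_subset by blast
  define m where "m = Min (lab ` C)"
  have m_le: "m \<le> lab a" if "a \<in> C" for a
    unfolding m_def using that finC by auto
  define M where "M = {a \<in> C. lab a = m}"
  have "m \<in> lab ` C" unfolding m_def using C finC by (intro Min_in) auto
  then obtain a where a: "a \<in> M" by (auto simp: M_def)
  have succ_C: "succ b \<in> C" if "b \<in> C" for b
    using that unfolding C_def by (rule orbit.step)
  have closed: "rot (rev b) \<in> rev ` M" if "b \<in> M" for b
  proof -
    have b: "b \<in> C" "lab b = m" "dn b" using that C by (auto simp: M_def)
    have "m \<le> lab (succ b)" using m_le succ_C b by blast
    then consider (level) "lab (succ b) = lab b" | (up) "lab b < lab (succ b)" using b by linarith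
    then show ?thesis
    proof cases
      case level
      then have "rot (rev b) = rev (succ b)"
        using succ_level(1)[OF b(3)] succ_cases(2)[OF b(3)] by (simp add: phi_def)
      then show ?thesis using level b succ_C by (auto simp: M_def)
    next
      case up
      then have l: "\<not> dn (phi b)" "\<not> dn (phi (phi b))" using succ_cases(3)[OF b(3)] by auto
      note u = succ_up[OF b(3) l]
      define s where "s i = (succ ^^ i) b" for i
      have s0: "s 0 = b" "s (Suc 0) = succ b" by (simp_all add: s_def)
      have sC: "s i \<in> C" for i
        by (induction i) (use b succ_C in \<open>auto simp: s_def\<close>)
      \<comment> \<open>Going once around the cycle comes back to \<open>b\<close>, which provides
        the later smaller label that the successor of \<open>succ b\<close> requires.\<close>
      have "b \<in> orbit succ b" by (rule permutation_self_in_orbit[OF permutation_succ])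
      then have "\<exists>n. b = s n \<and> 0 < n" unfolding orbit_altdef s_def by simp
      then obtain n where n: "s n = b" "0 < n" by metis
      then have n1: "Suc 0 < n" using up s0 by (cases "n = 1") auto
      let ?L = "\<lambda>i. lab (s i)"
      let ?k = "next_lower ?L (Suc 0)"
      have lt: "?L n < ?L (Suc 0)" using n up s0 by simp
      have "run rot dn (s ?k) (rev (s (Suc 0)))"
        by (rule run_next_lower[OF _ _ n1]) (use lt sC C in \<open>auto simp: s_def\<close>)
      then have k: "s ?k = rev (phi b)" using run_unique[OF inj_rot _ u(4)] s0 by simp
      have "?L ?k < ?L (Suc 0)" by (rule next_lower(2)[OF n1 lt])
      \<comment> \<open>The successor has a label below \<open>m + 1\<close>, and \<open>m\<close>
        is minimal on the cycle.\<close>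
      then have "lab (s ?k) = m" using m_le[OF sC, of ?k] u(3) s0 b by simp
      then have "s ?k \<in> M" using sC by (simp add: M_def)
      moreover have "rot (rev b) = rev (s ?k)" using k by (simp add: rev_rev phi_def)
      ultimately show ?thesis by blast
    qed
  qed
  have orb: "y \<in> rev ` M" if "y \<in> orbit rot (rev a)" for y
    using that
  proof induction
    case base then show ?case using closed a by blast
  next
    case (step y) then show ?case using closed by blast
  qed
  have up: "\<not> dn y" if y: "y \<in> rev ` M" for y
  proof -
    obtain b where "b \<in> M" "y = rev b" using y by blast
    moreover from this have "dn b" using C by (auto simp: M_def)
    ultimately show ?thesis by (simp add: dn_rev dn_D)
  qed
  have aD: "rev a \<in> D" using a C dn_D by (auto simp: M_def)
  have "lab (rev a) = 0"
  proof (rule ccontr)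
    assume "lab (rev a) \<noteq> 0"
    then obtain b where b: "b \<in> orbit rot (rev a)" "lab b = Suc (lab (rev b))"
      using down_exists[OF aD] by auto
    then have "b \<in> D" using subsetD[OF permutes_orbit_subset[OF rot aD]] by simp
    then have "dn b" using b by (simp add: dn_def)
    then show False using up[OF orb[OF b(1)]] by simp
  qed
  then have "r \<in> rev ` M" using label_zero[OF aD] orb by blast
  then obtain b where "b \<in> C" "r = rev b" by (auto simp: M_def)
  then show ?thesis by (simp add: rev_rev C_def)
qed

lemma orbit_succ_root: "orbit succ (rev r) = {a. dn a}"
proof
  show "orbit succ (rev r) \<subseteq> {a. dn a}"
    using permutes_orbit_subset[OF succ_permutes] dn_root by simp
  show "{a. dn a} \<subseteq> orbit succ (rev r)"
    using root_in_orbit_succ orbit_swap[OF permutation_self_in_orbit[OF permutation_succ]] by blast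
qed

definition contour :: "nat \<Rightarrow> 'e" where "contour i = (succ ^^ i) (rev r)"

lemma contour_Suc: "contour (Suc i) = succ (contour i)" by (simp add: contour_def)

lemma dn_contour: "dn (contour i)"
  unfolding contour_def by (rule dn_funpow_succ[OF dn_root])

lemma contour_bij:
  defines "N \<equiv> card {a. dn a}"
  shows "bij_betw contour {..<N} {a. dn a}" "contour N = contour 0" "0 < N"
proof -
  let ?p = "funpow_dist1 succ (rev r) (rev r)"
  have r: "rev r \<in> orbit succ (rev r)" by (rule permutation_self_in_orbit[OF permutation_succ])
  have b: "bij_betw contour {..<?p} {a. dn a}"
    using orbit_conv_funpow_dist1[OF r] inj_on_funpow_dist1[OF r]
    unfolding orbit_succ_root bij_betw_def contour_def lessThan_atLeast0 by simp
  then have p: "?p = N" unfolding N_def by (metis bij_betw_same_card card_lessThan)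
  then show "bij_betw contour {..<N} {a. dn a}" "0 < N" using b by auto
  show "contour N = contour 0"
    using funpow_dist1_prop[OF r] unfolding p[symmetric] contour_def by simp
qed

definition mate :: "nat \<Rightarrow> nat" where
  "mate i = the_inv_into {..<card {a. dn a}} contour (opp (contour i))"

lemma mate:
  assumes "i < card {a. dn a}"
  shows "mate i < card {a. dn a}" "contour (mate i) = opp (contour i)" "mate (mate i) = i" "mate i \<noteq> i"
proof -
  note b = contour_bij(1)
  have o: "opp (contour j) \<in> {a. dn a}" for j using dn_opp dn_contour by blast
  have m: "mate j \<in> {..<card {a. dn a}}" "contour (mate j) = opp (contour j)" for j
    unfolding mate_def
    using bij_betw_the_inv_into[OF b] o[of j] f_the_inv_into_f_bij_betw[OF b] by (auto simp: bij_betw_def)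
  then show "mate i < card {a. dn a}" and c: "contour (mate i) = opp (contour i)" by auto
  have "contour (mate (mate i)) = contour i" using m(2) opp_opp dn_contour by simp
  then show "mate (mate i) = i" using b m(1) assms by (auto simp: bij_betw_def inj_on_def)
  show "mate i \<noteq> i" using c opp_neq[OF dn_contour, of i] by metis
qed

lemma encodes_contour: "encodes rot rev dn lab (card {a. dn a}) contour mate"
proof -
  let ?N = "card {a. dn a}" and ?L = "\<lambda>i. lab (contour i)"
  have slow: "slow N ?L" for N
    using succ_cases(4,5)[OF dn_contour] by (simp add: slow_def contour_Suc)
  have LN: "?L ?N = 1" using contour_bij(2) lab_rev_root by (simp add: contour_def)
  have "(?L (Suc i) < ?L i \<longrightarrow> rot (rev (contour i)) = contour (mate i) \<and>
          run rot dn (contour (Suc i)) (rev (contour i))) \<and>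
      (?L (Suc i) = ?L i \<longrightarrow> rot (rev (contour i)) = rev (contour (Suc i)) \<and>
          rot (contour (Suc i)) = contour (mate i)) \<and>
      (?L i < ?L (Suc i) \<longrightarrow>
         rot (rev (contour i)) = rev (contour (next_lower ?L (Suc i))) \<and>
         rot (contour (next_lower ?L (Suc i))) = rev (contour (Suc i)) \<and>
         rot (contour (Suc i)) = contour (mate i))" if i: "i < ?N" for i
  proof (intro conjI impI)
    note d = dn_contour[of i]
    show "rot (rev (contour i)) = contour (mate i)" "run rot dn (contour (Suc i)) (rev (contour i))"
      if "?L (Suc i) < ?L i"
      using succ_down[OF d] succ_cases(1)[OF d] mate(2)[OF i] that by (simp_all add: contour_Suc phi_def)
    show "rot (rev (contour i)) = rev (contour (Suc i))" "rot (contour (Suc i)) = contour (mate i)"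
      if "?L (Suc i) = ?L i"
      using succ_level[OF d] succ_cases(2)[OF d] mate(2)[OF i] that
      by (simp_all add: contour_Suc phi_def rev_rev)
    assume up: "?L i < ?L (Suc i)"
    then have l: "\<not> dn (phi (contour i))" "\<not> dn (phi (phi (contour i)))"
      using succ_cases(3)[OF d] by (auto simp: contour_Suc)
    note u = succ_up[OF d l, folded contour_Suc]
    \<comment> \<open>The contour closes at label 1, and an ascending step ends above 1; hence the
      successor is found no later than corner \<open>N\<close>.\<close>
    have lt: "?L ?N < ?L (Suc i)" using u(3) LN dn_pos[OF d] by simp
    then have "Suc i < ?N" using i by (cases "Suc i = ?N") auto
    then have "run rot dn (contour (next_lower ?L (Suc i))) (rev (contour (Suc i)))"
      by (rule run_next_lower[OF dn_contour contour_Suc _ lt])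
    then have c: "contour (next_lower ?L (Suc i)) = rev (phi (contour i))"
      using run_unique[OF inj_rot _ u(4)] by blast
    then show "rot (rev (contour i)) = rev (contour (next_lower ?L (Suc i)))"
      "rot (contour (next_lower ?L (Suc i))) = rev (contour (Suc i))"
      using u(1) by (simp_all add: rev_rev phi_def)
    show "rot (contour (Suc i)) = contour (mate i)"
      using u(2) mate(2)[OF i] by (simp add: phi_def rev_rev)
  qed
  then show ?thesis
    unfolding encodes_def Let_def using contour_bij slow mate(1) by blast
qed

end

section \<open>Planar maps\<close>

context rooted_planar_map
begin

abbreviation "G \<equiv> map_graph m"
abbreviation "D \<equiv> map_arcs m"
abbreviation "V \<equiv> map_verts m"
abbreviation "rot \<equiv> map_rot m"
abbreviation "rv \<equiv> map_rev m"
abbreviation "src \<equiv> tail (map_graph m)"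
abbreviation "dst \<equiv> head (map_graph m)"
abbreviation "d \<equiv> graph_dist (map_graph m) (root_vertex m)"

section \<open>Arcs, rotation orbits and distances in a rooted planar map\<close>

lemma D_arcs: "D = arcs G" and V_verts: "V = verts G"
  by (simp_all add: map_arcs_def map_verts_def)

lemma wf: "wf_digraph G" using fin by (simp add: fin_digraph_def)

lemma finite_D: "finite D" and finite_V: "finite V"
  using fin_digraph.finite_arcs[OF fin] fin_digraph.finite_verts[OF fin] by (simp_all add: D_arcs V_verts)

lemma rv_rv [simp]: "rv (rv a) = a"
  by (rule bidirected_digraph.arev_arev[OF bidirected])

lemma rv_permutes: "rv permutes D"
  unfolding D_arcs by (rule bidirected_digraph.arev_permutes_arcs[OF bidirected])

lemma rv_D [simp]: "rv a \<in> D \<longleftrightarrow> a \<in> D" and rot_D [simp]: "rot a \<in> D \<longleftrightarrow> a \<in> D"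
  using rv_permutes rot_permutes by (auto simp: permutes_in_image)

lemma rv_neq: "a \<in> D \<Longrightarrow> rv a \<noteq> a"
  unfolding D_arcs by (rule bidirected_digraph.arev_neq[OF bidirected])

lemma src_rv [simp]: "a \<in> D \<Longrightarrow> src (rv a) = dst a" and dst_rv [simp]: "a \<in> D \<Longrightarrow> dst (rv a) = src a"
  unfolding D_arcs
  by (simp_all add: bidirected_digraph.tail_arev[OF bidirected] bidirected_digraph.head_arev[OF bidirected])

lemma src_V [simp]: "a \<in> D \<Longrightarrow> src a \<in> V" and dst_V [simp]: "a \<in> D \<Longrightarrow> dst a \<in> V"
  unfolding D_arcs V_verts
  by (simp_all add: wf_digraph.tail_in_verts[OF wf] wf_digraph.head_in_verts[OF wf])

lemma permutation_rot: "permutation rot"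
  using rot_permutes finite_D by (auto simp: permutation_permutes)

lemma orbit_rot:
  assumes "a \<in> D"
  shows "orbit rot a = {b \<in> D. src b = src a}"
proof -
  have a: "a \<in> out_arcs G (src a)" using assms by (simp add: D_arcs)
  then have "cyclic_on rot (out_arcs G (src a))" using rot_cyclic[OF src_V[OF assms]] by blast
  then have "orbit rot a = out_arcs G (src a)" using a by (rule orbit_cyclic_eq3)
  then show ?thesis unfolding out_arcs_def D_arcs .
qed

lemma src_rot [simp]: "a \<in> D \<Longrightarrow> src (rot a) = src a"
  using orbit_rot[of a] orbit.base[of rot a] by auto

text \<open>Arcs have reverses, so closure of \<open>W\<close> along arcs in their own direction
  already covers the symmetric closure behind \<open>connected\<close>.\<close>

lemma connected_verts:
  assumes "u \<in> W" "u \<in> V" "v \<in> V" "\<And>a. a \<in> D \<Longrightarrow> src a \<in> W \<Longrightarrow> dst a \<in> W"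
  shows "v \<in> W"
proof -
  have "(u, v) \<in> rtrancl_on (verts G) ((arcs_ends G)\<^sup>s)"
    using connected assms(2,3) by (simp add: connected_conv V_verts)
  then show ?thesis
  proof (induction rule: rtrancl_on_induct)
    case base
    show ?case by (rule assms(1))
  next
    case (step y z)
    then obtain a where "a \<in> D" "src a = y \<and> dst a = z \<or> src a = z \<and> dst a = y"
      by (auto simp: symcl_def arcs_ends_conv D_arcs)
    then show ?case using step.IH assms(4)[of a] assms(4)[of "rv a"] by auto
  qed
qed

text \<open>Connectedness of the graph is transitivity of the group generated by \<open>rot\<close>
  and \<open>rv\<close>.\<close>

lemma connected_darts:
  assumes "a \<in> Y" "Y \<subseteq> D" "\<And>b. b \<in> Y \<Longrightarrow> rv b \<in> Y" "\<And>b. b \<in> Y \<Longrightarrow> rot b \<in> Y"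
  shows "Y = D"
proof -
  have orb: "b \<in> Y" if "c \<in> Y" "b \<in> D" "src b = src c" for b c
  proof -
    have "b \<in> orbit rot c" using that assms(2) orbit_rot by auto
    then show ?thesis by induction (use that assms(4) in auto)
  qed
  have "v \<in> src ` Y" if "v \<in> V" for v
  proof (rule connected_verts[OF _ _ that])
    show "src a \<in> src ` Y" "src a \<in> V" using assms(1,2) by auto
    fix b assume b: "b \<in> D" "src b \<in> src ` Y"
    then have "b \<in> Y" using orb by blast
    then have "rv b \<in> Y" by (rule assms(3))
    then show "dst b \<in> src ` Y" using b(1) by (metis imageI src_rv)
  qed
  then have "b \<in> Y" if "b \<in> D" for b
    using orb[of _ b] that src_V[of b] by fastforce
  then show ?thesis using assms(2) by blast
qed

lemma root_arc_D: "root_arc m \<in> D" and root_V: "root_vertex m \<in> V"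
  using root_arc_in_arcs root_vertex_in_verts rooted_planar_map_axioms by blast+

lemma awalk_exists: "v \<in> V \<Longrightarrow> \<exists>p. pre_digraph.awalk G (root_vertex m) p v"
proof -
  assume v: "v \<in> V"
  have "v \<in> {v. \<exists>p. pre_digraph.awalk G (root_vertex m) p v}"
  proof (rule connected_verts[OF _ root_V v])
    show "root_vertex m \<in> {v. \<exists>p. pre_digraph.awalk G (root_vertex m) p v}"
      using wf_digraph.awalk_Nil_iff[OF wf, of "root_vertex m" "root_vertex m"] root_V V_verts by auto
    fix a assume a: "a \<in> D" "src a \<in> {v. \<exists>p. pre_digraph.awalk G (root_vertex m) p v}"
    then obtain p where p: "pre_digraph.awalk G (root_vertex m) p (src a)" by blast
    have "pre_digraph.awalk G (src a) [a] (dst a)"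
      using a(1) wf_digraph.arc_implies_awalk[OF wf, of a] by (simp add: D_arcs)
    from wf_digraph.awalk_appendI[OF wf p this]
    show "dst a \<in> {v. \<exists>p. pre_digraph.awalk G (root_vertex m) p v}" by blast
  qed
  then show ?thesis by blast
qed

lemma dist_walk:
  assumes "v \<in> V"
  obtains p where "pre_digraph.awalk G (root_vertex m) p v" "length p = d v"
proof -
  have "\<exists>k p. pre_digraph.awalk G (root_vertex m) p v \<and> length p = k"
    using awalk_exists[OF assms] by blast
  then have "\<exists>p. pre_digraph.awalk G (root_vertex m) p v \<and> length p = d v"
    unfolding graph_dist_def by (rule LeastI_ex)
  then show ?thesis using that by blast
qed

lemma dist_le: "pre_digraph.awalk G (root_vertex m) p v \<Longrightarrow> d v \<le> length p"
  unfolding graph_dist_def by (rule Least_le) blast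

lemma dist_root: "d (root_vertex m) = 0"
  using dist_le[of "[]" "root_vertex m"] wf_digraph.awalk_Nil_iff[OF wf, of "root_vertex m" "root_vertex m"]
    root_V V_verts by simp

lemma dist_head: "a \<in> D \<Longrightarrow> d (dst a) \<le> Suc (d (src a))"
proof -
  assume a: "a \<in> D"
  obtain p where p: "pre_digraph.awalk G (root_vertex m) p (src a)" "length p = d (src a)"
    using dist_walk[OF src_V[OF a]] .
  have "pre_digraph.awalk G (src a) [a] (dst a)"
    using a wf_digraph.arc_implies_awalk[OF wf, of a] by (simp add: D_arcs)
  then have "pre_digraph.awalk G (root_vertex m) (p @ [a]) (dst a)"
    by (rule wf_digraph.awalk_appendI[OF wf p(1)])
  from dist_le[OF this] show ?thesis using p(2) by simp
qed

lemma dist_down: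
  assumes "v \<in> V" "v \<noteq> root_vertex m"
  obtains a where "a \<in> D" "src a = v" "d v = Suc (d (dst a))"
proof -
  obtain p where p: "pre_digraph.awalk G (root_vertex m) p v" "length p = d v"
    using dist_walk[OF assms(1)] .
  have "p \<noteq> []" using p assms(2) wf_digraph.awalk_Nil_iff[OF wf] by auto
  then obtain q b where q: "p = q @ [b]" by (cases p rule: rev_cases) auto
  have w: "pre_digraph.awalk G (root_vertex m) q (src b)" "b \<in> D" "dst b = v"
    using p(1) unfolding q wf_digraph.awalk_append_iff[OF wf] wf_digraph.awalk_Cons_iff[OF wf]
      wf_digraph.awalk_Nil_iff[OF wf] by (auto simp: D_arcs)
  have "d v = Suc (d (src b))" using dist_le[OF w(1)] dist_head[OF w(2)] w(3) p(2) q by simp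
  then show ?thesis using that[of "rv b"] w by simp
qed

text \<open>A function that grows by at most one along arcs and can be decreased by one at every
  vertex except the root is the distance. This identifies the labels of a tree with distances in its
  map.\<close>

lemma dist_unique:
  assumes f0: "f (root_vertex m) = 0"
    and up: "\<And>a. a \<in> D \<Longrightarrow> f (dst a) \<le> Suc (f (src a))"
    and down: "\<And>v. v \<in> V \<Longrightarrow> v \<noteq> root_vertex m \<Longrightarrow> \<exists>a\<in>D. src a = v \<and> f v = Suc (f (dst a))"
    and v: "v \<in> V"
  shows "d v = f v"
proof (rule antisym)
  show "d v \<le> f v" using v
  proof (induction "f v" arbitrary: v rule: less_induct)
    case less
    show ?case
    proof (cases "v = root_vertex m")
      case False
      then obtain a where a: "a \<in> D" "src a = v" "f v = Suc (f (dst a))" using down less.prems by blast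
      then have "d (dst a) \<le> f (dst a)" using less.hyps by simp
      then show ?thesis using dist_head[of "rv a"] a by simp
    qed (simp add: dist_root)
  qed
  show "f v \<le> d v" using v
  proof (induction "d v" arbitrary: v rule: less_induct)
    case less
    show ?case
    proof (cases "v = root_vertex m")
      case False
      then obtain a where a: "a \<in> D" "src a = v" "d v = Suc (d (dst a))" using dist_down[OF less.prems] by blast
      then have "f (dst a) \<le> d (dst a)" using less.hyps by simp
      then show ?thesis using up[of "rv a"] a by simp
    qed (simp add: f0)
  qed
qed

section \<open>Faces and a spanning tree of the dual graph\<close>

definition phi where "phi = rot \<circ> rv"

lemma phi_permutes: "phi permutes D"
  unfolding phi_def using rv_permutes rot_permutes by (rule permutes_compose)

lemma phi_D [simp]: "phi a \<in> D \<longleftrightarrow> a \<in> D" by (simp add: phi_def)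

lemma src_phi [simp]: "a \<in> D \<Longrightarrow> src (phi a) = dst a" by (simp add: phi_def)

lemma permutation_phi: "permutation phi"
  using phi_permutes finite_D by (auto simp: permutation_permutes)

lemma faces_eq: "map_faces m = orbit phi ` D"
  by (simp add: map_faces_def phi_def)

lemma face_unique:
  assumes "F \<in> map_faces m" "a \<in> F"
  shows "F = orbit phi a"
proof -
  obtain b where b: "F = orbit phi b" using assms(1) by (auto simp: faces_eq)
  then have "cyclic_on phi F" using cyclic_on_orbit[OF phi_permutes finite_D] by simp
  from orbit_cyclic_eq3[OF this assms(2)] show ?thesis by simp
qed

lemma self_face: "a \<in> orbit phi a"
  by (rule permutation_self_in_orbit[OF permutation_phi])

lemma face_D: "F \<in> map_faces m \<Longrightarrow> F \<subseteq> D"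
  using permutes_orbit_subset[OF phi_permutes] by (auto simp: faces_eq)

lemma finite_faces: "finite (map_faces m)"
  using finite_D by (simp add: faces_eq)

lemma infinite_face_eq: "infinite_face m = orbit phi (root_arc m)"
  using face_unique[OF infinite_face root_on_border] .

lemma face_nonempty: "F \<in> map_faces m \<Longrightarrow> \<exists>a. a \<in> F"
  using self_face by (auto simp: faces_eq)

text \<open>Since \<open>rot\<close> is \<open>phi\<close> after \<open>rv\<close>, a union of faces
  that is closed under \<open>rv\<close> is closed under \<open>rot\<close> too, and so contains
  every arc.\<close>

lemma dual_tree_step:
  assumes X: "X \<subseteq> map_faces m" "X \<noteq> {}" "X \<noteq> map_faces m"
  shows "\<exists>a. a \<in> \<Union>X \<and> rv a \<in> D \<and> rv a \<notin> \<Union>X"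
proof (rule ccontr)
  assume contr: "\<not> ?thesis"
  have sub: "\<Union>X \<subseteq> D" using X(1) face_D by blast
  then have rv: "rv a \<in> \<Union>X" if "a \<in> \<Union>X" for a
    using that contr by auto
  have phi: "phi a \<in> \<Union>X" if a: "a \<in> \<Union>X" for a
  proof -
    obtain F where F: "F \<in> X" "a \<in> F" using a by blast
    then have "F = orbit phi a" using X(1) by (intro face_unique) auto
    then show ?thesis using F orbit.base[of phi a] by auto
  qed
  obtain F where F: "F \<in> X" using X(2) by blast
  then obtain a where a: "a \<in> F" using X(1) face_nonempty by blast
  have eq: "\<Union>X = D"
  proof (rule connected_darts)
    show "a \<in> \<Union>X" using F a by blast
    show "\<Union>X \<subseteq> D" by (rule sub)
    show "rot b \<in> \<Union>X" if "b \<in> \<Union>X" for b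
      using phi[OF rv[OF that]] by (simp add: phi_def)
  qed (rule rv)
  have "map_faces m \<subseteq> X"
  proof
    fix F' assume F': "F' \<in> map_faces m"
    then obtain b where b: "b \<in> F'" using face_nonempty by blast
    then have "b \<in> \<Union>X" using eq face_D[OF F'] by blast
    then obtain F'' where F'': "F'' \<in> X" "b \<in> F''" by blast
    then have "F'' = orbit phi b" using X(1) by (intro face_unique) auto
    then show "F' \<in> X" using F''(1) face_unique[OF F' b] by simp
  qed
  then show False using X by blast
qed

text \<open>\<open>S\<close> consists of the arcs of a spanning tree of the dual graph.\<close>
lemma dual_tree:
  "\<exists>S\<subseteq>D. rv ` S \<subseteq> S \<and> card S + 2 = 2 * card (map_faces m) \<and>
     (\<forall>H\<subseteq>S. rv ` H \<subseteq> H \<and> (\<forall>F\<in>map_faces m. even (card (H \<inter> F))) \<longrightarrow> H = {})"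
proof -
  let ?P = "\<lambda>S. \<forall>H\<subseteq>S. rv ` H \<subseteq> H \<and> (\<forall>F\<in>map_faces m. even (card (H \<inter> F))) \<longrightarrow> H = {}"
  \<comment> \<open>\<open>X\<close> is the set of faces reached by a partial dual tree and
    \<open>S\<close> the set of its arcs, two for each edge; every round adds one face as a
    leaf.\<close>
  have "\<exists>X S. X \<subseteq> map_faces m \<and> card X = Suc k \<and> S \<subseteq> \<Union>X \<and> rv ` S \<subseteq> S \<and> card S = 2 * k \<and> ?P S"
    if "k < card (map_faces m)" for k
    using that
  proof (induction k)
    case 0
    have "{infinite_face m} \<subseteq> map_faces m" using infinite_face by simp
    then show ?case by (intro exI[of _ "{infinite_face m}"] exI[of _ "{}"]) auto
  next
    case (Suc k)
    then obtain X S where X: "X \<subseteq> map_faces m" "card X = Suc k" "S \<subseteq> \<Union>X" "rv ` S \<subseteq> S"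
      "card S = 2 * k" and P: "?P S" by auto
    have "X \<noteq> {}" "X \<noteq> map_faces m" using X Suc.prems by auto
    then obtain a where a: "a \<in> \<Union>X" "rv a \<in> D" "rv a \<notin> \<Union>X" using dual_tree_step[OF X(1)] by blast
    define F where "F = orbit phi (rv a)"
    have F: "F \<in> map_faces m" "rv a \<in> F" using a(2) self_face by (auto simp: F_def faces_eq)
    have disj: "F \<inter> \<Union>X = {}"
    proof (rule ccontr)
      assume "F \<inter> \<Union>X \<noteq> {}"
      then obtain b F' where "b \<in> F" "b \<in> F'" "F' \<in> X" by blast
      then have "F = F'" using face_unique[of F b] face_unique[of F' b] F(1) X(1) by auto
      then show False using \<open>F' \<in> X\<close> F(2) a(3) by blast
    qed
    have "S \<subseteq> D" using X(1,3) face_D by blast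
    then have finS: "finite S" using finite_D finite_subset by blast
    have aS: "a \<notin> S" "rv a \<notin> S"
    proof -
      show "rv a \<notin> S" using X(3) a(3) by blast
      then show "a \<notin> S" using X(4) by blast
    qed
    let ?S = "insert a (insert (rv a) S)"
    have ne: "a \<noteq> rv a" using rv_neq[of a] a(2) by auto
    show ?case
    proof (intro exI[of _ "insert F X"] exI[of _ ?S] conjI)
      show "insert F X \<subseteq> map_faces m" using F X by simp
      have "F \<notin> X" using disj F(2) by blast
      then show "card (insert F X) = Suc (Suc k)"
        using X finite_subset[OF X(1) finite_faces] by simp
      show "?S \<subseteq> \<Union> (insert F X)" using a(1) F(2) X(3) by auto
      show "rv ` ?S \<subseteq> ?S" using X(4) by auto
      show "card ?S = 2 * Suc k" using aS ne finS X(5) by simp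
      show "?P ?S"
      proof (intro allI impI, elim conjE)
        fix H assume H: "H \<subseteq> ?S" "rv ` H \<subseteq> H" "\<forall>F\<in>map_faces m. even (card (H \<inter> F))"
        \<comment> \<open>Leaf removal: the new face can meet \<open>H\<close> only in
          \<open>rv a\<close>, so evenness excludes the new edge and leaves a subset of the old
          tree.\<close>
        have "S \<inter> F = {}" using disj X(3) by auto
        moreover have "a \<notin> F" using disj a(1) by auto
        ultimately have "H \<inter> F \<subseteq> {rv a}" using H(1) by auto
        moreover have "even (card (H \<inter> F))" using H(3) F(1) by blast
        ultimately have "H \<inter> F = {}" by (cases "H \<inter> F = {}") (auto simp: subset_singleton_iff)
        then have r: "rv a \<notin> H" using F(2) by blast
        then have "a \<notin> H" using H(2) by blast
        then have "H \<subseteq> S" using H(1) r by blast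
        then show "H = {}" using P H(2,3) by blast
      qed
    qed
  qed
  moreover have "0 < card (map_faces m)" using finite_faces infinite_face by (auto simp: card_gt_0_iff)
  ultimately obtain X S where "X \<subseteq> map_faces m" "S \<subseteq> \<Union>X" "rv ` S \<subseteq> S"
    "card S = 2 * (card (map_faces m) - 1)" "?P S"
    by (metis Suc_pred' lessI)
  moreover from this have "S \<subseteq> D" using face_D by blast
  ultimately show ?thesis using \<open>0 < card (map_faces m)\<close> by (intro exI[of _ S]) auto
qed

end

section \<open>Bipartiteness of quadrangulations and their distance labels\<close>

locale quadrangulation = rooted_planar_map m
  for m :: "('v, 'e::linorder) rooted_map" +
  assumes quad: "map_quadrangulation m"
begin

lemma face_four:
  assumes "a \<in> D"
  shows "phi (phi (phi (phi a))) = a" "distinct [a, phi a, phi (phi a), phi (phi (phi a))]"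
    "orbit phi a = {a, phi a, phi (phi a), phi (phi (phi a))}"
proof -
  let ?p = "funpow_dist1 phi a a"
  note self = self_face[of a]
  have "card (orbit phi a) = 4"
    using quad assms by (auto simp: map_quadrangulation_def face_degree_def faces_eq)
  then have "card ((\<lambda>n. (phi ^^ n) a) ` {0..<?p}) = 4"
    using orbit_conv_funpow_dist1[OF self] by simp
  then have p: "?p = 4" using card_image[OF inj_on_funpow_dist1[OF self]] by simp
  have "(phi ^^ 4) a = a" using funpow_dist1_prop[OF self] unfolding p .
  then show "phi (phi (phi (phi a))) = a" by (simp add: eval_nat_numeral)
  have i: "inj_on (\<lambda>n. (phi ^^ n) a) {0..<4}" using inj_on_funpow_dist1[OF self] unfolding p .
  have "(phi ^^ j) a \<noteq> (phi ^^ k) a" if "j < k" "k < 4" for j k :: nat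
    using inj_onD[OF i, of j k] that by auto
  from this[of 0 1] this[of 0 2] this[of 0 3] this[of 1 2] this[of 1 3] this[of 2 3]
  show "distinct [a, phi a, phi (phi a), phi (phi (phi a))]" by (simp add: eval_nat_numeral)
  have "orbit phi a = (\<lambda>n. (phi ^^ n) a) ` {0..<4}"
    using orbit_conv_funpow_dist1[OF self] unfolding p .
  also have "{0..<4} = {0, 1, 2, 3::nat}" by auto
  finally show "orbit phi a = {a, phi a, phi (phi a), phi (phi (phi a))}"
    by (simp add: eval_nat_numeral)
qed

lemma card_D: "card D = 4 * card (map_faces m)"
proof -
  have "card (orbit phi a) = 4" if "a \<in> D" for a
    using quad that by (auto simp: map_quadrangulation_def face_degree_def faces_eq)
  from card_orbits[OF phi_permutes finite_D this] show ?thesis by (simp add: faces_eq)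
qed

lemma card_V: "card V = card (map_faces m) + 2"
  using euler card_D by simp

definition boundary :: "'v set \<Rightarrow> 'e set" where
  "boundary X = {a \<in> D. (src a \<in> X) \<noteq> (dst a \<in> X)}"

text \<open>A closed walk changes sides of a cut an even number of times. As the degree 4 is even,
  the arcs of the face outside the cut are even in number as well.\<close>

lemma even_boundary:
  assumes "F \<in> map_faces m"
  shows "even (card (boundary X \<inter> F))" "even (card (F - boundary X))"
proof -
  obtain a where a: "a \<in> D" "F = orbit phi a" using assms by (auto simp: faces_eq)
  note f = face_four[OF a(1)]
  have F: "F = {a, phi a, phi (phi a), phi (phi (phi a))}" using a(2) f(3) by simp
  have last: "dst (phi (phi (phi a))) = src a"
    using src_phi[of "phi (phi (phi a))"] a(1) f(1) by simp
  have b: "a \<in> boundary X \<longleftrightarrow> (src a \<in> X) \<noteq> (dst a \<in> X)"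
    "phi a \<in> boundary X \<longleftrightarrow> (dst a \<in> X) \<noteq> (dst (phi a) \<in> X)"
    "phi (phi a) \<in> boundary X \<longleftrightarrow> (dst (phi a) \<in> X) \<noteq> (dst (phi (phi a)) \<in> X)"
    "phi (phi (phi a)) \<in> boundary X \<longleftrightarrow> (dst (phi (phi a)) \<in> X) \<noteq> (src a \<in> X)"
    using a(1) last by (simp_all add: boundary_def)
  show e: "even (card (boundary X \<inter> F))"
    using f(2) unfolding F
    by (cases "src a \<in> X"; cases "dst a \<in> X"; cases "dst (phi a) \<in> X"; cases "dst (phi (phi a)) \<in> X")
      (simp_all add: b Int_insert_right)
  have "card F = 4" using f(2) unfolding F by simp
  moreover have "card F = card (boundary X \<inter> F) + card (F - boundary X)"
    unfolding F by (subst card_Un_disjoint [symmetric]) (auto intro!: arg_cong[where f = card])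
  ultimately show "even (card (F - boundary X))" using e by presburger
qed

lemma rv_boundary: "rv ` boundary X \<subseteq> boundary X"
  by (auto simp: boundary_def)

text \<open>
  Restricting \<open>boundary X\<close>, for \<open>X\<close> avoiding the root vertex, to the edges outside a dual spanning
  tree is injective; by Euler's formula it is a map between sets of the same size, so some \<open>X\<close> is
  separated by all these edges, and then by all edges.
\<close>
lemma bipartite: "\<exists>X. boundary X = D"
proof -
  obtain S where S: "S \<subseteq> D" "rv ` S \<subseteq> S" "card S + 2 = 2 * card (map_faces m)"
    and dual': "\<forall>H\<subseteq>S. rv ` H \<subseteq> H \<and> (\<forall>F\<in>map_faces m. even (card (H \<inter> F))) \<longrightarrow> H = {}"
    using dual_tree by (elim exE conjE) (rule that)
  have dual: "H = {}"
    if "H \<subseteq> S" "rv ` H \<subseteq> H" "\<And>F. F \<in> map_faces m \<Longrightarrow> even (card (H \<inter> F))" for H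
    using dual'[rule_format, OF that(1)] that(2,3) by simp
  define P where "P = {a \<in> D - S. a < rv a}"
  have rvT: "rv a \<in> D - S" if "a \<in> D - S" for a
    using that S(2) by (metis DiffD1 DiffD2 DiffI image_subset_iff rv_D rv_rv)
  have finS: "finite S" using S(1) finite_D finite_subset by blast
  have "card (D - S) = 2 * card P"
    unfolding P_def by (rule card_involution) (use finite_D rvT rv_neq in auto)
  moreover have "card (D - S) = card D - card S" using S(1) finS by (simp add: card_Diff_subset)
  \<comment> \<open>Of the \<open>2 n\<close> edges, \<open>n - 1\<close> are in the dual tree,
    which leaves \<open>n + 1\<close>; with \<open>n + 2\<close> vertices, \<open>P\<close> is as
    large as the set of vertices other than the root.\<close>
  ultimately have cP: "Suc (card P) = card V" using S(3) card_D card_V by simp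
  let ?A = "Pow (V - {root_vertex m})"
  define h where "h X = boundary X \<inter> P" for X
  have out: "a \<in> boundary X \<longleftrightarrow> (if a < rv a then a else rv a) \<in> h X" if a: "a \<in> D - S" for a X
  proof (cases "a < rv a")
    case True then show ?thesis using a by (auto simp: h_def P_def)
  next
    case False
    then have "rv a < a" using rv_neq a by (metis DiffD1 linorder_neqE)
    then have "rv a \<in> P" using rvT[OF a] by (simp add: P_def)
    moreover have "a \<in> boundary X \<longleftrightarrow> rv a \<in> boundary X" using a by (auto simp: boundary_def)
    ultimately show ?thesis using False by (simp add: h_def)
  qed
  have "inj_on h ?A"
  proof (rule inj_onI)
    fix X Y assume X: "X \<in> ?A" and Y: "Y \<in> ?A" and eq: "h X = h Y"
    \<comment> \<open>Cuts add modulo 2: the cut of the symmetric difference consists of the arcs in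
      exactly one of the two cuts. It lies in the dual tree, hence is empty.\<close>
    define Z where "Z = {v. (v \<in> X) \<noteq> (v \<in> Y)}"
    have bZ: "a \<in> boundary Z \<longleftrightarrow> (a \<in> boundary X) \<noteq> (a \<in> boundary Y)" if "a \<in> D" for a
      using that by (auto simp: boundary_def Z_def)
    have "boundary Z \<subseteq> S"
    proof
      fix a assume a: "a \<in> boundary Z"
      then have "a \<in> D" by (simp add: boundary_def)
      then show "a \<in> S" using bZ[of a] a out[of a X] out[of a Y] eq by auto
    qed
    then have b0: "boundary Z = {}"
      by (rule dual) (use rv_boundary even_boundary in auto)
    have "v \<in> {v. v \<in> V \<and> v \<notin> Z}" if "v \<in> V" for v
    proof (rule connected_verts[OF _ root_V that])
      show "root_vertex m \<in> {v. v \<in> V \<and> v \<notin> Z}" using root_V X Y by (auto simp: Z_def)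
      fix a assume "a \<in> D" "src a \<in> {v. v \<in> V \<and> v \<notin> Z}"
      then show "dst a \<in> {v. v \<in> V \<and> v \<notin> Z}" using b0 by (auto simp: boundary_def)
    qed
    then show "X = Y" using X Y by (auto simp: Z_def)
  qed
  moreover have "h ` ?A \<subseteq> Pow P" by (auto simp: h_def)
  moreover have "card ?A = card (Pow P)"
    using finite_V finite_D root_V cP by (simp add: card_Pow P_def)
  moreover have "finite (Pow P)" using finite_D by (simp add: P_def)
  ultimately have "h ` ?A = Pow P"
    by (metis card_image card_subset_eq)
  then have "P \<in> h ` ?A" by blast
  then obtain X where X: "h X = P" by blast
  \<comment> \<open>The complement of a cut is even on faces too, so the tree property can be
    applied to it in turn.\<close>
  have "D - boundary X \<subseteq> S"
  proof
    fix a assume a: "a \<in> D - boundary X"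
    show "a \<in> S"
    proof (rule ccontr)
      assume "a \<notin> S"
      then have "(if a < rv a then a else rv a) \<notin> P" using out[of a X] a X by auto
      moreover have "rv a < a \<or> a < rv a" using rv_neq a by (metis DiffD1 linorder_neqE)
      ultimately show False using a rvT[of a] \<open>a \<notin> S\<close> by (auto simp: P_def split: if_splits)
    qed
  qed
  then have "D - boundary X = {}"
  proof (rule dual)
    show "rv ` (D - boundary X) \<subseteq> D - boundary X" by (auto simp: boundary_def)
    fix F assume F: "F \<in> map_faces m"
    have "(D - boundary X) \<inter> F = F - boundary X" using face_D[OF F] by blast
    then show "even (card ((D - boundary X) \<inter> F))" using even_boundary(2)[OF F] by simp
  qed
  then show ?thesis by (auto simp: boundary_def)
qed

lemma dist_arc: 
  assumes "a \<in> D"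
  shows "d (dst a) = Suc (d (src a)) \<or> d (src a) = Suc (d (dst a))"
proof -
  obtain X where X: "boundary X = D" using bipartite ..
  then have bd: "(src a \<in> X) \<noteq> (dst a \<in> X)" if "a \<in> D" for a using that by (auto simp: boundary_def)
  \<comment> \<open>The parity of the distance tells the side of the bipartition; so the ends of an
    arc never have equal distance.\<close>
  have par: "even (d v) \<longleftrightarrow> (v \<in> X \<longleftrightarrow> root_vertex m \<in> X)" if "v \<in> V" for v
    using that
  proof (induction "d v" arbitrary: v rule: less_induct)
    case less
    show ?case
    proof (cases "v = root_vertex m")
      case False
      then obtain b where b: "b \<in> D" "src b = v" "d v = Suc (d (dst b))" using dist_down[OF less.prems] by blast
      then have "even (d (dst b)) \<longleftrightarrow> (dst b \<in> X \<longleftrightarrow> root_vertex m \<in> X)" by (intro less.hyps) auto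
      then show ?thesis using b bd[OF b(1)] by auto
    qed (simp add: dist_root)
  qed
  have "even (d (src a)) \<noteq> even (d (dst a))" using par bd[OF assms] assms by auto
  moreover have "d (dst a) \<le> Suc (d (src a))" "d (src a) \<le> Suc (d (dst a))"
    using dist_head[OF assms] dist_head[of "rv a"] assms by auto
  ultimately show ?thesis by presburger
qed

lemma dist_zero:
  assumes "v \<in> V"
  shows "d v = 0 \<longleftrightarrow> v = root_vertex m"
proof (cases "v = root_vertex m")
  case False
  then obtain a where "d v = Suc (d (dst a))" using dist_down[OF assms] by blast
  then show ?thesis using False by simp
qed (simp add: dist_root)

sublocale Q: quadrangulated_surface D rot rv "\<lambda>a. d (src a)" "root_arc m"
proof
  have orb: "b \<in> orbit rot a" if "a \<in> D" "b \<in> D" "src b = src a" for a b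
    using orbit_rot[OF that(1)] that by auto
  show "\<exists>b\<in>orbit rot a. d (src b) = Suc (d (src (rv b)))" if a: "a \<in> D" "0 < d (src a)" for a
  proof -
    have "src a \<noteq> root_vertex m" using a(2) dist_root by auto
    then obtain b where b: "b \<in> D" "src b = src a" "d (src a) = Suc (d (dst b))"
      using dist_down[OF src_V[OF a(1)]] by blast
    then have "d (src b) = Suc (d (src (rv b)))" by simp
    then show ?thesis using orb[OF a(1) b(1,2)] by blast
  qed
  show "root_arc m \<in> orbit rot a" if "a \<in> D" "d (src a) = 0" for a
    using that orb[OF that(1) root_arc_D] dist_zero[of "src a"] by (simp add: root_vertex_def)
  show "rot (rv (rot (rv (rot (rv (rot (rv a))))))) = a" "rot (rv (rot (rv a))) \<noteq> a" if "a \<in> D" for a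
    using face_four[OF that] by (auto simp: phi_def)
  show "d (src (root_arc m)) = 0" using dist_root by (simp add: root_vertex_def)
  show "d (src (rv a)) = Suc (d (src a)) \<or> d (src a) = Suc (d (src (rv a)))" if "a \<in> D" for a
    using dist_arc[OF that] that by simp
qed (use finite_D rot_permutes rv_permutes root_arc_D in simp_all)

end

section \<open>Quadrangulations coded by trees\<close>

definition down_arc :: "('v, 'e) rooted_map \<Rightarrow> 'e \<Rightarrow> bool" where
  "down_arc m a \<longleftrightarrow> a \<in> map_arcs m \<and>
     graph_dist (map_graph m) (root_vertex m) (tail (map_graph m) a) =
       Suc (graph_dist (map_graph m) (root_vertex m) (head (map_graph m) a))"

definition tail_dist :: "('v, 'e) rooted_map \<Rightarrow> 'e \<Rightarrow> nat" where
  "tail_dist m a = graph_dist (map_graph m) (root_vertex m) (tail (map_graph m) a)"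

text \<open>Both directions of the bijection meet here. The root arc leaves the root vertex, so its
  reverse is a down arc at distance 1; it becomes corner 0, and its tail becomes the root of the
  tree. The root label is stated separately because \<open>plane_forest\<close> describes only the
  children.\<close>

definition codes :: "('v, 'e) rooted_map \<Rightarrow> (nat \<Rightarrow> 'e) \<Rightarrow> nat \<Rightarrow> (nat \<Rightarrow> nat) \<Rightarrow> nat plane_tree \<Rightarrow> bool" where
  "codes m e N A t \<longleftrightarrow> e 0 = map_rev m (root_arc m) \<and>
     encodes (map_rot m) (map_rev m) (down_arc m) (tail_dist m) N e A \<and>
     root_label t = 1 \<and> plane_forest A (\<lambda>i. tail_dist m (e i)) 0 N (children t)"

context quadrangulation
begin

lemma Q_dn: "Q.dn = down_arc m"
  by (rule ext) (auto simp: Q.dn_def down_arc_def)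

lemma card_down: "card {a. down_arc m a} = 2 * card (map_faces m)"
proof -
  let ?P = "{a. Q.dn a}"
  have "D = ?P \<union> rv ` ?P"
  proof
    show "D \<subseteq> ?P \<union> rv ` ?P"
    proof
      fix a assume a: "a \<in> D"
      show "a \<in> ?P \<union> rv ` ?P"
      proof (cases "Q.dn a")
        case False
        then have "Q.dn (rv a)" using Q.dn_rev a by blast
        then show ?thesis by (intro UnI2 image_eqI[of _ _ "rv a"]) simp_all
      qed simp
    qed
  qed (auto simp: Q.dn_D)
  moreover have "?P \<inter> rv ` ?P = {}" using Q.dn_rev Q.dn_D by blast
  moreover have "card (rv ` ?P) = card ?P" by (intro card_image inj_on_inverseI[where g = rv]) simp
  ultimately have "card D = 2 * card ?P"
    using Q.finite_dn card_Un_disjoint[of ?P "rv ` ?P"] by simp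
  then show ?thesis using card_D by (simp add: Q_dn)
qed

lemma src_down: "src ` {a. down_arc m a} = V - {root_vertex m}"
proof
  show "src ` {a. down_arc m a} \<subseteq> V - {root_vertex m}"
    using dist_root by (auto simp: down_arc_def)
  show "V - {root_vertex m} \<subseteq> src ` {a. down_arc m a}"
  proof
    fix v assume "v \<in> V - {root_vertex m}"
    then obtain a where "a \<in> D" "src a = v" "d v = Suc (d (dst a))" using dist_down[of v] by auto
    then show "v \<in> src ` {a. down_arc m a}" by (auto simp: down_arc_def)
  qed
qed

lemma card_non_root: "card (V - {root_vertex m}) = Suc (card (map_faces m))"
  using card_V finite_V root_V by simp

lemma codes_exists: "\<exists>t. codes m Q.contour (2 * card (map_faces m)) Q.mate t"
proof -
  let ?N = "card {a. Q.dn a}"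
  have N: "?N = 2 * card (map_faces m)" using card_down by (simp add: Q_dn)
  have v: "src (Q.contour (Suc i)) = src (Q.contour (Q.mate i))" if "i < ?N" for i
    using Q.opp_in_orbit_succ[OF Q.dn_contour, of i] Q.mate(2)[OF that]
      orbit_rot[OF Q.dn_D[OF Q.dn_succ[OF Q.dn_contour]], of i] by (simp add: Q.contour_Suc)
  have img: "(\<lambda>i. src (Q.contour i)) ` {..<?N} = V - {root_vertex m}"
    using Q.contour_bij(1) src_down unfolding bij_betw_def Q_dn[symmetric] by (metis image_image)
  have cimg: "card ((\<lambda>i. src (Q.contour i)) ` {..<?N}) = Suc (card (map_faces m))"
    unfolding img by (rule card_non_root)
  have "\<exists>ts. plane_forest Q.mate (\<lambda>i. tail_dist m (Q.contour i)) 0 ?N ts"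
  proof (rule plane_forest_of_noncrossing)
    fix i assume i: "i < ?N"
    have "src (Q.contour (Suc (Q.mate i))) = src (Q.contour i)"
      using v[OF Q.mate(1)[OF i]] Q.mate(3)[OF i] by simp
    then show "0 \<le> Q.mate i \<and> Q.mate i < ?N \<and> Q.mate (Q.mate i) = i \<and> Q.mate i \<noteq> i \<and>
        tail_dist m (Q.contour (Suc (Q.mate i))) = tail_dist m (Q.contour i)"
      using Q.mate(1,3,4)[OF i] by (simp add: tail_dist_def)
  next
    fix i j assume cr: "i < j" "j < Q.mate i" "Q.mate i < Q.mate j" "Q.mate j < ?N"
    show False
    proof (rule matching_noncrossing[where v = "\<lambda>i. src (Q.contour i)" and A = Q.mate])
      \<comment> \<open>The strict inequality is Euler's formula: one more vertex than
        chords.\<close>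
      show "?N div 2 < card ((\<lambda>i. src (Q.contour i)) ` {..<?N})"
        unfolding cimg using N by simp
    qed (use cr v Q.mate Q.contour_bij(2) in auto)
  qed simp
  then obtain ts where "plane_forest Q.mate (\<lambda>i. tail_dist m (Q.contour i)) 0 ?N ts" ..
  then have "codes m Q.contour ?N Q.mate (Node 1 ts)"
    using Q.encodes_contour unfolding codes_def Q_dn tail_dist_def [abs_def]
    by (simp add: Q.contour_def)
  then show ?thesis unfolding N by blast
qed

lemma run_src: "run rot (down_arc m) c x \<Longrightarrow> x \<in> D \<and> src x = src c"
  by (induction rule: run.induct) (auto simp: down_arc_def)

lemma codesD:
  assumes "codes m e N A t"
  shows "N = 2 * card (map_faces m)" "num_edges t = card (map_faces m)"
    "i < N \<Longrightarrow> src (e (Suc i)) = src (e (A i))"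
    "bij_betw e {..<N} {a. down_arc m a}" "e N = e 0" "slow N (\<lambda>i. tail_dist m (e i))"
    "i \<le> N \<Longrightarrow> down_arc m (e i)"
    "plane_forest A (\<lambda>i. tail_dist m (e i)) 0 N (children t)"
proof -
  let ?L = "\<lambda>i. tail_dist m (e i)"
  have enc: "encodes rot rv (down_arc m) (tail_dist m) N e A"
    and f: "plane_forest A ?L 0 N (children t)" using assms by (auto simp: codes_def)
  show "plane_forest A ?L 0 N (children t)" by (rule f)
  show b: "bij_betw e {..<N} {a. down_arc m a}" and N0: "e N = e 0" and "slow N ?L"
    using enc by (auto simp: encodes_def Let_def)
  show N: "N = 2 * card (map_faces m)" using bij_betw_same_card[OF b] card_down by simp
  have "N = 2 * num_edges t" using plane_forest_length[OF f] by (cases t) simp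
  then show "num_edges t = card (map_faces m)" using N by simp
  have "0 < N" using N finite_faces infinite_face by (auto simp: card_gt_0_iff)
  then have dn: "down_arc m (e i)" if "i \<le> N" for i
    using b N0 that unfolding bij_betw_def by (cases "i = N") (auto dest: le_neq_implies_less)
  then show "i \<le> N \<Longrightarrow> down_arc m (e i)" .
  show "src (e (Suc i)) = src (e (A i))" if i: "i < N"
  proof -
    have dn': "e i \<in> D" "e (Suc i) \<in> D" using dn[of i] dn[of "Suc i"] i by (auto simp: down_arc_def)
    consider "?L (Suc i) < ?L i" | "?L (Suc i) = ?L i" | "?L i < ?L (Suc i)" by linarith
    then show ?thesis
    proof cases
      case 1
      then have "rot (rv (e i)) = e (A i)" "run rot (down_arc m) (e (Suc i)) (rv (e i))"
        using enc i by (auto simp: encodes_def Let_def)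
      then show ?thesis using run_src[of "e (Suc i)" "rv (e i)"] src_rot[of "rv (e i)"] dn' by simp
    next
      case 2
      then have "rot (e (Suc i)) = e (A i)" using enc i by (auto simp: encodes_def Let_def)
      then show ?thesis using src_rot[OF dn'(2)] by simp
    next
      case 3
      then have "rot (e (Suc i)) = e (A i)" using enc i by (auto simp: encodes_def Let_def)
      then show ?thesis using src_rot[OF dn'(2)] by simp
    qed
  qed
qed

text \<open>The corners \<open>I\<close> where tree vertices are first visited reach every vertex
  except the root vertex, and they are just as many as these vertices; so a surjection is already a
  bijection. The root vertex is absent from the tree, whence \<open>0 < k\<close>.\<close>

lemma codes_profile:
  assumes c: "codes m e N A t" and k: "0 < k"
  shows "map_profile m k = label_count t k"
proof -
  note f = codesD(8)[OF c]
  let ?L = "\<lambda>i. tail_dist m (e i)"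
  define J where "J = {i \<in> {0..<N}. i < A i}"
  define I where "I = insert 0 (Suc ` J)"
  have finJ: "finite J" by (simp add: J_def)
  have cJ: "card J = card (map_faces m)"
    using plane_forest_card_ups[OF f] codesD(1)[OF c] by (simp add: J_def)
  have cI: "card I = Suc (card (map_faces m))"
    using finJ cJ by (simp add: I_def card_image)
  have "(\<lambda>i. src (e i)) ` I = V - {root_vertex m}"
  proof
    have "down_arc m (e i)" if "i \<in> I" for i
      using that by (intro codesD(7)[OF c]) (auto simp: I_def J_def)
    then show "(\<lambda>i. src (e i)) ` I \<subseteq> V - {root_vertex m}" using src_down by blast
    show "V - {root_vertex m} \<subseteq> (\<lambda>i. src (e i)) ` I"
    proof
      fix v assume "v \<in> V - {root_vertex m}"
      then have "v \<in> src ` e ` {..<N}"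
        using src_down codesD(4)[OF c] unfolding bij_betw_def by simp
      then obtain i where i: "i < N" "v = src (e i)" by blast
      have "src (e i) = src (e 0) \<or> (\<exists>j\<in>{0..<N}. j < A j \<and> src (e i) = src (e (Suc j)))"
        by (rule plane_forest_corner[OF f, where v = "\<lambda>i. src (e i)"]) (use i codesD(3)[OF c] in auto)
      then show "v \<in> (\<lambda>i. src (e i)) ` I" using i(2) by (auto simp: I_def J_def)
    qed
  qed
  moreover have "finite I" using finJ by (simp add: I_def)
  ultimately have bij: "bij_betw (\<lambda>i. src (e i)) I (V - {root_vertex m})"
    using cI card_non_root by (simp add: bij_betw_def eq_card_imp_inj_on)
  have "{v \<in> V. d v = k} = (\<lambda>i. src (e i)) ` {i \<in> I. ?L i = k}"
    using bij k dist_root unfolding bij_betw_def tail_dist_def by auto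
  then have "map_profile m k = card ((\<lambda>i. src (e i)) ` {i \<in> I. ?L i = k})"
    by (simp add: map_profile_def)
  also have "\<dots> = card {i \<in> I. ?L i = k}"
    using bij by (intro card_image) (auto simp: bij_betw_def inj_on_def)
  also have "{i \<in> I. ?L i = k} = (if ?L 0 = k then {0} else {}) \<union> Suc ` {i \<in> J. ?L (Suc i) = k}"
    by (auto simp: I_def)
  also have "card \<dots> = (if ?L 0 = k then 1 else 0) + card {i \<in> J. ?L (Suc i) = k}"
    using finJ by (subst card_Un_disjoint) (auto simp: card_image)
  also have "card {i \<in> J. ?L (Suc i) = k} = count_list (concat (map labels (children t))) k"
    using plane_forest_count[OF f, of k] by (simp add: J_def conj_assoc)
  also have "?L 0 = 1"
    using c Q.lab_rev_root by (simp add: codes_def tail_dist_def)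
  finally show ?thesis
    using c by (cases t) (auto simp: label_count_def codes_def)
qed

lemma codes_labels:
  assumes c: "codes m e N A t"
  shows "d ` V = insert 0 (set (labels t))" "0 \<notin> set (labels t)"
proof -
  note f = codesD(8)[OF c]
  show z: "0 \<notin> set (labels t)"
  proof
    assume "0 \<in> set (labels t)"
    then have "0 \<in> set (concat (map labels (children t)))"
      using c by (cases t) (auto simp: codes_def)
    then have "0 < count_list (concat (map labels (children t))) 0"
      by (metis count_list_0_iff gr0I)
    then have "{i \<in> {0..<N}. i < A i \<and> tail_dist m (e (Suc i)) = 0} \<noteq> {}"
      using plane_forest_count[OF f, of 0] by (metis card.empty less_numeral_extra(3))
    then obtain i where "i < N" "tail_dist m (e (Suc i)) = 0" by auto
    then show False using codesD(7)[OF c, of "Suc i"] by (simp add: down_arc_def tail_dist_def)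
  qed
  have "k \<in> d ` V \<longleftrightarrow> k \<in> set (labels t)" if k: "0 < k" for k
  proof -
    have "k \<in> d ` V \<longleftrightarrow> 0 < map_profile m k"
      using finite_V by (auto simp: map_profile_def card_gt_0_iff)
    also have "\<dots> \<longleftrightarrow> k \<in> set (labels t)"
      unfolding codes_profile[OF c k] label_count_def by (metis count_list_0_iff gr0I less_numeral_extra(3))
    finally show ?thesis .
  qed
  moreover have "0 \<in> d ` V" using dist_root root_V by (metis imageI)
  ultimately show "d ` V = insert 0 (set (labels t))"
    using z by (auto simp: set_eq_iff) (metis gr0I)+
qed

lemma codes_radius:
  assumes c: "codes m e N A t"
  shows "map_radius m = max_label t"
proof -
  have "set (labels t) \<noteq> {}" by (cases t) auto
  then show ?thesis
    unfolding map_radius_def max_label_def codes_labels(1)[OF c] by simp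
qed

lemma codes_well_labelled:
  assumes c: "codes m e N A t"
  shows "well_labelled t"
proof -
  let ?L = "\<lambda>i. tail_dist m (e i)"
  have L0: "?L 0 = 1" using c Q.lab_rev_root by (simp add: codes_def tail_dist_def)
  have "\<forall>i. 0 \<le> i \<and> i < N \<longrightarrow> \<bar>int (?L i) - int (?L (Suc i))\<bar> \<le> 1"
    using codesD(6)[OF c] by (auto simp: slow_def abs_le_iff)
  then have "\<forall>t\<in>set (children t). \<bar>int 1 - int (root_label t)\<bar> \<le> 1 \<and> adjacent_labels_close t"
    using plane_forest_close[OF codesD(8)[OF c]] L0 by simp
  moreover have "root_label t = 1" using c by (simp add: codes_def)
  moreover have "\<forall>x\<in>set (labels t). 0 < x" using codes_labels(2)[OF c] by (metis gr0I)
  ultimately show ?thesis unfolding well_labelled_def by (cases t) simp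
qed

end

lemma encodes_step:
  assumes "encodes rot rv P lab N e A" "i < N"
  shows "A i < N"
    "lab (e (Suc i)) < lab (e i) \<Longrightarrow> rot (rv (e i)) = e (A i)"
    "lab (e (Suc i)) < lab (e i) \<Longrightarrow> run rot P (e (Suc i)) (rv (e i))"
    "lab (e (Suc i)) = lab (e i) \<Longrightarrow> rot (rv (e i)) = rv (e (Suc i))"
    "lab (e i) \<le> lab (e (Suc i)) \<Longrightarrow> rot (e (Suc i)) = e (A i)"
    "lab (e i) < lab (e (Suc i)) \<Longrightarrow> rot (rv (e i)) = rv (e (next_lower (\<lambda>i. lab (e i)) (Suc i)))"
    "lab (e i) < lab (e (Suc i)) \<Longrightarrow> rot (e (next_lower (\<lambda>i. lab (e i)) (Suc i))) = rv (e (Suc i))"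
  using assms unfolding encodes_def Let_def le_less by metis+

context rooted_planar_map
begin

lemma src_image: "src ` D = V"
proof
  show "V \<subseteq> src ` D"
  proof
    fix v assume v: "v \<in> V"
    show "v \<in> src ` D"
    proof (rule connected_verts[OF _ root_V v])
      show "root_vertex m \<in> src ` D" using root_arc_D by (simp add: root_vertex_def)
      fix a assume "a \<in> D"
      then show "dst a \<in> src ` D" by (intro image_eqI[of _ _ "rv a"]) simp_all
    qed
  qed
qed auto

text \<open>Every vertex carries an arc and is an orbit of \<open>rot\<close>, and the infinite face
  is the \<open>phi\<close> orbit of the root arc. The bijection of the arcs therefore dictates the
  rest of the isomorphism.\<close>

lemma iso_of_arcs:
  assumes m': "rooted_planar_map m'"
    and g: "bij_betw g D (map_arcs m')"
    and rev: "\<And>a. a \<in> D \<Longrightarrow> map_rev m' (g a) = g (rv a)"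
    and rot: "\<And>a. a \<in> D \<Longrightarrow> map_rot m' (g a) = g (rot a)"
    and root: "g (root_arc m) = root_arc m'"
  shows "\<exists>f. rooted_map_iso m m' f g"
proof -
  interpret M: rooted_planar_map m' by (rule m')
  have gD: "g a \<in> M.D \<longleftrightarrow> a \<in> D" if "a \<in> D" for a using g that by (auto simp: bij_betw_def)
  have orb: "orbit M.rot (g a) = g ` orbit rot a" if a: "a \<in> D" for a
    using orbit_inverse[of a rot M.rot g] permutation_self_in_orbit[OF permutation_rot] rot
      permutes_orbit_subset[OF rot_permutes a] by blast
  have src_eq: "M.src (g a) = M.src (g b) \<longleftrightarrow> src a = src b" if a: "a \<in> D" "b \<in> D" for a b
  proof -
    have "M.src (g a) = M.src (g b) \<longleftrightarrow> g b \<in> orbit M.rot (g a)"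
      using M.orbit_rot[of "g a"] gD a by auto
    also have "\<dots> \<longleftrightarrow> g b \<in> g ` orbit rot a" using orb[OF a(1)] by simp
    also have "\<dots> \<longleftrightarrow> b \<in> orbit rot a"
      using g a permutes_orbit_subset[OF rot_permutes a(1)] unfolding bij_betw_def
      by (meson inj_on_image_mem_iff)
    also have "\<dots> \<longleftrightarrow> src a = src b" unfolding orbit_rot[OF a(1)] using a(2) by (simp add: eq_commute)
    finally show ?thesis .
  qed
  define f where "f v = M.src (g (SOME a. a \<in> D \<and> src a = v))" for v
  have f: "f (src a) = M.src (g a)" if a: "a \<in> D" for a
  proof -
    have "(SOME b. b \<in> D \<and> src b = src a) \<in> D \<and> src (SOME b. b \<in> D \<and> src b = src a) = src a"
      by (rule someI[of _ a]) (use a in simp)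
    then show ?thesis unfolding f_def using src_eq a by blast
  qed
  have "bij_betw f V (map_verts m')"
  proof (rule bij_betwI')
    fix u v assume "u \<in> V" "v \<in> V"
    then obtain a b where "a \<in> D" "b \<in> D" "u = src a" "v = src b" using src_image by blast
    then show "f u = f v \<longleftrightarrow> u = v" using f src_eq by simp
  next
    fix u assume "u \<in> V"
    then obtain a where "a \<in> D" "u = src a" using src_image by blast
    then show "f u \<in> M.V" using f gD by simp
  next
    fix w assume "w \<in> M.V"
    then obtain b where b: "b \<in> M.D" "w = M.src b" using M.src_image by blast
    then obtain a where "a \<in> D" "b = g a" using g unfolding bij_betw_def by blast
    then show "\<exists>v\<in>V. w = f v" using b f by (intro bexI[of _ "src a"]) simp_all
  qed
  moreover have "M.dst (g a) = f (dst a)" if "a \<in> D" for a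
    using f[of "rv a"] rev[OF that] M.src_rv[of "g a"] gD that by simp
  moreover have "g ` infinite_face m = infinite_face m'"
  proof -
    have "M.phi (g a) = g (phi a)" if "a \<in> D" for a
      using that rev rot by (simp add: M.phi_def phi_def)
    then have "g ` orbit phi (root_arc m) = orbit M.phi (g (root_arc m))"
      using permutes_orbit_subset[OF phi_permutes root_arc_D] by (intro orbit_inverse self_face) blast
    then show ?thesis using infinite_face_eq M.infinite_face_eq root by simp
  qed
  ultimately have "rooted_map_iso m m' f g"
    unfolding rooted_map_iso_def using g f rev rot root by simp
  then show ?thesis by (intro exI[of _ f])
qed

end

lemma (in quadrangulation) codes_dart:
  assumes c: "codes m e N A t" and a: "a \<in> D"
  shows "\<exists>i<N. a = e i \<or> a = rv (e i)"
proof -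
  have "down_arc m a \<or> down_arc m (rv a)" using Q.dn_rev[OF a] unfolding Q_dn by blast
  then have "a \<in> e ` {..<N} \<or> rv a \<in> e ` {..<N}"
    using codesD(4)[OF c] unfolding bij_betw_def by auto
  then show ?thesis by (metis imageE lessThan_iff rv_rv)
qed

lemma (in quadrangulation) codes_L:
  assumes c: "codes m e N A t"
  shows "tail_dist m (e 0) = 1" "tail_dist m (e N) = 1" "i \<le> N \<Longrightarrow> 0 < tail_dist m (e i)"
    and "\<And>j. j < N \<Longrightarrow> tail_dist m (e (Suc j)) < tail_dist m (e j) \<Longrightarrow>
       \<exists>i<j. tail_dist m (e i) < tail_dist m (e (Suc i)) \<and>
         next_lower (\<lambda>i. tail_dist m (e i)) (Suc i) = Suc j"
proof -
  show L0: "tail_dist m (e 0) = 1" using c Q.lab_rev_root by (simp add: codes_def tail_dist_def)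
  then show "tail_dist m (e N) = 1" using codesD(5)[OF c] by simp
  show pos: "0 < tail_dist m (e i)" if "i \<le> N" for i
    using codesD(7)[OF c that] by (simp add: down_arc_def tail_dist_def)
  fix j assume j: "j < N" "tail_dist m (e (Suc j)) < tail_dist m (e j)"
  let ?L = "\<lambda>i. tail_dist m (e i)"
  have s: "slow (Suc j) ?L" using slow_mono[OF codesD(6)[OF c]] j by simp
  have "?L 0 \<le> ?L (Suc j)" using L0 pos[of "Suc j"] j by simp
  from prev_le_down[OF s j(2) _ this]
  show "\<exists>i<j. ?L i < ?L (Suc i) \<and> next_lower ?L (Suc i) = Suc j" by auto
qed

text \<open>The tree determines \<open>A\<close> and all corner labels, and the clauses of
  \<open>encodes\<close> then prescribe \<open>rot\<close> on every arc. Matching equal corner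
  numbers is therefore compatible with both rotations.\<close>

lemma codes_same_tree_iso:
  assumes q: "quadrangulation m" "quadrangulation m'"
    and c: "codes m e N A t" and c': "codes m' e' N' A' t"
  shows "\<exists>f g. rooted_map_iso m m' f g"
proof -
  interpret quadrangulation m by (rule q)
  interpret M: quadrangulation m' by (rule q)
  let ?L = "\<lambda>i. tail_dist m (e i)" and ?L' = "\<lambda>i. tail_dist m' (e' i)"
  have "?L 0 = ?L' 0" using codes_L(1)[OF c] M.codes_L(1)[OF c'] by simp
  from plane_forest_determines[OF codesD(8)[OF c] M.codesD(8)[OF c'] this]
  have N: "N' = N" and A: "\<And>i. i < N \<Longrightarrow> A' i = A i" and L: "\<And>i. i \<le> N \<Longrightarrow> ?L i = ?L' i" by auto
  note c' = c'[unfolded N]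
  have enc: "encodes rot rv (down_arc m) (tail_dist m) N e A"
    and enc': "encodes M.rot M.rv (down_arc m') (tail_dist m') N e' A'"
    using c c' by (simp_all add: codes_def)
  have inj: "inj_on e {..<N}" using codesD(4)[OF c] by (simp add: bij_betw_def)
  define g where "g a = (if down_arc m a then e' (the_inv_into {..<N} e a)
      else M.rv (e' (the_inv_into {..<N} e (rv a))))" for a
  have down: "down_arc m (e i)" "e i \<in> D" "\<not> down_arc m (rv (e i))" if "i \<le> N" for i
    using codesD(7)[OF c that] Q.dn_rev[of "e i"] unfolding Q_dn by (auto simp: down_arc_def)
  have down': "e' i \<in> M.D" if "i \<le> N" for i
    using M.codesD(7)[OF c' that] by (auto simp: down_arc_def)
  have g: "g (e i) = e' i" "g (rv (e i)) = M.rv (e' i)" if "i \<le> N" for i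
  proof -
    have *: "g (e i) = e' i" "g (rv (e i)) = M.rv (e' i)" if "i < N" for i
      using down[of i] that the_inv_into_f_f[OF inj] by (simp_all add: g_def)
    have "0 < N" using codesD(1)[OF c] finite_faces infinite_face by (auto simp: card_gt_0_iff)
    then show "g (e i) = e' i" "g (rv (e i)) = M.rv (e' i)"
      using * that codesD(5)[OF c] M.codesD(5)[OF c'] by (cases "i = N"; simp)+
  qed
  have img: "g ` D = M.D"
  proof
    show "g ` D \<subseteq> M.D"
    proof
      fix b assume "b \<in> g ` D"
      then obtain a where a: "a \<in> D" "b = g a" by blast
      from codes_dart[OF c a(1)] obtain i where "i < N" "a = e i \<or> a = rv (e i)" by blast
      then show "b \<in> M.D" using a(2) g[of i] down'[of i] by auto
    qed
    show "M.D \<subseteq> g ` D"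
    proof
      fix b assume "b \<in> M.D"
      from M.codes_dart[OF c' this] obtain i where i: "i < N" "b = e' i \<or> b = M.rv (e' i)" by blast
      then have "b = g (e i) \<or> b = g (rv (e i))" using g[of i] by simp
      then show "b \<in> g ` D" using down(2)[of i] i(1) by auto
    qed
  qed
  have "card D = card M.D"
    using card_D M.card_D codesD(1)[OF c] M.codesD(1)[OF c'] by simp
  then have bij: "bij_betw g D M.D"
    using img finite_D by (simp add: bij_betw_def eq_card_imp_inj_on)
  have rev: "M.rv (g a) = g (rv a)" if a: "a \<in> D" for a
  proof -
    from codes_dart[OF c a] obtain i where "i < N" "a = e i \<or> a = rv (e i)" by blast
    then show ?thesis using g[of i] by auto
  qed
  have up_lt: "?L N < ?L (Suc i)" "Suc i < N" if "i < N" "?L i < ?L (Suc i)" for i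
  proof -
    show "?L N < ?L (Suc i)" using codes_L(2)[OF c] codes_L(3)[OF c, of i] that by simp
    then show "Suc i < N" using that(1) by (cases "Suc i = N") auto
  qed
  have nl: "next_lower ?L (Suc i) = next_lower ?L' (Suc i)" "next_lower ?L (Suc i) \<le> N"
    if "i < N" "?L i < ?L (Suc i)" for i
    using next_lower_cong[of N ?L ?L', OF L _ up_lt(1)[OF that]] up_lt(2)[OF that]
      next_lower(3)[of "Suc i" N ?L, OF up_lt(2)[OF that] up_lt(1)[OF that]] by auto
  have Ai: "A i \<le> N" if "i < N" for i using encodes_step(1)[OF enc that] by simp
  note st = encodes_step[OF enc] and st' = encodes_step[OF enc']
  have rot_rev: "M.rot (M.rv (e' i)) = g (rot (rv (e i)))" if i: "i < N" for i
  proof -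
    have LL: "?L i = ?L' i" "?L (Suc i) = ?L' (Suc i)" using L i by auto
    consider "?L (Suc i) < ?L i" | "?L (Suc i) = ?L i" | "?L i < ?L (Suc i)" by linarith
    then show ?thesis
    proof cases
      case 1
      then show ?thesis using st(2)[OF i] st'(2)[OF i] LL g(1)[OF Ai[OF i]] A[OF i] by simp
    next
      case 2
      then show ?thesis using st(4)[OF i] st'(4)[OF i] LL g(2)[of "Suc i"] i by simp
    next
      case 3
      then show ?thesis using st(6)[OF i] st'(6)[OF i] LL nl[OF i 3] g(2) by simp
    qed
  qed
  have rot_e: "M.rot (e' (Suc i)) = g (rot (e (Suc i)))" if i: "i < N" for i
  proof -
    have LL: "?L i = ?L' i" "?L (Suc i) = ?L' (Suc i)" using L i by auto
    show ?thesis
    proof (cases "?L (Suc i) < ?L i")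
      case False
      then show ?thesis using st(5)[OF i] st'(5)[OF i] LL g(1)[OF Ai[OF i]] A[OF i] by simp
    next
      case True
      \<comment> \<open>Where step \<open>i\<close> descends, its own clause says nothing on
        \<open>rot (e (Suc i))\<close>; the clause of the matched ascending step \<open>j\<close>
        does.\<close>
      from codes_L(4)[OF c i True] obtain j
        where j: "j < i" "?L j < ?L (Suc j)" "next_lower ?L (Suc j) = Suc i" by blast
      then have jN: "j < N" using i by simp
      have "?L' j < ?L' (Suc j)" using L[of j] L[of "Suc j"] j jN by simp
      then have "M.rot (e' (Suc i)) = M.rv (e' (Suc j))"
        using st'(7)[OF jN] nl(1)[OF jN j(2)] j(3) by simp
      moreover have "rot (e (Suc i)) = rv (e (Suc j))" using st(7)[OF jN j(2)] j(3) by simp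
      ultimately show ?thesis using g(2)[of "Suc j"] jN by simp
    qed
  qed
  have rot: "M.rot (g a) = g (rot a)" if a: "a \<in> D" for a
  proof -
    from codes_dart[OF c a] obtain i where i: "i < N" "a = e i \<or> a = rv (e i)" by blast
    show ?thesis
    proof (cases "a = rv (e i)")
      case True then show ?thesis using rot_rev[OF i(1)] g(2)[of i] i(1) by simp
    next
      case False
      then have ai: "a = e i" using i by simp
      show ?thesis
      proof (cases i)
        case 0
        \<comment> \<open>Corner 0 has no preceding step; it is treated as corner
          \<open>N\<close>.\<close>
        then have "a = e (Suc (N - 1))" "e' i = e' (Suc (N - 1))"
          using ai i(1) codesD(5)[OF c] M.codesD(5)[OF c'] by simp_all
        then show ?thesis using rot_e[of "N - 1"] g(1)[of i] ai i(1) by simp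
      next
        case (Suc k) then show ?thesis using rot_e[of k] g(1)[of i] ai i(1) by simp
      qed
    qed
  qed
  have "root_arc m = rv (e 0)" "root_arc m' = M.rv (e' 0)" using c c' by (simp_all add: codes_def)
  then have "g (root_arc m) = root_arc m'" using g(2)[of 0] by simp
  from iso_of_arcs[OF M.rooted_planar_map_axioms bij rev rot this] show ?thesis by blast
qed

text \<open>Distances, down arcs and runs are all transported by an isomorphism, so the trees coding
  a map depend only on its isomorphism class.\<close>

lemma codes_iso:
  assumes m: "rooted_planar_map m" and m': "rooted_planar_map m'" and iso: "rooted_map_iso m m' f g"
    and c: "codes m e N A t"
  shows "codes m' (g \<circ> e) N A t"
proof -
  interpret rooted_planar_map m by (rule m)
  interpret M: rooted_planar_map m' by (rule m')
  have bij: "bij_betw g D M.D"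
    and h: "\<And>a. a \<in> D \<Longrightarrow> M.src (g a) = f (src a)" "\<And>a. a \<in> D \<Longrightarrow> M.dst (g a) = f (dst a)"
      "\<And>a. a \<in> D \<Longrightarrow> M.rv (g a) = g (rv a)" "\<And>a. a \<in> D \<Longrightarrow> M.rot (g a) = g (rot a)"
    and root: "g (root_arc m) = root_arc m'"
    using iso by (auto simp: rooted_map_iso_def)
  have gD: "g a \<in> M.D" if "a \<in> D" for a using bij that by (auto simp: bij_betw_def)
  note dist = root_dist_iso[OF m iso]
  have td: "tail_dist m' (g a) = tail_dist m a" if "a \<in> D" for a
    using that dist by (simp add: tail_dist_def h)
  have down: "down_arc m' (g a) \<longleftrightarrow> down_arc m a" if "a \<in> D" for a
    using that dist gD by (simp add: down_arc_def h)
  have enc: "encodes rot rv (down_arc m) (tail_dist m) N e A" using c by (simp add: codes_def)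
  have be: "bij_betw e {..<N} {a. down_arc m a}" and eN: "e N = e 0"
    and slow: "slow N (\<lambda>i. tail_dist m (e i))"
    using enc by (auto simp: encodes_def Let_def)
  have e0: "e 0 \<in> D" using c root_arc_D by (simp add: codes_def)
  have eD: "e i \<in> D" if "i \<le> N" for i
  proof (cases "i = N")
    case False
    then have "e i \<in> {a. down_arc m a}" using be that unfolding bij_betw_def by auto
    then show ?thesis by (simp add: down_arc_def)
  qed (simp add: eN e0)
  have L: "tail_dist m' (g (e i)) = tail_dist m (e i)" if "i \<le> N" for i using td eD that by simp
  have "g ` {a. down_arc m a} = {a. down_arc m' a}"
  proof
    show "g ` {a. down_arc m a} \<subseteq> {a. down_arc m' a}" using down by (auto simp: down_arc_def)
    show "{a. down_arc m' a} \<subseteq> g ` {a. down_arc m a}"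
    proof
      fix b assume b: "b \<in> {a. down_arc m' a}"
      then have "b \<in> g ` D" using bij by (simp add: bij_betw_def down_arc_def)
      then show "b \<in> g ` {a. down_arc m a}" using down b by auto
    qed
  qed
  then have "bij_betw g {a. down_arc m a} {a. down_arc m' a}"
    using bij_betw_subset[OF bij, of "{a. down_arc m a}"] by (auto simp: down_arc_def)
  then have "bij_betw (g \<circ> e) {..<N} {a. down_arc m' a}" by (rule bij_betw_trans[OF be])
  have run: "x \<in> D \<and> run M.rot (down_arc m') (g a) (g x)" if "run rot (down_arc m) a x" "a \<in> D" for a x
    using that
  proof (induction rule: run.induct)
    case (base a)
    then show ?case using run.base[of "down_arc m'" "g a" M.rot] down by simp
  next
    case (step a x)
    then have x: "x \<in> D" "run M.rot (down_arc m') (g a) (g x)" by simp_all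
    have "\<not> down_arc m' (M.rot (g x))" using step.hyps(2) down[of "rot x"] h(4)[of x] x(1) by simp
    from run.step[OF x(2) this] show ?case using x(1) h(4) by simp
  qed
  have nl: "next_lower (\<lambda>i. tail_dist m' (g (e i))) (Suc i) = next_lower (\<lambda>i. tail_dist m (e i)) (Suc i)"
      "next_lower (\<lambda>i. tail_dist m (e i)) (Suc i) \<le> N"
    if i: "i < N" and up: "tail_dist m (e i) < tail_dist m (e (Suc i))" for i
  proof -
    have "tail_dist m (e 0) \<le> 1"
      using dist_head[of "root_arc m"] root_arc_D c dist_root
      by (simp add: codes_def tail_dist_def root_vertex_def)
    moreover have "0 < tail_dist m (e i)"
    proof -
      have "e i \<in> {a. down_arc m a}" using be i unfolding bij_betw_def by auto
      then show ?thesis by (simp add: down_arc_def tail_dist_def)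
    qed
    ultimately have lt: "tail_dist m (e N) < tail_dist m (e (Suc i))" using up eN by simp
    then have sN: "Suc i < N" using i by (cases "Suc i = N") auto
    show "next_lower (\<lambda>i. tail_dist m (e i)) (Suc i) \<le> N"
      using next_lower(3)[of "Suc i" N "\<lambda>i. tail_dist m (e i)", OF sN lt] .
    show "next_lower (\<lambda>i. tail_dist m' (g (e i))) (Suc i) = next_lower (\<lambda>i. tail_dist m (e i)) (Suc i)"
      using next_lower_cong[of N "\<lambda>i. tail_dist m (e i)" "\<lambda>i. tail_dist m' (g (e i))", OF L[symmetric] sN lt]
      by simp
  qed
  note st = encodes_step[OF enc]
  have "encodes M.rot M.rv (down_arc m') (tail_dist m') N (g \<circ> e) A"
    unfolding encodes_def Let_def
  proof (intro conjI allI impI)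
    show "bij_betw (g \<circ> e) {..<N} {a. down_arc m' a}" by fact
    show "(g \<circ> e) N = (g \<circ> e) 0" using eN by simp
    show "slow N (\<lambda>i. tail_dist m' ((g \<circ> e) i))" using slow L by (simp add: slow_def)
    fix i assume i: "i < N"
    note D = eD[of i] eD[of "Suc i"] and LL = L[of i] L[of "Suc i"]
    show "A i < N" by (rule st(1)[OF i])
    show "M.rot (M.rv ((g \<circ> e) i)) = (g \<circ> e) (A i)"
      "run M.rot (down_arc m') ((g \<circ> e) (Suc i)) (M.rv ((g \<circ> e) i))"
      if "tail_dist m' ((g \<circ> e) (Suc i)) < tail_dist m' ((g \<circ> e) i)"
      using st(2,3)[OF i] run[of "e (Suc i)" "rv (e i)"] that D LL i h by simp_all
    show "M.rot (M.rv ((g \<circ> e) i)) = M.rv ((g \<circ> e) (Suc i))" "M.rot ((g \<circ> e) (Suc i)) = (g \<circ> e) (A i)"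
      if "tail_dist m' ((g \<circ> e) (Suc i)) = tail_dist m' ((g \<circ> e) i)"
      using st(4,5)[OF i] that D LL i h by simp_all
    assume "tail_dist m' ((g \<circ> e) i) < tail_dist m' ((g \<circ> e) (Suc i))"
    then have up: "tail_dist m (e i) < tail_dist m (e (Suc i))" using LL i by simp
    note nl = nl[OF i up]
    show "M.rot (M.rv ((g \<circ> e) i)) =
        M.rv ((g \<circ> e) (next_lower (\<lambda>i. tail_dist m' ((g \<circ> e) i)) (Suc i)))"
      "M.rot ((g \<circ> e) (next_lower (\<lambda>i. tail_dist m' ((g \<circ> e) i)) (Suc i))) = M.rv ((g \<circ> e) (Suc i))"
      "M.rot ((g \<circ> e) (Suc i)) = (g \<circ> e) (A i)"
      using st(5,6,7)[OF i] up D eD[OF nl(2)] nl(1) i h by simp_all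
  qed
  moreover have "(g \<circ> e) 0 = M.rv (root_arc m')"
    using c root root_arc_D h(3)[of "root_arc m"] by (simp add: codes_def)
  moreover have "plane_forest A (\<lambda>i. tail_dist m' ((g \<circ> e) i)) 0 N (children t)"
    by (rule plane_forest_cong[of A "\<lambda>i. tail_dist m (e i)"]) (use c L in \<open>auto simp: codes_def\<close>)
  ultimately show ?thesis using c by (simp add: codes_def)
qed

text \<open>Corner 0 is prescribed by the root. Each later corner and each partner is forced by the
  preceding corner, because the pattern of the face can be recognized from its down arcs
  alone.\<close>

lemma codes_unique:
  assumes q: "quadrangulation m" and c: "codes m e N A t" and c': "codes m e' N' A' t'"
  shows "t = t'"
proof -
  interpret quadrangulation m by (rule q)
  let ?L = "\<lambda>i. tail_dist m (e i)" and ?L' = "\<lambda>i. tail_dist m (e' i)"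
  have N: "N' = N" using codesD(1)[OF c] codesD(1)[OF c'] by simp
  note c' = c'[unfolded N]
  have enc: "encodes rot rv (down_arc m) (tail_dist m) N e A"
    and enc': "encodes rot rv (down_arc m) (tail_dist m) N e' A'"
    using c c' by (simp_all add: codes_def)
  have up: "\<not> down_arc m (rv a)" if "down_arc m a" for a
    using that Q.dn_rev[of a] unfolding Q_dn by (auto simp: down_arc_def)
  \<comment> \<open>\<open>p\<close> and \<open>s\<close> are the second and third arcs of the face
    of \<open>e'' i\<close>; which of them is a down arc decides the clause.\<close>
  have kind: "down_arc m p \<and> run rot (down_arc m) (e'' (Suc i)) (rv (e'' i)) \<and> e'' (A'' i) = p \<or>
      \<not> down_arc m p \<and> down_arc m s \<and> e'' (Suc i) = rv p \<and> e'' (A'' i) = s \<or>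
      \<not> down_arc m p \<and> \<not> down_arc m s \<and> e'' (Suc i) = rv s \<and> e'' (A'' i) = rot (rv s)"
    if c: "codes m e'' N A'' t''" and i: "i < N"
      and p: "p = rot (rv (e'' i))" and s: "s = rot (rv p)" for e'' A'' t'' i p s
  proof -
    have enc: "encodes rot rv (down_arc m) (tail_dist m) N e'' A''" using c by (simp add: codes_def)
    note st = encodes_step[OF enc i]
    have dn: "down_arc m (e'' j)" if "j \<le> N" for j using codesD(7)[OF c that] .
    consider (down) "tail_dist m (e'' (Suc i)) < tail_dist m (e'' i)"
      | (level) "tail_dist m (e'' (Suc i)) = tail_dist m (e'' i)"
      | (up) "tail_dist m (e'' i) < tail_dist m (e'' (Suc i))" by linarith
    then show ?thesis
    proof cases
      case down
      then show ?thesis using st(1,2,3) dn[of "A'' i"] p by simp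
    next
      case level
      then have "p = rv (e'' (Suc i))" "s = e'' (A'' i)" using st(4,5) p s by simp_all
      then show ?thesis using dn[of "A'' i"] st(1) up[OF dn[of "Suc i"]] i by simp
    next
      case up
      let ?k = "next_lower (\<lambda>i. tail_dist m (e'' i)) (Suc i)"
      have ps: "p = rv (e'' ?k)" "s = rv (e'' (Suc i))" "rot (e'' (Suc i)) = e'' (A'' i)"
        using st(5,6,7) up p s by simp_all
      have lt: "tail_dist m (e'' N) < tail_dist m (e'' (Suc i))"
        using codes_L(2)[OF c] codes_L(3)[OF c, of i] up i by simp
      then have "Suc i < N" using i by (cases "Suc i = N") auto
      from next_lower(3)[of "Suc i" N "\<lambda>i. tail_dist m (e'' i)", OF this lt]
      have "down_arc m (e'' ?k)" by (rule dn)
      then show ?thesis using ps \<open>\<And>a. down_arc m a \<Longrightarrow> \<not> down_arc m (rv a)\<close> dn[of "Suc i"] i by simp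
    qed
  qed
  have step: "e (Suc i) = e' (Suc i) \<and> e (A i) = e' (A' i)" if i: "i < N" and eq: "e i = e' i" for i
  proof -
    define p where "p = rot (rv (e i))"
    define s where "s = rot (rv p)"
    have k: "down_arc m p \<and> run rot (down_arc m) (e (Suc i)) (rv (e i)) \<and> e (A i) = p \<or>
        \<not> down_arc m p \<and> down_arc m s \<and> e (Suc i) = rv p \<and> e (A i) = s \<or>
        \<not> down_arc m p \<and> \<not> down_arc m s \<and> e (Suc i) = rv s \<and> e (A i) = rot (rv s)"
      by (rule kind[OF c i p_def s_def])
    have k': "down_arc m p \<and> run rot (down_arc m) (e' (Suc i)) (rv (e i)) \<and> e' (A' i) = p \<or>
        \<not> down_arc m p \<and> down_arc m s \<and> e' (Suc i) = rv p \<and> e' (A' i) = s \<or>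
        \<not> down_arc m p \<and> \<not> down_arc m s \<and> e' (Suc i) = rv s \<and> e' (A' i) = rot (rv s)"
      using kind[OF c' i p_def[unfolded eq] s_def] by (simp only: eq)
    show ?thesis
    proof (cases "down_arc m p")
      case True
      then have "run rot (down_arc m) (e (Suc i)) (rv (e i))" "run rot (down_arc m) (e' (Suc i)) (rv (e i))"
        "e (A i) = p" "e' (A' i) = p" using k k' by simp_all
      then show ?thesis using run_unique[OF Q.inj_rot] by metis
    next
      case False
      then show ?thesis using k k' by (cases "down_arc m s") simp_all
    qed
  qed
  have e: "e i = e' i" if "i \<le> N" for i
    using that
  proof (induction i)
    case 0 then show ?case using c c' by (simp add: codes_def)
  next
    case (Suc i) then show ?case using step[of i] by simp
  qed
  have "A i = A' i" if i: "i < N" for i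
  proof -
    have lt: "A i < N" "A' i < N" using encodes_step(1) enc enc' i by blast+
    then have "e (A i) = e (A' i)" using step[OF i] e[of i] e[of "A' i"] i by simp
    then show ?thesis using codesD(4)[OF c] lt by (auto simp: bij_betw_def dest: inj_onD)
  qed
  then have "plane_forest A' ?L' 0 N (children t)"
    by (intro plane_forest_cong[OF codesD(8)[OF c]]) (simp_all add: e)
  from plane_forest_unique[OF this codesD(8)[OF c']]
  have "children t = children t'" .
  moreover have "root_label t = root_label t'" using c c' by (simp add: codes_def)
  ultimately show ?thesis by (cases t; cases t') simp
qed

section \<open>The quadrangulation of a well labelled tree\<close>

text \<open>
  The arcs of the quadrangulation of a tree are the numbers below \<open>2 * N\<close>: the even number \<open>e i\<close> is
  the down arc at corner \<open>i\<close>, the odd number \<open>u i\<close> its reverse, and corner \<open>N\<close> is corner 0.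
\<close>
locale labelled_contour =
  fixes A L :: "nat \<Rightarrow> nat" and N :: nat and ts :: "nat plane_tree list"
  assumes plane_forest: "plane_forest A L 0 N ts"
    and slow: "slow N L"
    and L0: "L 0 = 1"
    and L_pos: "i \<le> N \<Longrightarrow> 0 < L i"
    and N_pos: "0 < N"
begin

definition e :: "nat \<Rightarrow> nat" where "e i = 2 * (i mod N)"
definition u :: "nat \<Rightarrow> nat" where "u i = Suc (2 * (i mod N))"
definition rv :: "nat \<Rightarrow> nat" where
  "rv a = (if a < 2 * N then if even a then Suc a else a - 1 else a)"
text \<open>The corner of an arc is taken in \<open>1, \<dots>, N\<close>, so that it has a preceding contour step.\<close>
definition corner :: "nat \<Rightarrow> nat" where "corner a = (if a div 2 = 0 then N else a div 2)"
text \<open>These are the clauses of \<open>encodes\<close> solved for \<open>rot\<close>. One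
  clause describes the image of \<open>e (next_lower L (Suc i))\<close> in terms of the ascending
  step \<open>i\<close>; \<open>prev_le\<close> recovers \<open>i\<close> from that corner.\<close>

definition rot :: "nat \<Rightarrow> nat" where
  "rot a = (if 2 * N \<le> a then a
     else if even a then
       let c = corner a in if L c < L (c - 1) then u (Suc (prev_le L c)) else e (A (c - 1))
     else
       let i = a div 2 in if L (Suc i) < L i then e (A i)
         else if L (Suc i) = L i then u (Suc i) else u (next_lower L (Suc i)))"
definition phi :: "nat \<Rightarrow> nat" where "phi = rot \<circ> rv"

section \<open>Faces of the constructed map\<close>

lemma A: "i < N \<Longrightarrow> A i < N" "i < N \<Longrightarrow> A (A i) = i" "i < N \<Longrightarrow> A i \<noteq> i"
    "i < N \<Longrightarrow> L (Suc (A i)) = L i"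
  using plane_forest_matching[OF plane_forest, of i] by auto

lemma L_A: "i < N \<Longrightarrow> L (A i) = L (Suc i)"
  using A(4)[OF A(1), of i] A(2)[of i] by simp

lemma LN: "L N = 1" using plane_forest_end[OF plane_forest] L0 by simp

lemma slowD: "i < N \<Longrightarrow> L (Suc i) \<le> Suc (L i)" "i < N \<Longrightarrow> L i \<le> Suc (L (Suc i))"
  using slow by (auto simp: slow_def)

lemma eN: "e N = e 0" and uN: "u N = u 0" by (simp_all add: e_def u_def)

lemma e_lt: "e i < 2 * N" and u_lt: "u i < 2 * N"
proof -
  have "i mod N < N" using N_pos by simp
  then show "e i < 2 * N" "u i < 2 * N" unfolding e_def u_def by linarith+
qed

lemma e_even: "even (e i)" and u_odd: "odd (u i)" by (simp_all add: e_def u_def)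

lemma rv_e: "rv (e i) = u i" and rv_u: "rv (u i) = e i"
  using e_lt[of i] u_lt[of i] e_even[of i] u_odd[of i] by (simp_all add: rv_def) (simp_all add: e_def u_def)

lemma corner_e: "0 < c \<Longrightarrow> c \<le> N \<Longrightarrow> corner (e c) = c"
  by (cases "c = N") (auto simp: corner_def e_def)

lemma corner_u: "0 < c \<Longrightarrow> c \<le> N \<Longrightarrow> corner (u c) = c"
  by (cases "c = N") (auto simp: corner_def u_def)

lemma dart_cases:
  assumes "a < 2 * N"
  obtains i where "i < N" "a = e i" | i where "i < N" "a = u i"
proof (cases "even a")
  case True
  then have "a = e (a div 2)" "a div 2 < N" using assms by (auto simp: e_def)
  then show ?thesis using that(1) by blast
next
  case False
  then have "a div 2 < N" using assms by auto
  moreover from this False have "a = u (a div 2)" by (simp add: u_def odd_two_times_div_two_succ)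
  ultimately show ?thesis using that(2) by blast
qed

lemma corner_cases:
  assumes "a < 2 * N"
  obtains p where "p < N" "a = e (Suc p)" | p where "p < N" "a = u (Suc p)"
proof -
  have Suc: "\<exists>p<N. e i = e (Suc p) \<and> u i = u (Suc p)" if "i < N" for i
  proof (cases i)
    case 0
    then show ?thesis using eN uN N_pos by (intro exI[of _ "N - 1"]) simp
  next
    case (Suc p)
    then show ?thesis using that by (intro exI[of _ p]) simp
  qed
  from assms have "\<exists>p<N. a = e (Suc p) \<or> a = u (Suc p)"
    using Suc by (cases rule: dart_cases) metis+
  then show ?thesis using that by blast
qed

lemma rot_u:
  assumes "i < N"
  shows "L (Suc i) < L i \<Longrightarrow> rot (u i) = e (A i)"
    "L (Suc i) = L i \<Longrightarrow> rot (u i) = u (Suc i)"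
    "L i < L (Suc i) \<Longrightarrow> rot (u i) = u (next_lower L (Suc i))"
proof -
  have "u i div 2 = i" using assms by (simp add: u_def)
  then show "L (Suc i) < L i \<Longrightarrow> rot (u i) = e (A i)"
    "L (Suc i) = L i \<Longrightarrow> rot (u i) = u (Suc i)"
    "L i < L (Suc i) \<Longrightarrow> rot (u i) = u (next_lower L (Suc i))"
    using u_lt[of i] u_odd[of i] by (simp_all add: rot_def)
qed

lemma rot_e:
  assumes "p < N"
  shows "L (Suc p) < L p \<Longrightarrow> rot (e (Suc p)) = u (Suc (prev_le L (Suc p)))"
    "L p \<le> L (Suc p) \<Longrightarrow> rot (e (Suc p)) = e (A p)"
  using e_lt[of "Suc p"] e_even[of "Suc p"] corner_e[of "Suc p"] assms by (simp_all add: rot_def)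

lemma up:
  assumes "i < N" "L i < L (Suc i)"
  shows "L (Suc i) = Suc (L i)" "Suc i < N" "L N < L (Suc i)"
proof -
  show "L (Suc i) = Suc (L i)" using slowD(1)[OF assms(1)] assms(2) by simp
  show lt: "L N < L (Suc i)" using LN L_pos[of i] assms by simp
  then show "Suc i < N" using assms(1) by (cases "Suc i = N") auto
qed

lemma up_next:
  assumes "i < N" "L i < L (Suc i)"
  obtains p where "next_lower L (Suc i) = Suc p" "p < N" "i < p" "L (Suc p) < L p" "L (Suc p) = L i"
    "prev_le L (Suc p) = i"
proof -
  note u = up[OF assms]
  note n = next_lower[of "Suc i" N L, OF u(2,3)]
  note q = prev_le_next_lower[OF slow u(1,2,3)]
  obtain p where p: "next_lower L (Suc i) = Suc p" using n(1) by (cases "next_lower L (Suc i)") auto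
  then show ?thesis using that[of p] n(1,3) q by simp
qed

lemma down_prev:
  assumes "p < N" "L (Suc p) < L p"
  defines "i \<equiv> prev_le L (Suc p)"
  shows "i < p" "L i = L (Suc p)" "L (Suc i) = Suc (L i)" "next_lower L (Suc i) = Suc p"
proof -
  have "L 0 \<le> L (Suc p)" using L0 L_pos[of "Suc p"] assms(1) by simp
  from prev_le_down[OF slow_mono[OF slow] assms(2) _ this] assms(1)
  show "i < p" "L i = L (Suc p)" "L (Suc i) = Suc (L i)" "next_lower L (Suc i) = Suc p"
    by (simp_all add: i_def)
qed

lemma A_down: "i < N \<Longrightarrow> L i < L (Suc i) \<Longrightarrow> L (Suc (A i)) < L (A i)"
  using A(4) L_A by simp

lemma A_up: "i < N \<Longrightarrow> L (Suc i) < L i \<Longrightarrow> L (A i) < L (Suc (A i))"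
  using A(4) L_A by simp

lemma e_inj: "i < N \<Longrightarrow> j < N \<Longrightarrow> e i = e j \<longleftrightarrow> i = j" by (simp add: e_def)

lemma u_Suc_inj: "i < N \<Longrightarrow> j < N \<Longrightarrow> u (Suc i) = u (Suc j) \<longleftrightarrow> i = j"
  using corner_u[of "Suc i"] corner_u[of "Suc j"] by (metis Suc_leI nat.inject zero_less_Suc)

lemma e_neq_u: "e i \<noteq> u j" "u j \<noteq> e i" using e_even u_odd by metis+

lemma phi_e: "phi (e i) = rot (u i)" and phi_u: "phi (u i) = rot (e i)"
  by (simp_all add: phi_def rv_e rv_u)

text \<open>The four arcs have tails labelled \<open>l, l-1, l, l+1\<close>, where \<open>l\<close>
  is \<open>L i\<close>. Read from \<open>e (A i)\<close>, this is also the face of a descending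
  step.\<close>

lemma up_face:
  assumes i: "i < N" "L i < L (Suc i)"
  shows "phi (e i) = u (next_lower L (Suc i))" "phi (u (next_lower L (Suc i))) = u (Suc i)"
    "phi (u (Suc i)) = e (A i)" "phi (e (A i)) = e i"
proof -
  obtain p where p: "next_lower L (Suc i) = Suc p" "p < N" "L (Suc p) < L p" "prev_le L (Suc p) = i"
    using up_next[OF i] by blast
  show "phi (e i) = u (next_lower L (Suc i))" using rot_u(3)[OF i] by (simp add: phi_e)
  show "phi (u (next_lower L (Suc i))) = u (Suc i)" using rot_e(1)[OF p(2,3)] p by (simp add: phi_u)
  show "phi (u (Suc i)) = e (A i)" using rot_e(2)[OF i(1)] i by (simp add: phi_u)
  show "phi (e (A i)) = e i" using rot_u(1)[OF A(1)[OF i(1)] A_down[OF i]] A(2)[OF i(1)] by (simp add: phi_e)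
qed

lemma level_face:
  assumes i: "i < N" "L (Suc i) = L i"
  shows "phi (e i) = u (Suc i)" "phi (u (Suc i)) = e (A i)"
    "phi (e (A i)) = u (Suc (A i))" "phi (u (Suc (A i))) = e i"
proof -
  have Ai: "L (Suc (A i)) = L (A i)" using A(4)[OF i(1)] L_A[OF i(1)] i by simp
  show "phi (e i) = u (Suc i)" "phi (e (A i)) = u (Suc (A i))"
    using rot_u(2) A(1) i Ai by (simp_all add: phi_e)
  show "phi (u (Suc i)) = e (A i)" "phi (u (Suc (A i))) = e i"
    using rot_e(2)[OF i(1)] rot_e(2)[OF A(1)[OF i(1)]] A(2)[OF i(1)] i Ai by (simp_all add: phi_u)
qed

text \<open>The two traversals of an edge change the label oppositely, so the ascending and the
  level faces already contain all arcs.\<close>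

lemma phi_four_two:
  assumes "a < 2 * N"
  shows "phi (phi (phi (phi a))) = a" "phi (phi a) \<noteq> a" "phi a < 2 * N"
proof -
  have up: "phi (phi (phi (phi x))) = x \<and> phi (phi x) \<noteq> x \<and> phi x < 2 * N"
    if "i < N" "L i < L (Suc i)" "x \<in> {e i, u (next_lower L (Suc i)), u (Suc i), e (A i)}" for i x
    using that(3) by (elim insertE emptyE; simp add: up_face[OF that(1,2)] e_lt u_lt e_neq_u)
  have level: "phi (phi (phi (phi x))) = x \<and> phi (phi x) \<noteq> x \<and> phi x < 2 * N"
    if "i < N" "L (Suc i) = L i" "x = e i \<or> x = u (Suc i)" for i x
  proof -
    have "e (A i) \<noteq> e i" "u (Suc (A i)) \<noteq> u (Suc i)"
      using e_inj[of "A i" i] u_Suc_inj[of "A i" i] A(1,3)[OF that(1)] that(1) by simp_all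
    then show ?thesis using that(3) by (elim disjE; simp add: level_face[OF that(1,2)] e_lt u_lt)
  qed
  have "phi (phi (phi (phi a))) = a \<and> phi (phi a) \<noteq> a \<and> phi a < 2 * N"
    using assms
  proof (cases rule: dart_cases)
    case (1 i)
    consider "L i < L (Suc i)" | "L (Suc i) = L i" | "L (Suc i) < L i" by linarith
    then show ?thesis
    proof cases
      case 3
      then show ?thesis using up[of "A i" a] A[OF 1(1)] A_up[OF 1(1)] 1 by simp
    qed (use 1 up[of i a] level[of i a] in simp_all)
  next
    case (2 j)
    from assms show ?thesis
    proof (cases rule: corner_cases)
      case (1 p) then show ?thesis using 2 e_neq_u by metis
    next
      case p: (2 p)
      consider "L p < L (Suc p)" | "L (Suc p) = L p" | "L (Suc p) < L p" by linarith
      then show ?thesis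
      proof cases
        \<comment> \<open>The reverse arc at the end of a descent is the second arc in the face of
          the ascending step matched with it.\<close>
        case 3
        note d = down_prev[OF p(1) 3]
        show ?thesis using up[of "prev_le L (Suc p)" a] d p by simp
      qed (use p up[of p a] level[of p a] in simp_all)
    qed
  qed
  then show "phi (phi (phi (phi a))) = a" "phi (phi a) \<noteq> a" "phi a < 2 * N" by auto
qed

lemma rv_lt: "rv a < 2 * N \<longleftrightarrow> a < 2 * N" and rv_rv: "rv (rv a) = a" and rv_neq: "a < 2 * N \<Longrightarrow> rv a \<noteq> a"
  by (auto simp: rv_def elim!: oddE evenE)

lemma rv_eq: "rv a = a \<longleftrightarrow> \<not> a < 2 * N"
proof (cases "a < 2 * N")
  case True then show ?thesis using rv_neq by simp
qed (simp add: rv_def)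

lemma rot_phi: "rot a = phi (rv a)" by (simp add: phi_def rv_rv)

lemma phi_permutes: "phi permutes {..<2 * N}"
proof (rule bij_imp_permutes)
  have "inj_on phi {..<2 * N}"
    by (rule inj_on_inverseI[where g = "phi \<circ> phi \<circ> phi"]) (simp add: phi_four_two)
  moreover have "phi ` {..<2 * N} \<subseteq> {..<2 * N}" using phi_four_two(3) by auto
  ultimately show "bij_betw phi {..<2 * N} {..<2 * N}"
    using endo_inj_surj[of "{..<2 * N}" phi] by (auto simp: bij_betw_def)
  show "phi a = a" if "a \<notin> {..<2 * N}" for a
    using that by (simp add: phi_def rv_def rot_def)
qed

lemma permutation_phi: "permutation phi"
  using phi_permutes by (auto simp: permutation_permutes)

lemma rv_permutes: "rv permutes {..<2 * N}"
proof (rule bij_imp_permutes)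
  show "bij_betw rv {..<2 * N} {..<2 * N}"
    by (rule bij_betw_byWitness[where f' = rv]) (auto simp: rv_rv rv_lt)
qed (simp add: rv_def)

lemma rot_permutes: "rot permutes {..<2 * N}"
proof -
  have "rot = phi \<circ> rv" by (rule ext) (simp add: rot_phi)
  then show ?thesis using permutes_compose[OF rv_permutes phi_permutes] by simp
qed

lemma permutation_rot: "permutation rot"
  using rot_permutes by (auto simp: permutation_permutes)

lemma rot_lt: "a < 2 * N \<Longrightarrow> rot a < 2 * N"
  using permutes_in_image[OF rot_permutes, of a] by simp

section \<open>Vertices of the constructed map\<close>

definition vert :: "nat \<Rightarrow> nat" where "vert a = Min (orbit rot a)"

lemma vert_eq: "vert a = vert b \<longleftrightarrow> b \<in> orbit rot a"
proof
  have self: "x \<in> orbit rot x" for x by (rule permutation_self_in_orbit[OF permutation_rot])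
  have min: "vert x \<in> orbit rot x" for x
    unfolding vert_def using finite_orbit[OF self] orbit_nonempty[of rot x] by (intro Min_in) auto
  assume "vert a = vert b"
  then have "vert a \<in> orbit rot b" using min[of b] by simp
  then have "b \<in> orbit rot (vert a)" by (rule orbit_swap[OF self])
  then show "b \<in> orbit rot a" using min[of a] by (rule orbit_trans)
next
  assume "b \<in> orbit rot a"
  moreover have "cyclic_on rot (orbit rot a)" by (rule cyclic_on_orbit'[OF permutation_rot])
  ultimately have "orbit rot b = orbit rot a" by (intro orbit_cyclic_eq3)
  then show "vert a = vert b" by (simp add: vert_def)
qed

lemma vert_rot [simp]: "vert (rot a) = vert a"
  using vert_eq[of a "rot a"] orbit.base[of rot a] by simp

lemma vert_rot_eq: "rot a = b \<Longrightarrow> vert b = vert a"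
  using vert_rot[of a] by simp

definition dn :: "nat \<Rightarrow> bool" where "dn a \<longleftrightarrow> a < 2 * N \<and> even a"

lemma dn_e: "dn (e i)" and not_dn_u: "\<not> dn (u i)"
  using e_lt e_even u_odd by (simp_all add: dn_def)

lemma run_vert: "run rot dn c x \<Longrightarrow> vert x = vert c"
  by (induction rule: run.induct) simp_all

text \<open>After \<open>e (Suc p)\<close> the rotation passes the reverses of the down arcs that
  arrive at this corner. They belong to the corners \<open>f\<close> after \<open>prev_le\<close>
  with label larger by one, and come in increasing order of \<open>f\<close>. All of them are odd,
  so they form a single run.\<close>

lemma run_u:
  assumes p: "p < N" "L (Suc p) < L p"
  shows "prev_le L (Suc p) < f \<Longrightarrow> f \<le> p \<Longrightarrow> L f = Suc (L (Suc p)) \<Longrightarrow> run rot dn (e (Suc p)) (u f)"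
proof (induction f rule: less_induct)
  case (less f)
  let ?j = "prev_le L (Suc p)"
  note d = down_prev[OF p]
  have "L 0 \<le> L (Suc p)" using L0 L_pos[of "Suc p"] p(1) by simp
  note between = prev_le(4)[of 0 "Suc p" L, OF _ this]
  show ?case
  proof (cases "f = Suc ?j")
    case True
    then have "rot (e (Suc p)) = u f" using rot_e(1)[OF p] by simp
    then show ?thesis using run.step[OF run.base[of dn "e (Suc p)" rot, OF dn_e]] not_dn_u by metis
  next
    case False
    then obtain g where g: "f = Suc g" "?j < g" "g < N" "g < p"
      using less.prems p(1) by (cases f) auto
    then have Lg: "L (Suc p) < L g" using between[of g] by simp
    have extend: "run rot dn (e (Suc p)) (u f)" if "run rot dn (e (Suc p)) (u k)" "rot (u k) = u f" for k
      using run.step[OF that(1)] that(2) not_dn_u by metis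
    show ?thesis
    proof (cases "L g = L f")
      case True
      then show ?thesis using less.IH[of g] less.prems g rot_u(2)[OF g(3)] by (intro extend[of g]) auto
    next
      case False
      then have dg: "L (Suc g) < L g" using Lg less.prems g(1) by simp
      \<comment> \<open>Step \<open>g\<close> descends to \<open>f\<close>; the preceding arc of the
        run then belongs to \<open>?k\<close>, the previous corner with the label of
        \<open>f\<close>.\<close>
      note dd = down_prev[OF g(3) dg]
      let ?k = "prev_le L (Suc g)"
      have "L (Suc ?j) \<le> L (Suc g)" using d(2,3) less.prems g(1) by simp
      moreover have "Suc ?j < Suc g" using g by simp
      ultimately have "Suc ?j \<le> ?k" by (intro prev_le(3))
      then have "run rot dn (e (Suc p)) (u ?k)"
        using less.IH[of ?k] dd(1,2) g less.prems by simp
      moreover have "rot (u ?k) = u f" using rot_u(3)[of ?k] dd g by simp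
      ultimately show ?thesis by (rule extend)
    qed
  qed
qed

lemma run_down:
  assumes "p < N" "L (Suc p) < L p"
  shows "run rot dn (e (Suc p)) (u p)"
  using run_u[OF assms down_prev(1)[OF assms]] slowD(2)[OF assms(1)] assms(2) by simp

text \<open>By \<open>run_u\<close>, the down arc of a corner ends at the vertex of its successor
  corner.\<close>

lemma vert_u:
  assumes f: "0 < f" "f \<le> N" "L f \<noteq> 1"
  shows "vert (u f) = vert (e (next_lower L f))" "next_lower L f \<le> N" "Suc (L (next_lower L f)) = L f"
proof -
  have lt: "L N < L f" using LN L_pos[OF f(2)] f(3) by simp
  then have fN: "f < N" using f(2) by (cases "f = N") auto
  note n = next_lower[OF fN lt]
  show "next_lower L f \<le> N" by (rule n(3))
  show l: "Suc (L (next_lower L f)) = L f" by (rule next_lower_label[OF slow fN lt])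
  obtain p where p: "next_lower L f = Suc p" using n(1) by (cases "next_lower L f") auto
  have pN: "p < N" "f \<le> p" using n(1,3) p by simp_all
  have dp: "L (Suc p) < L p" using n(4)[of p] pN p l by simp
  have "prev_le L (Suc p) < f"
  proof (rule ccontr)
    assume "\<not> ?thesis"
    then have "L f \<le> L (prev_le L (Suc p))" using n(4)[of "prev_le L (Suc p)"] down_prev(1)[OF pN(1) dp] p by simp
    then show False using down_prev(2)[OF pN(1) dp] l p by simp
  qed
  then have "run rot dn (e (Suc p)) (u f)" using run_u[OF pN(1) dp] pN(2) l p by simp
  then show "vert (u f) = vert (e (next_lower L f))" using run_vert p by simp
qed

text \<open>Corners of label 1 have no successor. The rotation links each of their reverse arcs to
  that of the preceding such corner, so all share the root vertex.\<close>

lemma vert_u_root: "f \<le> N \<Longrightarrow> L f = 1 \<Longrightarrow> vert (u f) = vert (u 0)"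
proof (induction f rule: less_induct)
  case (less f)
  show ?case
  proof (cases f)
    case (Suc g)
    then have g: "g < N" using less.prems by simp
    show ?thesis
    proof (cases "L g = 1")
      case True
      then have "vert (u g) = vert (u 0)" using less.IH[of g] Suc g by simp
      moreover have "rot (u g) = u f" using rot_u(2)[OF g] True less.prems Suc by simp
      ultimately show ?thesis using vert_rot_eq[of "u g" "u f"] by simp
    next
      case False
      then have "L (Suc g) < L g" using L_pos[of g] g less.prems Suc by simp
      note d = down_prev[OF g this]
      let ?k = "prev_le L (Suc g)"
      have "vert (u ?k) = vert (u 0)" using less.IH[of ?k] d g less.prems Suc by simp
      moreover have "rot (u ?k) = u f" using rot_u(3)[of ?k] d g Suc by simp
      ultimately show ?thesis using vert_rot_eq[of "u ?k" "u f"] by simp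
    qed
  qed simp
qed

text \<open>Corners of one tree vertex stay in one rotation orbit, so tree vertices give
  well-defined vertices of the map.\<close>

lemma vert_e: "i < N \<Longrightarrow> vert (e (Suc i)) = vert (e (A i))"
proof (cases "L (Suc i) < L i")
  case True
  assume i: "i < N"
  have "vert (u i) = vert (e (Suc i))" using run_vert[OF run_down[OF i True]] .
  then show ?thesis using vert_rot_eq[OF rot_u(1)[OF i True]] by simp
next
  case False
  assume i: "i < N"
  then show ?thesis using vert_rot_eq[OF rot_e(2)[OF i]] False by simp
qed

definition quad_graph :: "(nat, nat) pre_digraph" where
  "quad_graph = \<lparr>verts = vert ` {..<2 * N}, arcs = {..<2 * N}, tail = vert, head = \<lambda>a. vert (rv a)\<rparr>"

definition quad_map :: "(nat, nat) rooted_map" where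
  "quad_map = \<lparr>map_graph = quad_graph, map_rev = rv, map_rot = rot, infinite_face = orbit phi (u 0), root_arc = u 0\<rparr>"

lemma quad_map_simps [simp]:
  "map_graph quad_map = quad_graph" "map_rev quad_map = rv" "map_rot quad_map = rot"
  "infinite_face quad_map = orbit phi (u 0)" "root_arc quad_map = u 0"
  "map_arcs quad_map = {..<2 * N}" "map_verts quad_map = vert ` {..<2 * N}"
  "tail quad_graph = vert" "head quad_graph a = vert (rv a)"
  "arcs quad_graph = {..<2 * N}" "verts quad_graph = vert ` {..<2 * N}"
  by (simp_all add: quad_map_def quad_graph_def map_arcs_def map_verts_def)

lemma root_vertex_quad: "root_vertex quad_map = vert (u 0)"
  by (simp add: root_vertex_def)

lemma faces_quad: "map_faces quad_map = orbit phi ` {..<2 * N}"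
  by (simp add: map_faces_def phi_def)

lemma card_face: "a < 2 * N \<Longrightarrow> card (orbit phi a) = 4"
  using phi_four_two by (intro card_orbit_four)

lemma card_faces: "4 * card (map_faces quad_map) = 2 * N"
  using card_orbits[OF phi_permutes, of 4] card_face by (simp add: faces_quad)

text \<open>One corner for each tree vertex: the one at which the contour first visits it, with 0
  for the root.\<close>

definition firsts :: "nat set" where "firsts = insert 0 (Suc ` {i \<in> {0..<N}. i < A i})"

lemma firsts_lt: "i \<in> firsts \<Longrightarrow> i < N"
  using N_pos A(1) by (fastforce simp: firsts_def)

lemma card_firsts: "2 * card firsts = N + 2"
proof -
  have "card firsts = Suc (card {i \<in> {0..<N}. i < A i})"
    unfolding firsts_def by (subst card_insert_disjoint) (auto simp: card_image)
  then show ?thesis using plane_forest_card_ups[OF plane_forest] plane_forest_length[OF plane_forest] by simp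
qed

lemma vert_e_firsts:
  assumes "c \<le> N"
  shows "vert (e c) \<in> (\<lambda>i. vert (e i)) ` firsts"
proof -
  have "vert (e c) = vert (e 0) \<or> (\<exists>i\<in>{0..<N}. i < A i \<and> vert (e c) = vert (e (Suc i)))"
    using assms by (intro plane_forest_corner[OF plane_forest, where v = "\<lambda>i. vert (e i)"] vert_e) auto
  then show ?thesis by (auto simp: firsts_def)
qed

lemma verts_quad: "vert ` {..<2 * N} = insert (vert (u 0)) ((\<lambda>i. vert (e i)) ` firsts)"
proof
  show "vert ` {..<2 * N} \<subseteq> insert (vert (u 0)) ((\<lambda>i. vert (e i)) ` firsts)"
  proof
    fix w assume "w \<in> vert ` {..<2 * N}"
    then obtain a where a: "a < 2 * N" "w = vert a" by blast
    from a(1) show "w \<in> insert (vert (u 0)) ((\<lambda>i. vert (e i)) ` firsts)"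
    proof (cases rule: corner_cases)
      case (1 p) then show ?thesis using vert_e_firsts[of "Suc p"] a by simp
    next
      case (2 p)
      show ?thesis
      proof (cases "L (Suc p) = 1")
        case True then show ?thesis using vert_u_root[of "Suc p"] 2 a by simp
      next
        case False
        then show ?thesis using vert_u[of "Suc p"] vert_e_firsts[of "next_lower L (Suc p)"] 2 a by simp
      qed
    qed
  qed
  show "insert (vert (u 0)) ((\<lambda>i. vert (e i)) ` firsts) \<subseteq> vert ` {..<2 * N}"
    using e_lt u_lt by auto
qed

lemma orbit_invariant:
  assumes "\<And>a. a < 2 * N \<Longrightarrow> h (rot a) = h a" "a < 2 * N" "vert a = vert b"
  shows "h a = h b"
proof -
  have "b \<in> orbit rot a" using assms(3) by (simp add: vert_eq)
  then have "b < 2 * N \<and> h b = h a"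
    by induction (use assms(1,2) rot_lt in auto)
  then show ?thesis by simp
qed

text \<open>Orbits might still merge. A function that is invariant under \<open>rot\<close> and
  takes different values at the first corners and at the root vertex rules this out.\<close>

lemma card_verts_quad: "card (vert ` {..<2 * N}) = card firsts + 1"
proof -
  obtain v where v: "\<And>i. i < N \<Longrightarrow> v (Suc i) = v (A i)" "v 0 = 0" "v N = (0::nat)"
    "\<And>i. i < N \<Longrightarrow> i < A i \<Longrightarrow> v (Suc i) = Suc i"
  proof -
    obtain w where "\<forall>i. 0 \<le> i \<and> i < N \<longrightarrow> w (Suc i) = w (A i)" "w 0 = (0::nat)" "w N = 0"
      "\<forall>i. 0 \<le> i \<and> i < N \<and> i < A i \<longrightarrow> w (Suc i) = Suc i"
      using plane_forest_vertices[OF plane_forest] by (elim exE conjE) (rule that)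
    then show ?thesis by (intro that[of w]) simp_all
  qed
  \<comment> \<open>The tail of a down arc is the tree vertex of its corner, that of a reverse arc
    is the vertex of the successor corner. The shift by \<open>Suc\<close> keeps the value 0 free
    for the root vertex.\<close>
  define h where "h a = (if even a then Suc (v (corner a))
      else if L (corner a) = 1 then 0 else Suc (v (next_lower L (corner a))))" for a
  have he: "h (e (Suc p)) = Suc (v (Suc p))" if "p < N" for p
    using that corner_e[of "Suc p"] by (simp add: h_def e_even)
  have hu: "h (u (Suc p)) = (if L (Suc p) = 1 then 0 else Suc (v (next_lower L (Suc p))))" if "p < N" for p
    using that corner_u[of "Suc p"] u_odd[of "Suc p"] by (simp add: h_def)
  have he': "h (e i) = Suc (v i)" if "i < N" for i
    using that he[of "i - 1"] he[of "N - 1"] eN N_pos v(2,3) by (cases i) simp_all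
  have hu': "h (u i) = (if L i = 1 then 0 else Suc (v (next_lower L i)))" if "i < N" for i
    using that hu[of "i - 1"] hu[of "N - 1"] uN N_pos L0 LN by (cases i) simp_all
  have inv: "h (rot a) = h a" if a: "a < 2 * N" for a
    using a
  proof (cases rule: dart_cases)
    case (2 i)
    consider "L (Suc i) < L i" | "L (Suc i) = L i" | "L i < L (Suc i)" by linarith
    then show ?thesis
    proof cases
      case 1
      then have "L i \<noteq> 1" using L_pos[of "Suc i"] 2 by simp
      then show ?thesis
        using 1 2 rot_u(1) he'[of "A i"] A(1) hu'[of i] v(1) next_lower_down[of L i] by simp
    next
      case level: 2
      have "next_lower L i = next_lower L (Suc i)" if "L i \<noteq> 1"
        using next_lower_level[of L i N, OF level] 2 LN L_pos[of i] that by simp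
      then show ?thesis using rot_u(2)[OF 2(1) level] hu[OF 2(1)] hu'[OF 2(1)] 2 level by simp
    next
      case 3
      obtain p where p: "next_lower L (Suc i) = Suc p" "p < N" "L (Suc p) = L i" using up_next[OF 2(1) 3] by blast
      have "next_lower L i = next_lower L (next_lower L (Suc i))" if "L i \<noteq> 1"
        using next_lower_up(3)[OF slow up(1)[OF 2(1) 3] 2(1)] LN L_pos[of i] 2 that by simp
      then show ?thesis using rot_u(3)[OF 2(1) 3] hu[OF p(2)] hu'[OF 2(1)] 2 p by simp
    qed
  next
    case (1 j)
    from a show ?thesis
    proof (cases rule: corner_cases)
      case (2 p) then show ?thesis using 1 e_neq_u by simp
    next
      case p: (1 p)
      show ?thesis
      proof (cases "L (Suc p) < L p")
        case True
        note d = down_prev[OF p(1) True]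
        have "L (Suc (prev_le L (Suc p))) \<noteq> 1" using d(2,3) L_pos[of "Suc p"] p(1) by simp
        then show ?thesis
          using rot_e(1)[OF p(1) True] hu[of "prev_le L (Suc p)"] he[OF p(1)] d p by simp
      next
        case False
        then show ?thesis using rot_e(2)[OF p(1)] he'[OF A(1)[OF p(1)]] he[OF p(1)] v(1)[OF p(1)] p by simp
      qed
    qed
  qed
  have vf: "v i = i" if "i \<in> firsts" for i using that v(2,4) by (auto simp: firsts_def)
  have inj: "inj_on (\<lambda>i. vert (e i)) firsts"
  proof (rule inj_onI)
    fix i j assume ij: "i \<in> firsts" "j \<in> firsts" "vert (e i) = vert (e j)"
    have "h (e i) = h (e j)" by (rule orbit_invariant[of h, OF inv e_lt ij(3)])
    then show "i = j" using he' firsts_lt ij vf by simp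
  qed
  have "vert (u 0) \<notin> (\<lambda>i. vert (e i)) ` firsts"
  proof
    assume "vert (u 0) \<in> (\<lambda>i. vert (e i)) ` firsts"
    then obtain i where i: "i \<in> firsts" "vert (u 0) = vert (e i)" by blast
    have "h (u 0) = h (e i)" by (rule orbit_invariant[of h, OF inv u_lt i(2)])
    then show False using he'[of i] hu'[of 0] L0 firsts_lt[OF i(1)] N_pos by simp
  qed
  moreover have "finite firsts" by (simp add: firsts_def)
  ultimately show ?thesis unfolding verts_quad using card_image[OF inj] by simp
qed

section \<open>Distances and Euler's formula in the constructed map\<close>

definition lam :: "nat \<Rightarrow> nat" where
  "lam a = (if even a then L (corner a) else L (corner a) - 1)"

lemma lam_eq: "i \<le> N \<Longrightarrow> lam (e i) = L i" "i \<le> N \<Longrightarrow> lam (u i) = L i - 1"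
proof -
  have *: "corner (e i) = i \<and> corner (u i) = i \<or> i = 0 \<and> corner (e i) = N \<and> corner (u i) = N" if "i \<le> N"
    using that corner_e[of i] corner_u[of i] by (cases "i = 0") (auto simp: corner_def e_def u_def)
  show "i \<le> N \<Longrightarrow> lam (e i) = L i" "i \<le> N \<Longrightarrow> lam (u i) = L i - 1"
    using * e_even[of i] u_odd[of i] L0 LN by (auto simp: lam_def)
qed

lemma lam_rot: "a < 2 * N \<Longrightarrow> lam (rot a) = lam a"
proof -
  assume a: "a < 2 * N"
  from a show ?thesis
  proof (cases rule: dart_cases)
    case (2 i)
    consider "L (Suc i) < L i" | "L (Suc i) = L i" | "L i < L (Suc i)" by linarith
    then show ?thesis
    proof cases
      case 1
      then show ?thesis using 2 rot_u(1) lam_eq A(1)[of i] L_A[of i] slowD(2)[of i] by simp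
    next
      case 3
      obtain p where "next_lower L (Suc i) = Suc p" "p < N" "L (Suc p) = L i" using up_next[OF 2(1) 3] by blast
      then show ?thesis using 2 3 rot_u(3) lam_eq by simp
    qed (use 2 rot_u(2) lam_eq in simp)
  next
    case (1 j)
    from a show ?thesis
    proof (cases rule: corner_cases)
      case (2 p) then show ?thesis using 1 e_neq_u by simp
    next
      case p: (1 p)
      show ?thesis
      proof (cases "L (Suc p) < L p")
        case True
        then show ?thesis using rot_e(1) down_prev[OF p(1) True] lam_eq p by simp
      next
        case False
        then show ?thesis using rot_e(2) lam_eq A(1)[of p] L_A[of p] p by simp
      qed
    qed
  qed
qed

lemma lam_rv:
  assumes "a < 2 * N"
  shows "lam (rv a) \<le> Suc (lam a)" "even a \<Longrightarrow> lam a = Suc (lam (rv a))" "odd a \<Longrightarrow> lam (rv a) = Suc (lam a)"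
  using assms
  by (cases rule: dart_cases; use lam_eq L_pos rv_e rv_u e_even u_odd in force)+

lemma even_dart_exists:
  assumes "a < 2 * N" "vert a \<noteq> vert (u 0)"
  shows "\<exists>b<2 * N. even b \<and> vert b = vert a"
  using assms(1)
proof (cases rule: corner_cases)
  case (1 p) then show ?thesis using e_even e_lt by blast
next
  case (2 p)
  then have "L (Suc p) \<noteq> 1" using vert_u_root[of "Suc p"] assms(2) by auto
  then have "vert a = vert (e (next_lower L (Suc p)))" using vert_u[of "Suc p"] 2 by simp
  then show ?thesis using e_even e_lt by metis
qed

lemma rooted_planar_map_quad: "rooted_planar_map quad_map"
proof -
  have wf: "wf_digraph quad_graph" by unfold_locales (auto simp: rv_lt)
  have bi: "bidirected_digraph quad_graph rv"
    using wf by (simp add: bidirected_digraph_def bidirected_digraph_axioms_def rv_rv rv_eq)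
  let ?R = "rtrancl_on (verts quad_graph) ((arcs_ends quad_graph)\<^sup>s)"
  have arc: "(vert a, vert (rv a)) \<in> (arcs_ends quad_graph)\<^sup>s" "(vert (rv a), vert a) \<in> (arcs_ends quad_graph)\<^sup>s"
    if "a < 2 * N" for a
  proof -
    have "arc_to_ends quad_graph a \<in> arcs_ends quad_graph"
      unfolding arcs_ends_def using that by (intro imageI) simp
    then have "(vert a, vert (rv a)) \<in> arcs_ends quad_graph" by (simp add: arc_to_ends_def)
    then show "(vert a, vert (rv a)) \<in> (arcs_ends quad_graph)\<^sup>s" "(vert (rv a), vert a) \<in> (arcs_ends quad_graph)\<^sup>s"
      by (auto simp: symcl_def intro!: image_eqI)
  qed
  \<comment> \<open>Each vertex except the root vertex has a down arc, and following down arcs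
    lowers \<open>lam\<close> until the root vertex is reached.\<close>
  have root: "(vert a, vert (u 0)) \<in> ?R \<and> (vert (u 0), vert a) \<in> ?R" if "a < 2 * N" for a
    using that
  proof (induction "lam a" arbitrary: a rule: less_induct)
    case less
    show ?case
    proof (cases "vert a = vert (u 0)")
      case True then show ?thesis using u_lt[of 0] by (simp add: rtrancl_on_refl)
    next
      case False
      then obtain b where b: "b < 2 * N" "even b" "vert b = vert a"
        using even_dart_exists[OF less.prems False] by blast
      have "lam b = lam a" by (rule orbit_invariant[of lam, OF lam_rot b(1,3)])
      then have "lam (rv b) < lam a" using lam_rv(2)[OF b(1,2)] by simp
      then have IH: "(vert (rv b), vert (u 0)) \<in> ?R \<and> (vert (u 0), vert (rv b)) \<in> ?R"
        using less.hyps b(1) by (simp add: rv_lt)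
      have va: "vert a \<in> verts quad_graph" using less.prems by simp
      show ?thesis
        using converse_rtrancl_on_into_rtrancl_on[OF arc(1)[OF b(1), unfolded b(3)] conjunct1[OF IH] va]
          rtrancl_on_into_rtrancl_on[OF conjunct2[OF IH] arc(2)[OF b(1), unfolded b(3)] va] by blast
    qed
  qed
  have "Digraph_Component.connected quad_graph"
    unfolding connected_conv
  proof (intro conjI ballI)
    show "verts quad_graph \<noteq> {}" using u_lt[of 0] by auto
    fix x y assume "x \<in> verts quad_graph" "y \<in> verts quad_graph"
    then obtain a b where ab: "a < 2 * N" "x = vert a" "b < 2 * N" "y = vert b" by auto
    show "(x, y) \<in> ?R"
      using rtrancl_on_trans[OF conjunct1[OF root[OF ab(1)]] conjunct2[OF root[OF ab(3)]]] ab by simp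
  qed
  moreover have "cyclic_on rot (out_arcs quad_graph v)" if v: "v \<in> vert ` {..<2 * N}" for v
  proof -
    obtain a where a: "a < 2 * N" "v = vert a" using v by blast
    have sub: "orbit rot a \<subseteq> {..<2 * N}"
      using permutes_orbit_subset[OF rot_permutes, of a] a(1) by simp
    have "b \<in> out_arcs quad_graph v \<longleftrightarrow> b \<in> orbit rot a" for b
      using sub a(2) vert_eq[of a b] by (auto simp: out_arcs_def)
    then have "out_arcs quad_graph v = orbit rot a" by blast
    then show ?thesis using cyclic_on_orbit'[OF permutation_rot] by simp
  qed
  moreover have "fin_digraph quad_graph"
    using wf by (simp add: fin_digraph_def fin_digraph_axioms_def)
  \<comment> \<open>There are \<open>N div 2 + 2\<close> vertices, \<open>N\<close> edges and
    \<open>N div 2\<close> faces, with \<open>N\<close> even.\<close>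
  moreover have "int (card (vert ` {..<2 * N})) - int N + int (card (map_faces quad_map)) = 2"
    using card_verts_quad card_firsts card_faces by simp
  moreover have "orbit phi (u 0) \<in> map_faces quad_map" "u 0 \<in> orbit phi (u 0)"
    using u_lt[of 0] permutation_self_in_orbit[OF permutation_phi] by (simp_all add: faces_quad)
  ultimately show ?thesis
    using bi rot_permutes by (intro rooted_planar_map.intro) simp_all
qed

lemma quadrangulation_quad: "quadrangulation quad_map"
proof -
  have "map_quadrangulation quad_map"
    using card_face by (auto simp: map_quadrangulation_def face_degree_def faces_quad)
  then show ?thesis
    using rooted_planar_map_quad by (simp add: quadrangulation_def quadrangulation_axioms_def)
qed

lemma tail_dist_quad:
  assumes a: "a < 2 * N"
  shows "tail_dist quad_map a = lam a"
proof -
  interpret M: rooted_planar_map quad_map by (rule rooted_planar_map_quad)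
  \<comment> \<open>\<open>lam\<close> is constant on rotation orbits, so it induces a function on
    vertices.\<close>
  define f where "f w = lam (SOME a. a < 2 * N \<and> vert a = w)" for w
  have f: "f (vert a) = lam a" if a: "a < 2 * N" for a
  proof -
    let ?b = "SOME b. b < 2 * N \<and> vert b = vert a"
    have "?b < 2 * N \<and> vert ?b = vert a" by (rule someI[of _ a]) (use a in simp)
    then show ?thesis unfolding f_def using orbit_invariant[of lam, OF lam_rot] by blast
  qed
  have "M.d (vert a) = f (vert a)"
  proof (rule M.dist_unique)
    show "f (root_vertex quad_map) = 0"
      using f[OF u_lt] lam_eq(2)[of 0] L0 by (simp add: root_vertex_quad)
    show "f (M.dst b) \<le> Suc (f (M.src b))" if "b \<in> M.D" for b
      using that f[of b] f[of "rv b"] lam_rv(1)[of b] by (simp add: rv_lt)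
    show "\<exists>b\<in>M.D. M.src b = v \<and> f v = Suc (f (M.dst b))" if v: "v \<in> M.V" "v \<noteq> root_vertex quad_map" for v
    proof -
      obtain c where c: "c < 2 * N" "v = vert c" using v(1) by auto
      then obtain b where b: "b < 2 * N" "even b" "vert b = v"
        using even_dart_exists[OF c(1)] v(2) by (auto simp: root_vertex_quad)
      then have "f v = Suc (f (vert (rv b)))" using f[of b] f[of "rv b"] lam_rv(2)[of b] by (auto simp: rv_lt)
      then show ?thesis using b by (intro bexI[of _ b]) simp_all
    qed
    show "vert a \<in> M.V" using a by simp
  qed
  then show ?thesis using f[OF a] by (simp add: tail_dist_def)
qed

lemma down_arc_quad: "down_arc quad_map = dn"
proof
  fix a
  have "down_arc quad_map a \<longleftrightarrow> a < 2 * N \<and> tail_dist quad_map a = Suc (tail_dist quad_map (rv a))"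
    by (simp add: down_arc_def tail_dist_def)
  also have "\<dots> \<longleftrightarrow> a < 2 * N \<and> lam a = Suc (lam (rv a))"
    by (cases "a < 2 * N") (simp_all add: tail_dist_quad rv_lt)
  also have "\<dots> \<longleftrightarrow> dn a"
  proof -
    have "lam a = Suc (lam (rv a)) \<longleftrightarrow> even a" if a: "a < 2 * N"
    proof (cases "even a")
      case True then show ?thesis using lam_rv(2)[OF a] by blast
    next
      case False then show ?thesis using lam_rv(3)[OF a] by linarith
    qed
    then show ?thesis by (auto simp only: dn_def)
  qed
  finally show "down_arc quad_map a \<longleftrightarrow> dn a" .
qed

lemma tail_dist_e: "i \<le> N \<Longrightarrow> tail_dist quad_map (e i) = L i"
  using tail_dist_quad[OF e_lt] lam_eq(1) by simp

lemma codes_quad: "codes quad_map e N A (Node 1 ts)"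
proof -
  have "encodes rot rv dn (tail_dist quad_map) N e A"
    unfolding encodes_def Let_def
  proof (intro conjI allI impI)
    have "e ` {..<N} = {a. dn a}"
    proof
      show "e ` {..<N} \<subseteq> {a. dn a}" using dn_e by auto
      show "{a. dn a} \<subseteq> e ` {..<N}"
      proof
        fix a assume "a \<in> {a. dn a}"
        then have a: "a < 2 * N" "even a" by (simp_all add: dn_def)
        from a(1) show "a \<in> e ` {..<N}"
          by (cases rule: dart_cases) (use a(2) u_odd in auto)
      qed
    qed
    then show "bij_betw e {..<N} {a. dn a}"
      using e_inj by (auto simp: bij_betw_def inj_on_def)
    show "e N = e 0" by (rule eN)
    show "slow N (\<lambda>i. tail_dist quad_map (e i))"
      using slow by (simp add: slow_def tail_dist_e)
    fix i assume i: "i < N"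
    have LL: "tail_dist quad_map (e i) = L i" "tail_dist quad_map (e (Suc i)) = L (Suc i)"
      using i by (simp_all add: tail_dist_e)
    show "A i < N" by (rule A(1)[OF i])
    show "rot (rv (e i)) = e (A i)" "run rot dn (e (Suc i)) (rv (e i))"
      if "tail_dist quad_map (e (Suc i)) < tail_dist quad_map (e i)"
      using that rot_u(1)[OF i] run_down[OF i] by (simp_all add: LL rv_e)
    show "rot (rv (e i)) = rv (e (Suc i))" "rot (e (Suc i)) = e (A i)"
      if "tail_dist quad_map (e (Suc i)) = tail_dist quad_map (e i)"
      using that rot_u(2)[OF i] rot_e(2)[OF i] by (simp_all add: LL rv_e)
    assume "tail_dist quad_map (e i) < tail_dist quad_map (e (Suc i))"
    then have ups: "L i < L (Suc i)" by (simp add: LL)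
    note u = up_face[OF i ups]
    have "next_lower L (Suc i) = next_lower (\<lambda>i. tail_dist quad_map (e i)) (Suc i)"
      using up(2,3)[OF i ups] by (intro next_lower_cong[of N]) (simp_all add: tail_dist_e)
    then show "rot (rv (e i)) = rv (e (next_lower (\<lambda>i. tail_dist quad_map (e i)) (Suc i)))"
      "rot (e (next_lower (\<lambda>i. tail_dist quad_map (e i)) (Suc i))) = rv (e (Suc i))"
      "rot (e (Suc i)) = e (A i)"
      using u by (simp_all add: rv_e phi_e phi_u)
  qed
  moreover have "plane_forest A (\<lambda>i. tail_dist quad_map (e i)) 0 N ts"
    by (rule plane_forest_cong[OF plane_forest]) (simp_all add: tail_dist_e)
  ultimately show ?thesis
    by (simp add: codes_def down_arc_quad rv_u)
qed

end

lemma codes_surjective: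
  assumes wl: "well_labelled t" and n: "0 < num_edges t"
  shows "\<exists>m e N A. quadrangulation (m :: (nat, nat) rooted_map) \<and> codes m e N A t"
proof -
  obtain ts where t: "t = Node 1 ts" using wl by (cases t) (auto simp: well_labelled_def)
  obtain A L N where f: "plane_forest A L 0 N ts" "L 0 = 1" using plane_forest_exists by metis
  have "\<forall>t\<in>set ts. \<bar>int (L 0) - int (root_label t)\<bar> \<le> 1 \<and> adjacent_labels_close t"
    using wl f(2) by (simp add: well_labelled_def t)
  then have "\<forall>i. 0 \<le> i \<and> i < N \<longrightarrow> \<bar>int (L i) - int (L (Suc i))\<bar> \<le> 1"
    using plane_forest_close[OF f(1)] by blast
  then have slow: "slow N L" by (fastforce simp: slow_def)
  have "0 < L c" if c: "c \<le> N" for c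
  proof -
    \<comment> \<open>Labels agree at all corners of a vertex, so positivity need only be checked at
      the root and where vertices are discovered.\<close>
    have "L c = L 0 \<or> (\<exists>i\<in>{0..<N}. i < A i \<and> L c = L (Suc i))"
    proof (rule plane_forest_corner[OF f(1)])
      show "L (Suc i) = L (A i)" if "0 \<le> i" "i < N" for i
        using plane_forest_matching[OF f(1), of i] plane_forest_matching[OF f(1), of "A i"] that by auto
    qed (use c in auto)
    moreover have "0 < L (Suc i)" if i: "i < N" "i < A i" for i
    proof -
      have "i \<in> {j \<in> {0..<N}. j < A j \<and> L (Suc j) = L (Suc i)}" using i by simp
      then have "0 < count_list (concat (map labels ts)) (L (Suc i))"
        unfolding plane_forest_count[OF f(1)] by (auto simp: card_gt_0_iff)
      then have "L (Suc i) \<in> set (concat (map labels ts))" by (metis count_list_0_iff less_numeral_extra(3))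
      then show ?thesis using wl by (auto simp: well_labelled_def t)
    qed
    ultimately show ?thesis using f(2) by auto
  qed
  moreover have "0 < N" using plane_forest_length[OF f(1)] n by (simp add: t)
  ultimately interpret labelled_contour A L N ts
    using f slow by unfold_locales auto
  show ?thesis unfolding t by (intro exI conjI) (rule quadrangulation_quad, rule codes_quad)
qed

section \<open>Equality in law\<close>

lemma root_le_labels:
  "adjacent_labels_close t \<Longrightarrow> x \<in> set (labels t) \<Longrightarrow> x \<le> root_label t + num_edges t"
proof (induction t arbitrary: x)
  case (Node y ts)
  show ?case
  proof (cases "x = y")
    case False
    then obtain t where t: "t \<in> set ts" "x \<in> set (labels t)" using Node.prems by auto
    then have "x \<le> root_label t + num_edges t" using Node by simp
    moreover have "root_label t \<le> Suc y"
    proof -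
      have "\<bar>int y - int (root_label t)\<bar> \<le> 1" using Node.prems t(1) by simp
      then show ?thesis by linarith
    qed
    moreover have "Suc (num_edges t) \<le> num_edges (Node y ts)"
      using member_le_sum_list[of "Suc (num_edges t)" "map (\<lambda>t. Suc (num_edges t)) ts"] t(1) by simp
    ultimately show ?thesis by simp
  qed simp
qed

lemma finite_bounded_forests:
  "finite {ts :: nat plane_tree list. (\<Sum>t\<leftarrow>ts. Suc (num_edges t)) = n \<and>
     (\<forall>t\<in>set ts. set (labels t) \<subseteq> {..K})}"
proof (induction n rule: less_induct)
  case (less n)
  let ?F = "\<lambda>n. {ts :: nat plane_tree list. (\<Sum>t\<leftarrow>ts. Suc (num_edges t)) = n \<and>
     (\<forall>t\<in>set ts. set (labels t) \<subseteq> {..K})}"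
  let ?U = "\<Union>k<n. ?F k"
  have fin: "finite ?U" using less by auto
  \<comment> \<open>Removing the first root splits a forest into its children and the remaining
    trees, both with fewer edges.\<close>
  have "?F n \<subseteq> insert [] ((\<lambda>(x, us, ts). Node x us # ts) ` ({..K} \<times> ?U \<times> ?U))"
  proof
    fix ts assume ts: "ts \<in> ?F n"
    show "ts \<in> insert [] ((\<lambda>(x, us, ts). Node x us # ts) ` ({..K} \<times> ?U \<times> ?U))"
    proof (cases ts)
      case (Cons t ts')
      obtain x us where t: "t = Node x us" by (cases t)
      have "x \<in> {..K}" "us \<in> ?U" "ts' \<in> ?U" using ts unfolding Cons t by auto
      then show ?thesis unfolding Cons t
        by (intro insertI2 image_eqI[of _ _ "(x, us, ts')"]) simp_all
    qed simp
  qed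
  then show ?case by (rule finite_subset) (use fin in simp)
qed

lemma finite_well_labelled_trees: "finite (well_labelled_trees n)"
proof (rule finite_subset)
  let ?F = "{ts :: nat plane_tree list. (\<Sum>t\<leftarrow>ts. Suc (num_edges t)) = n \<and>
     (\<forall>t\<in>set ts. set (labels t) \<subseteq> {..n + 1})}"
  show "well_labelled_trees n \<subseteq> Node 1 ` ?F"
  proof
    fix t assume t: "t \<in> well_labelled_trees n"
    then have wl: "well_labelled t" and n: "num_edges t = n" by (auto simp: well_labelled_trees_def)
    obtain ts where ts: "t = Node 1 ts" using wl by (cases t) (auto simp: well_labelled_def)
    have "x \<le> n + 1" if "x \<in> set (labels t)" for x
      using root_le_labels[of t x] that wl n by (simp add: well_labelled_def)
    then show "t \<in> Node 1 ` ?F" using n unfolding ts by (intro imageI) auto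
  qed
  show "finite (Node 1 ` ?F)" by (rule finite_imageI[OF finite_bounded_forests])
qed

lemma well_labelled_trees_nonempty: "well_labelled_trees n \<noteq> {}"
proof -
  have "Node 1 (replicate n (Node 1 [])) \<in> well_labelled_trees n"
    by (simp add: well_labelled_trees_def well_labelled_def sum_list_replicate map_replicate_const)
  then show ?thesis by blast
qed

section \<open>The bijection on isomorphism classes and the transfer of laws\<close>

definition represents :: "planar_map \<Rightarrow> (nat, nat) rooted_map \<Rightarrow> bool" where
  "represents q m \<longleftrightarrow> planar_map_equiv m m \<and> q = abs_planar_map m"

definition coded_by :: "nat plane_tree \<Rightarrow> planar_map \<Rightarrow> bool" where
  "coded_by t q \<longleftrightarrow> (\<exists>m e N A. represents q m \<and> quadrangulation m \<and> codes m e N A t)"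

lemma equiv_self: "rooted_planar_map m \<Longrightarrow> planar_map_equiv m m"
  unfolding planar_map_equiv_def using rooted_map_iso_refl by blast

lemma represents_invariants:
  assumes "represents q m"
  shows "is_quadrangulation q \<longleftrightarrow> map_quadrangulation m" "num_faces q = card (map_faces m)"
    "profile q = map_profile m" "radius q = map_radius m"
  using assms by (simp_all add: represents_def is_quadrangulation.abs_eq num_faces.abs_eq
      profile.abs_eq radius.abs_eq)

lemma represents_exists: "\<exists>m. represents q m"
proof -
  have "planar_map_equiv (rep_planar_map q) (rep_planar_map q)"
    "abs_planar_map (rep_planar_map q) = q"
    using Quotient_planar_map by (simp_all add: Quotient_rep_reflp Quotient_abs_rep)
  then show ?thesis unfolding represents_def by metis
qed

lemma represents_iff_iso:
  assumes "represents q m" "represents q' m'"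
  shows "q = q' \<longleftrightarrow> (\<exists>f g. rooted_map_iso m m' f g)"
proof -
  have "q = q' \<longleftrightarrow> planar_map_equiv m m'"
    using assms Quotient_planar_map unfolding represents_def by (metis Quotient_rel)
  then show ?thesis using assms unfolding represents_def planar_map_equiv_def by auto
qed

lemma coded_by_exists:
  assumes "q \<in> quadrangulations n"
  shows "\<exists>t\<in>well_labelled_trees n. coded_by t q"
proof -
  obtain m where m: "represents q m" using represents_exists by blast
  then have "quadrangulation m"
    using assms represents_invariants[OF m]
    by (simp add: quadrangulations_def quadrangulation_def quadrangulation_axioms_def
        represents_def planar_map_equiv_def)
  then interpret quadrangulation m .
  obtain t where t: "codes m Q.contour (2 * card (map_faces m)) Q.mate t" using codes_exists by blast
  have "t \<in> well_labelled_trees n"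
    using codes_well_labelled[OF t] codesD(2)[OF t] assms represents_invariants(2)[OF m]
    by (simp add: well_labelled_trees_def quadrangulations_def)
  then show ?thesis using t m quadrangulation_axioms unfolding coded_by_def by blast
qed

lemma coded_by_surjective:
  assumes "t \<in> well_labelled_trees n" "n \<ge> 1"
  shows "\<exists>q. coded_by t q"
proof -
  obtain m :: "(nat, nat) rooted_map" and e N A where m: "quadrangulation m" "codes m e N A t"
    using codes_surjective[of t] assms by (auto simp: well_labelled_trees_def)
  then have "represents (abs_planar_map m) m"
    by (simp add: represents_def equiv_self quadrangulation.axioms(1))
  then show ?thesis using m unfolding coded_by_def by blast
qed

lemma coded_by_unique_map:
  assumes "coded_by t q" "coded_by t q'"
  shows "q = q'"
proof -
  obtain m e N A where m: "represents q m" "quadrangulation m" "codes m e N A t"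
    using assms(1) unfolding coded_by_def by blast
  obtain m' e' N' A' where m': "represents q' m'" "quadrangulation m'" "codes m' e' N' A' t"
    using assms(2) unfolding coded_by_def by blast
  show ?thesis
    using codes_same_tree_iso[OF m(2) m'(2) m(3) m'(3)] represents_iff_iso[OF m(1) m'(1)] by blast
qed

lemma coded_by_unique_tree:
  assumes "coded_by t q" "coded_by t' q"
  shows "t = t'"
proof -
  obtain m e N A where m: "represents q m" "quadrangulation m" "codes m e N A t"
    using assms(1) unfolding coded_by_def by blast
  obtain m' e' N' A' where m': "represents q m'" "quadrangulation m'" "codes m' e' N' A' t'"
    using assms(2) unfolding coded_by_def by blast
  obtain f g where iso: "rooted_map_iso m m' f g" using represents_iff_iso[OF m(1) m'(1)] by blast
  have "codes m' (g \<circ> e) N A t"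
    using codes_iso[OF _ _ iso m(3)] m(2) m'(2) by (simp add: quadrangulation.axioms(1))
  then show ?thesis using codes_unique[OF m'(2)] m'(3) by blast
qed

lemma coded_by_invariants:
  assumes "coded_by t q"
  shows "q \<in> quadrangulations (num_edges t)" "radius q = max_label t"
    "0 < k \<Longrightarrow> profile q k = label_count t k"
proof -
  obtain m e N A where m: "represents q m" "quadrangulation m" "codes m e N A t"
    using assms unfolding coded_by_def by blast
  interpret quadrangulation m by (rule m(2))
  show "q \<in> quadrangulations (num_edges t)"
    using quad codesD(2)[OF m(3)] represents_invariants[OF m(1)] by (simp add: quadrangulations_def)
  show "radius q = max_label t"
    using codes_radius[OF m(3)] represents_invariants(4)[OF m(1)] by simp
  show "0 < k \<Longrightarrow> profile q k = label_count t k"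
    using codes_profile[OF m(3)] represents_invariants(3)[OF m(1)] by simp
qed

text \<open>A bijection between finite sets carries one uniform law to the other, and the statistics
  agree tree by tree, so both identities hold without any counting of maps or trees.\<close>

theorem corollary1:
  fixes n :: nat
  assumes "n \<ge> 1"
  shows "map_pmf (\<lambda>t. \<lambda>k\<in>{1..}. label_count t k) (random_well_labelled_tree n)
           = map_pmf (\<lambda>q. \<lambda>k\<in>{1..}. profile q k) (random_quadrangulation n)
       \<and> map_pmf radius (random_quadrangulation n)
           = map_pmf max_label (random_well_labelled_tree n)"
proof -
  define T where "T = well_labelled_trees n"
  define b where "b t = (THE q. coded_by t q)" for t
  have b: "coded_by t (b t)" if t: "t \<in> T" for t
  proof -
    obtain q where q: "coded_by t q" using coded_by_surjective t assms unfolding T_def by blast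
    then show ?thesis
      unfolding b_def by (rule theI[of "coded_by t"]) (rule coded_by_unique_map[OF _ q])
  qed
  have "inj_on b T"
  proof (rule inj_onI)
    fix t t' assume t: "t \<in> T" "t' \<in> T" "b t = b t'"
    have "coded_by t' (b t)" using b[OF t(2)] t(3) by simp
    then show "t = t'" by (rule coded_by_unique_tree[OF b[OF t(1)]])
  qed
  moreover have "b ` T = quadrangulations n"
  proof
    show "b ` T \<subseteq> quadrangulations n"
      using coded_by_invariants(1)[OF b] by (auto simp: T_def well_labelled_trees_def)
    show "quadrangulations n \<subseteq> b ` T"
    proof
      fix q assume "q \<in> quadrangulations n"
      then obtain t where t: "t \<in> T" "coded_by t q" using coded_by_exists unfolding T_def by blast
      then have "q = b t" using coded_by_unique_map b by blast
      then show "q \<in> b ` T" using t(1) by blast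
    qed
  qed
  moreover have fin: "finite T" and ne: "T \<noteq> {}"
    unfolding T_def by (rule finite_well_labelled_trees well_labelled_trees_nonempty)+
  ultimately have pmf: "random_quadrangulation n = map_pmf b (random_well_labelled_tree n)"
    unfolding random_quadrangulation_def random_well_labelled_tree_def T_def[symmetric]
    by (simp add: map_pmf_of_set_inj)
  \<comment> \<open>\<open>coded_by\<close> is known only for trees in \<open>T\<close>, so the
    statistics may be exchanged only on the support of the law.\<close>
  have supp: "set_pmf (random_well_labelled_tree n) = T"
    unfolding random_well_labelled_tree_def T_def[symmetric] using ne fin by (rule set_pmf_of_set)
  have "map_pmf (\<lambda>t. \<lambda>k\<in>{1..}. label_count t k) (random_well_labelled_tree n) =
      map_pmf (\<lambda>t. \<lambda>k\<in>{1..}. profile (b t) k) (random_well_labelled_tree n)"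
    using coded_by_invariants(3)[OF b] unfolding supp[symmetric]
    by (intro map_pmf_cong refl restrict_ext) auto
  moreover have "map_pmf (\<lambda>t. radius (b t)) (random_well_labelled_tree n) =
      map_pmf max_label (random_well_labelled_tree n)"
    using coded_by_invariants(2)[OF b] unfolding supp[symmetric] by (intro map_pmf_cong refl)
  ultimately show ?thesis unfolding pmf map_pmf_comp by simp
qed

end
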